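(* Assume the Generalised Riemann Hypothesis (for Dirichlet $L$-functions). Let $s \geqslant 1$ be a fixed integer such that the following holds: for any integers $2 \leqslant h < u$ one has \[ R_{2s}(h,u) \leqslant h^{s+o(1)} \] uniformly over $u$ (with $o(1)\to 0$ as $h\to\infty$), where $R_{2s}(h,u)$ is the number of tuples $(n_1,\ldots,n_{2s}) \in (u,u+h]^{2s}$ of integers whose product $n_1\cdots n_{2s}$ is a perfect square. Let $Q$ be a real parameter and let $h,u$ be integers with $2 \leqslant h < u \leqslant Q$. Let $\boldsymbol{\alpha} = (\alpha_n)_{u< n \leqslant u+h}$ be any complex numbers with $|\alpha_n| \leqslant 1$. For a prime $p \geqslant 3$ put \[ S_p(\boldsymbol{\alpha}, u,h) = \sum_{u< n \leqslant u+h} \alpha_n \left(\frac{n}{p}\right), \qquad M_{2s}(Q; \boldsymbol{\alpha}, u,h) = \sum_{\substack{p \in [Q,2Q]\\ p~\text{prime}}} |S_p(\boldsymbol{\alpha}, u,h)|^{2s} . \] Then \[ M_{2s}(Q; \boldsymbol{\alpha}, u,h) \leqslant h^{s+o(1)}\, \pi(Q) + h^{2s} Q^{1/2+o(1)}, \] where the $o(1)$ terms tend to $0$ as $h, Q\to\infty$ (depending only on $s$), uniformly in $u$ and $\boldsymbol{\alpha}$.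
   Context: $\left(\frac{n}{p}\right)$ denotes the Legendre symbol modulo the prime $p$. $\pi(Q)$ is the number of primes $p \leqslant Q$. *)

theory Defs
  imports "HOL-Analysis.Analysis" "HOL-Number_Theory.Number_Theory" "HOL-Library.FuncSet"
begin

definition dirichlet_character :: "nat \<Rightarrow> (nat \<Rightarrow> complex) \<Rightarrow> bool" where
  "dirichlet_character q chi \<longleftrightarrow> q \<ge> 1 \<and> (\<forall>n. chi (n + q) = chi n) \<and>
     (\<forall>m n. chi (m * n) = chi m * chi n) \<and> chi 1 = 1 \<and>
     (\<forall>n. chi n = 0 \<longleftrightarrow> \<not> coprime n q)"

definition GRH :: bool where
  "GRH \<longleftrightarrow> (\<forall>q chi. dirichlet_character q chi \<longrightarrow>
     (\<exists>L. L holomorphic_on ({z. Re z > 1/2} - {1}) \<and>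
          (\<forall>z. Re z > 1 \<longrightarrow> (\<lambda>n. chi (Suc n) / of_nat (Suc n) powr z) sums L z) \<and>
          (\<forall>z. Re z > 1/2 \<and> z \<noteq> 1 \<longrightarrow> L z \<noteq> 0)))"

definition R_sq :: "nat \<Rightarrow> nat \<Rightarrow> nat \<Rightarrow> nat" where
  "R_sq k h u = card {f \<in> {..<k} \<rightarrow>\<^sub>E {u<..u+h}. \<exists>m::nat. (\<Prod>i<k. f i) = m ^ 2}"

definition prime_pi :: "real \<Rightarrow> nat" where
  "prime_pi Q = card {p::nat. prime p \<and> real p \<le> Q}"

definition S :: "(nat \<Rightarrow> complex) \<Rightarrow> nat \<Rightarrow> nat \<Rightarrow> nat \<Rightarrow> complex" where
  "S \<alpha> u h p = (\<Sum>n\<in>{u<..u+h}. \<alpha> n * of_int (Legendre (int n) (int p)))"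

definition M :: "nat \<Rightarrow> real \<Rightarrow> (nat \<Rightarrow> complex) \<Rightarrow> nat \<Rightarrow> nat \<Rightarrow> real" where
  "M k Q \<alpha> u h = (\<Sum>p\<in>{p::nat. prime p \<and> Q \<le> real p \<and> real p \<le> 2 * Q}. norm (S \<alpha> u h p) ^ k)"

end

theory Submission
  imports Defs "HOL-Probability.Probability" "HOL-Complex_Analysis.Complex_Analysis"
    "HOL-Real_Asymp.Real_Asymp"
begin

text \<open>
  Since the terms of \<open>M\<close> are nonnegative, the sharp cutoff \<open>Q \<le> p \<le> 2 Q\<close> may be replaced by the weight
  \<open>ln p * W(p/Q)\<close> with \<open>W(y) = exp (- (ln y)^2 / 4)\<close>. Expanding the \<open>2 s\<close>-th power, each tuple with product
  \<open>N\<close> contributes the weighted sum of the Legendre symbols \<open>(N/p)\<close>. If \<open>N\<close> is a square, Chebyshev's bounds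
  suffice. Otherwise reciprocity turns \<open>(N/p)\<close> into a nonprincipal real character \<open>chi\<close> modulo \<open>8 N\<close>.
  The Mellin transform of \<open>W\<close> is a Gaussian, so the sum of \<open>chi(n) Lambda(n) W(n/Q)\<close> is the integral of
  \<open>- L'/L(z) exp (z^2) Q^z\<close> along a vertical line, which may be moved to \<open>Re z = 1/2 + \<delta>\<close>. There \<open>L'/L\<close> is
  logarithmic in the modulus and linear in \<open>Im z\<close>, by the Borel-Caratheodory inequality applied to \<open>log L\<close> on
  discs centred on \<open>Re z = 2\<close>. The hypothesis \<open>GRH\<close> does not speak about the point 1, so \<open>L(1) \<noteq> 0\<close> is proved.
\<close>

section \<open>Quadratic characters\<close>

text \<open>The products \<open>N\<close> can be as large as a power of \<open>Q\<close>, so every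
  estimate has to be explicit in the modulus. A logarithmic dependence is harmless: the weight gains
  a factor of order \<open>ln Q\<close> on [Q, 2Q], and dividing by it cancels the logarithm of the
  modulus. This allows crude tools. The modulus \<open>8 N\<close> may be far from the conductor,
  and \<open>L\<close> is continued only to Re z > 0, by partial summation with the trivial bound
  for character sums. The Gaussian weight is chosen because exp(z^2) beats the linear growth of L'/L
  on vertical lines, so all integrals converge absolutely and a line can be moved at once. Working
  at distance \<delta> from the critical line costs a constant of order 1/\<delta>^2. Since \<delta>
  is fixed in terms of \<epsilon> before \<open>h\<close> and \<open>Q\<close> grow, this constant
  disappears in the o(1). The square products give Q / ln Q, which a lower Chebyshev bound turns
  into \<pi>(Q).\<close>

lemma Legendre_values: "Legendre a p \<in> {-1, 0, 1}"
  by (auto simp: Legendre_def)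

lemma Legendre_cong: "[a = b] (mod p) \<Longrightarrow> Legendre a p = Legendre b p"
proof -
  assume "[a = b] (mod p)"
  hence "[x = a] (mod p) \<longleftrightarrow> [x = b] (mod p)" "[a = x] (mod p) \<longleftrightarrow> [b = x] (mod p)" for x
    by (auto simp: cong_def)
  thus ?thesis unfolding Legendre_def QuadRes_def by simp
qed

lemma Legendre_1 [simp]: "p > 1 \<Longrightarrow> Legendre 1 p = 1"
  unfolding Legendre_def QuadRes_def by (auto simp: cong_def intro!: exI[of _ 1])

text \<open>Two such values differ by at most 2 < p. This upgrades the congruence in Euler's
  criterion to an equality.\<close>

lemma sign_values_eqI:
  fixes x y p :: int
  assumes "[x = y] (mod p)" "p > 2" "x \<in> {-1, 0, 1}" "y \<in> {-1, 0, 1}"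
  shows "x = y"
proof -
  have "p dvd x - y" using assms(1) by (simp add: cong_iff_dvd_diff)
  moreover have "\<bar>x - y\<bar> < p" using assms by auto
  ultimately show ?thesis using dvd_imp_le_int[of "x - y" p] by auto
qed

lemma Legendre_mult:
  assumes "prime (p::nat)" "p > 2"
  shows "Legendre (a * b) (int p) = Legendre a (int p) * Legendre b (int p)"
proof (rule sign_values_eqI)
  have "[Legendre a (int p) * Legendre b (int p) = a ^ ((p - 1) div 2) * b ^ ((p - 1) div 2)] (mod int p)"
    by (intro cong_mult euler_criterion assms)
  also have "a ^ ((p - 1) div 2) * b ^ ((p - 1) div 2) = (a * b) ^ ((p - 1) div 2)"
    by (simp add: power_mult_distrib)
  finally show "[Legendre (a * b) (int p) = Legendre a (int p) * Legendre b (int p)] (mod int p)"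
    using euler_criterion[OF assms, of "a * b"] by (metis cong_sym cong_trans)
  show "Legendre a (int p) * Legendre b (int p) \<in> {-1, 0, 1}"
    using Legendre_values[of a "int p"] Legendre_values[of b "int p"] by auto
qed (use assms Legendre_values in auto)

lemma Legendre_power:
  assumes "prime (p::nat)" "p > 2"
  shows "Legendre (a ^ k) (int p) = Legendre a (int p) ^ k"
  by (induction k) (use assms in \<open>auto simp: Legendre_mult\<close>)

lemma Legendre_prod:
  assumes "prime (p::nat)" "p > 2"
  shows "Legendre (\<Prod>x\<in>A. f x) (int p) = (\<Prod>x\<in>A. Legendre (f x) (int p))"
  by (induction A rule: infinite_finite_induct) (use assms in \<open>auto simp: Legendre_mult\<close>)

lemma Legendre_eq_0_iff: "Legendre a p = 0 \<longleftrightarrow> p dvd a"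
  by (auto simp: Legendre_def cong_0_iff)

section \<open>The characters modulo 4 and 8, and the value of (2/p)\<close>

definition chi4 :: "nat \<Rightarrow> int" where
  "chi4 n = (if n mod 4 = 1 then 1 else if n mod 4 = 3 then -1 else 0)"

text \<open>The even character modulo 8 of the second supplementary law, just as \<open>chi4\<close>
  carries the sign in the law of reciprocity.\<close>

definition chi8 :: "nat \<Rightarrow> int" where
  "chi8 n = (if n mod 8 \<in> {1, 7} then 1 else if n mod 8 \<in> {3, 5} then -1 else 0)"

lemma chi4_mod: "chi4 (k mod 4) = chi4 k"
  by (simp add: chi4_def)

lemma chi8_mod: "chi8 (k mod 8) = chi8 k"
  by (simp add: chi8_def)

lemma chi4_mult: "chi4 (m * n) = chi4 m * chi4 n"
proof -
  have "chi4 (a * b) = chi4 a * chi4 b" if "a \<in> {0,1,2,3}" "b \<in> {0,1,2,3}" for a b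
    using that by (elim insertE emptyE) (simp_all add: chi4_def)
  moreover have "k mod 4 \<in> {0,1,2,3}" for k :: nat by (simp, presburger)
  ultimately have "chi4 ((m mod 4) * (n mod 4)) = chi4 (m mod 4) * chi4 (n mod 4)" by blast
  thus ?thesis by (metis chi4_mod mod_mult_eq)
qed

lemma chi8_mult: "chi8 (m * n) = chi8 m * chi8 n"
proof -
  have "chi8 (a * b) = chi8 a * chi8 b" if "a \<in> {0,1,2,3,4,5,6,7}" "b \<in> {0,1,2,3,4,5,6,7}" for a b
    using that by (elim insertE emptyE) (simp_all add: chi8_def)
  moreover have "k mod 8 \<in> {0,1,2,3,4,5,6,7}" for k :: nat by (simp, presburger)
  ultimately have "chi8 ((m mod 8) * (n mod 8)) = chi8 (m mod 8) * chi8 (n mod 8)" by blast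
  thus ?thesis by (metis chi8_mod mod_mult_eq)
qed

lemma chi4_odd: "odd n \<Longrightarrow> chi4 n = (-1) ^ ((n - 1) div 2)"
proof -
  assume "odd n"
  hence "n mod 4 = 1 \<or> n mod 4 = 3" by presburger
  thus ?thesis
  proof
    assume *: "n mod 4 = 1"
    hence "even ((n - 1) div 2)" by presburger
    thus ?thesis using * by (simp add: chi4_def)
  next
    assume *: "n mod 4 = 3"
    hence "odd ((n - 1) div 2)" by presburger
    thus ?thesis using * by (simp add: chi4_def)
  qed
qed

lemma odd_mod_8: "odd (n::nat) \<Longrightarrow> n mod 8 \<in> {1, 3, 5, 7}"
  by (auto, presburger)

text \<open>By Gauss's lemma the symbol is the parity of the number of doubled residues 2y, with y
  \<le> (p-1)/2, that exceed (p-1)/2. That parity depends only on p modulo 8.\<close>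

lemma Legendre_2:
  assumes p: "prime (p::nat)" "p > 2"
  shows "Legendre 2 (int p) = chi8 p"
proof -
  have odd: "odd p" using p prime_odd_nat by blast
  have "\<not> int p dvd 2" using p by (auto dest: zdvd_imp_le)
  then interpret GAUSS p 2
    using p by unfold_locales (auto simp: cong_0_iff)
  \<comment> \<open>Doubling a residue in the lower half never wraps around modulo p, so the
    exceptional set \<open>E\<close> of Gauss's lemma is explicit.\<close>
  have "E = (\<lambda>y. 2 * y) ` {(int p - 1) div 4<..(int p - 1) div 2}"
  proof (intro equalityI subsetI)
    fix x assume "x \<in> E"
    then obtain y where y: "0 < y" "y \<le> (int p - 1) div 2" "x = (y * 2) mod int p" "(int p - 1) div 2 < x"
      unfolding E_def C_def B_def A_def by auto
    have "y * 2 < int p" using y(2) by linarith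
    hence "x = 2 * y" using y by simp
    thus "x \<in> (\<lambda>y. 2 * y) ` {(int p - 1) div 4<..(int p - 1) div 2}"
      using y by (intro image_eqI[of _ _ y]) auto
  next
    fix x assume "x \<in> (\<lambda>y. 2 * y) ` {(int p - 1) div 4<..(int p - 1) div 2}"
    then obtain y where y: "x = 2 * y" "(int p - 1) div 4 < y" "y \<le> (int p - 1) div 2" by auto
    have "0 < y" using y p by linarith
    have "y * 2 < int p" using y by linarith
    hence "x = (y * 2) mod int p" using y \<open>0 < y\<close> by simp
    moreover have "(int p - 1) div 2 < x" using y odd by linarith
    moreover have "y \<in> A" unfolding A_def using y \<open>0 < y\<close> by simp
    ultimately show "x \<in> E"
      unfolding E_def C_def B_def by blast
  qed
  hence "card E = nat ((int p - 1) div 2 - (int p - 1) div 4)"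
    by (simp add: card_image inj_on_def)
  moreover have "nat ((int p - 1) div 2 - (int p - 1) div 4) = (p - 1) div 2 - (p - 1) div 4"
  proof -
    have "int p - 1 = int (p - 1)" using p by simp
    hence eq: "(int p - 1) div 2 = int ((p - 1) div 2)" "(int p - 1) div 4 = int ((p - 1) div 4)"
      by (simp_all only: zdiv_int of_nat_numeral)
    have "nat (int a - int b) = a - b" for a b by simp
    thus ?thesis unfolding eq .
  qed
  moreover have "p mod 8 \<in> {1, 3, 5, 7}" using odd by (rule odd_mod_8)
  moreover have "even ((n - 1) div 2 - (n - 1) div 4)" if "n mod 8 = 1 \<or> n mod 8 = 7" for n :: nat
  proof -
    have "n = 8 * (n div 8) + n mod 8" by simp
    with that obtain k where "n = 8 * k + 1 \<or> n = 8 * k + 7" by metis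
    moreover have "(8 * k + 7 - 1) div 4 = 2 * k + 1" "(8 * k + 7 - 1) div 2 = 4 * k + 3"
      "(8 * k + 1 - 1) div 4 = 2 * k" "(8 * k + 1 - 1) div 2 = 4 * k" by simp_all
    ultimately show ?thesis by (elim disjE) (simp_all only:, simp_all)
  qed
  moreover have "odd ((n - 1) div 2 - (n - 1) div 4)" if "n mod 8 = 3 \<or> n mod 8 = 5" for n :: nat
  proof -
    have "n = 8 * (n div 8) + n mod 8" by simp
    with that obtain k where "n = 8 * k + 3 \<or> n = 8 * k + 5" by metis
    moreover have "(8 * k + 3 - 1) div 4 = 2 * k" "(8 * k + 3 - 1) div 2 = 4 * k + 1"
      "(8 * k + 5 - 1) div 4 = 2 * k + 1" "(8 * k + 5 - 1) div 2 = 4 * k + 2" by simp_all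
    ultimately show ?thesis by (elim disjE) (simp_all only:, simp_all)
  qed
  ultimately have mod8: "p mod 8 \<in> {1, 3, 5, 7}"
    and par: "p mod 8 = 1 \<or> p mod 8 = 7 \<Longrightarrow> even (card E)" "p mod 8 = 3 \<or> p mod 8 = 5 \<Longrightarrow> odd (card E)"
    by metis+
  from mod8 consider "p mod 8 = 1 \<or> p mod 8 = 7" | "p mod 8 = 3 \<or> p mod 8 = 5" by auto
  thus ?thesis
  proof cases
    case 1
    hence "Legendre 2 (int p) = 1" using par(1) gauss_lemma by simp
    moreover have "chi8 p = 1" using 1 by (auto simp: chi8_def)
    ultimately show ?thesis by simp
  next
    case 2
    hence "Legendre 2 (int p) = -1" using par(2) gauss_lemma by simp
    moreover have "chi8 p = -1" using 2 by (auto simp: chi8_def)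
    ultimately show ?thesis by simp
  qed
qed

text \<open>Quadratic reciprocity makes \<open>p \<mapsto> (q/p)\<close>, for prime \<open>q\<close>, the restriction to primes of a
  completely multiplicative function with period \<open>8 q\<close>.\<close>

definition recip :: "nat \<Rightarrow> nat \<Rightarrow> int" where
  "recip q n = (if q = 2 then chi8 n else Legendre (int n) (int q) * chi4 n ^ ((q - 1) div 2))"

lemma recip_mult:
  assumes "prime q"
  shows "recip q (m * n) = recip q m * recip q n"
proof (cases "q = 2")
  case False
  hence "q > 2" using prime_ge_2_nat[OF assms] by simp
  thus ?thesis using False assms
    by (simp add: recip_def Legendre_mult chi4_mult power_mult_distrib)
qed (simp add: recip_def chi8_mult)

lemma recip_periodic: "q dvd N \<Longrightarrow> recip q (n + 8 * N) = recip q n"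
proof -
  assume "q dvd N"
  have "(n + 8 * N) mod 8 = n mod 8" by simp
  hence "chi8 (n + 8 * N) = chi8 n" by (metis chi8_mod)
  moreover have "(n + 8 * N) mod 4 = n mod 4" by presburger
  hence "chi4 (n + 8 * N) = chi4 n" by (metis chi4_mod)
  moreover have "Legendre (int (n + 8 * N)) (int q) = Legendre (int n) (int q)"
    using \<open>q dvd N\<close> by (intro Legendre_cong) (auto simp: cong_iff_dvd_diff)
  ultimately show ?thesis unfolding recip_def by (simp only:)
qed

lemma recip_values:
  assumes "prime q" "odd n" "\<not> q dvd n"
  shows "recip q n \<in> {-1, 1}"
proof -
  have "n mod 8 \<in> {1, 3, 5, 7}" using assms(2) by (rule odd_mod_8)
  hence "chi8 n \<in> {-1, 1}" by (auto simp: chi8_def)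
  moreover have "chi4 n \<in> {-1, 1}" using assms(2) by (simp add: chi4_odd minus_one_power_iff)
  moreover have "Legendre (int n) (int q) \<in> {-1, 1}"
    using Legendre_values[of "int n" "int q"] assms(3) Legendre_eq_0_iff[of "int n" "int q"] by auto
  ultimately show ?thesis by (cases "even ((q - 1) div 2)") (auto simp: recip_def)
qed

lemma recip_eq_Legendre:
  assumes "prime q" "prime p" "p > 2" "p \<noteq> q"
  shows "recip q p = Legendre (int q) (int p)"
proof (cases "q = 2")
  case True
  thus ?thesis using Legendre_2[of p] assms by (simp add: recip_def)
next
  case False
  hence q: "q > 2" using prime_ge_2_nat[OF assms(1)] by simp
  have odd: "odd p" using assms prime_odd_nat by blast
  have "Legendre (int p) (int q) * Legendre (int q) (int p) = (-1) ^ ((p - 1) div 2 * ((q - 1) div 2))"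
    using Quadratic_Reciprocity[of p q] assms q by blast
  moreover have "chi4 p ^ ((q - 1) div 2) = (-1) ^ ((p - 1) div 2 * ((q - 1) div 2))"
    using odd by (simp add: chi4_odd power_mult)
  moreover have "Legendre (int p) (int q) \<in> {-1, 0, 1}" "Legendre (int q) (int p) \<in> {-1, 0, 1}"
    by (rule Legendre_values)+
  moreover have "(-1) ^ ((p - 1) div 2 * ((q - 1) div 2)) \<in> {-1, 1 :: int}"
    by (simp add: minus_one_power_iff)
  \<comment> \<open>A nonzero product makes \<open>a\<close> a sign, hence its own inverse; this
    moves the symbol (p/q) to the other side of reciprocity.\<close>
  moreover have "b = a * e" if "a * b = e" "a \<in> {-1, 0, 1}" "b \<in> {-1, 0, 1}" "e \<in> {-1, 1}" for a b e :: int
    using that by auto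
  ultimately show ?thesis using False unfolding recip_def by metis
qed

text \<open>A Kronecker symbol (N/n), cut off to vanish exactly where n shares a factor with 2N, as
  \<open>dirichlet_character\<close> demands for modulus 8N. Primes of even multiplicity stay in the
  modulus, so the character is in general imprimitive.\<close>

definition quad_char :: "nat \<Rightarrow> nat \<Rightarrow> int" where
  "quad_char N n = (if coprime n (2 * N) then \<Prod>q\<in>prime_factors N. recip q n ^ multiplicity q N else 0)"

lemma quad_char_values: "quad_char N n \<in> {-1, 0, 1}"
  and quad_char_nonzero: "coprime n (2 * N) \<Longrightarrow> quad_char N n \<noteq> 0"
proof -
  have *: "(\<Prod>q\<in>prime_factors N. recip q n ^ multiplicity q N) \<in> {-1, 1}" if "coprime n (2 * N)"
  proof -
    have "(\<Prod>q\<in>A. recip q n ^ multiplicity q N) \<in> {-1, 1}" if "A \<subseteq> prime_factors N" for A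
      using finite_subset[OF that finite_set_mset] that
    proof (induction A rule: finite_induct)
      case (insert q A)
      have q: "prime q" "q dvd N" using insert by auto
      have "\<not> q dvd n"
        using \<open>coprime n (2 * N)\<close> q by (metis coprime_common_divisor coprime_mult_right_iff not_prime_unit)
      moreover have "odd n" using \<open>coprime n (2 * N)\<close> by auto
      ultimately have "recip q n \<in> {-1, 1}" using recip_values q by blast
      thus ?case using insert by (cases "even (multiplicity q N)") auto
    qed auto
    thus ?thesis by blast
  qed
  show "quad_char N n \<in> {-1, 0, 1}" using * by (auto simp: quad_char_def)
  show "quad_char N n \<noteq> 0" if "coprime n (2 * N)" using *[OF that] unfolding quad_char_def if_P[OF that] by force
qed

lemma quad_char_mult: "quad_char N (m * n) = quad_char N m * quad_char N n"
proof -
  have "(\<Prod>q\<in>prime_factors N. recip q (m * n) ^ multiplicity q N) =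
      (\<Prod>q\<in>prime_factors N. recip q m ^ multiplicity q N) * (\<Prod>q\<in>prime_factors N. recip q n ^ multiplicity q N)"
    unfolding prod.distrib [symmetric]
    by (intro prod.cong refl) (auto simp: recip_mult power_mult_distrib in_prime_factors_iff)
  thus ?thesis unfolding quad_char_def by auto
qed

lemma coprime_8_iff: "coprime n (8 * N) \<longleftrightarrow> coprime n (2 * (N::nat))"
proof -
  have "coprime n 8 \<longleftrightarrow> coprime n (2 ^ 3)" by simp
  also have "\<dots> \<longleftrightarrow> coprime n 2" by (subst coprime_power_right_iff) auto
  finally show ?thesis by (simp add: coprime_mult_right_iff)
qed

text \<open>The factor 8 of the modulus serves \<open>chi8\<close> and \<open>chi4\<close>, the
  factor N serves the Legendre symbols modulo the primes dividing N.\<close>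

lemma dirichlet_character_quad_char:
  assumes "N > 0"
  shows "dirichlet_character (8 * N) (\<lambda>n. complex_of_real (of_int (quad_char N n)))"
  unfolding dirichlet_character_def
proof (intro conjI allI)
  fix m n
  have eq: "n + 8 * N = 4 * (2 * N) + n" by simp
  have cop: "coprime (n + 8 * N) (2 * N) \<longleftrightarrow> coprime n (2 * N)"
    unfolding coprime_iff_gcd_eq_1 eq by (metis gcd.commute gcd_add_mult)
  have "quad_char N (n + 8 * N) = quad_char N n"
    unfolding quad_char_def cop by (auto intro!: prod.cong simp: recip_periodic in_prime_factors_iff)
  thus "complex_of_real (of_int (quad_char N (n + 8 * N))) = complex_of_real (of_int (quad_char N n))" by simp
  show "complex_of_real (of_int (quad_char N (m * n))) =
      complex_of_real (of_int (quad_char N m)) * complex_of_real (of_int (quad_char N n))"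
    by (simp add: quad_char_mult)
  have "recip q 1 = 1" if "prime q" for q
    using prime_gt_1_nat[OF that] by (simp add: recip_def chi8_def chi4_def)
  hence "quad_char N 1 = 1" by (simp add: quad_char_def in_prime_factors_iff)
  thus "complex_of_real (of_int (quad_char N 1)) = 1" by simp
  show "(complex_of_real (of_int (quad_char N n)) = 0) = (\<not> coprime n (8 * N))"
    unfolding coprime_8_iff of_real_eq_0_iff of_int_eq_0_iff
    by (metis quad_char_def quad_char_nonzero)
qed (use assms in auto)

lemma quad_char_eq_Legendre:
  assumes "N > 0" "prime p" "p > 2"
  shows "quad_char N p = Legendre (int N) (int p)"
proof (cases "p dvd N")
  case True
  hence "\<not> coprime p (2 * N)" using assms
    by (metis coprime_absorb_left dvd_mult not_prime_unit)
  moreover have "Legendre (int N) (int p) = 0" using True by (simp add: Legendre_eq_0_iff)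
  ultimately show ?thesis unfolding quad_char_def by (simp only: if_False)
next
  case False
  have "coprime p 2" using assms by (simp add: prime_odd_nat)
  moreover have "coprime p N" using False assms by (simp add: prime_imp_coprime)
  ultimately have cop: "coprime p (2 * N)" by simp
  have "int N = (\<Prod>q\<in>prime_factors N. int q ^ multiplicity q N)"
    by (subst prime_factorization_nat[OF assms(1)]) simp
  hence "Legendre (int N) (int p) = (\<Prod>q\<in>prime_factors N. Legendre (int q) (int p) ^ multiplicity q N)"
    by (simp add: Legendre_prod Legendre_power assms)
  also have "\<dots> = (\<Prod>q\<in>prime_factors N. recip q p ^ multiplicity q N)"
    using False assms by (intro prod.cong refl, subst recip_eq_Legendre) (auto simp: in_prime_factors_iff)
  finally show ?thesis using cop by (simp add: quad_char_def)
qed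

text \<open>Squaring identifies 1 and p-1, so on the finite set of nonzero residues it is not
  injective, hence not surjective. Any missed value is a nonresidue.\<close>

lemma ex_nonresidue:
  assumes "prime (p::nat)" "p > 2"
  shows "\<exists>a::nat. Legendre (int a) (int p) = -1"
proof -
  define f where "f = (\<lambda>x::nat. x ^ 2 mod p)"
  have img: "f ` {1..p-1} \<subseteq> {1..p-1}"
  proof safe
    fix x assume "x \<in> {1..p-1}"
    hence "\<not> p dvd x" using assms by (auto dest!: dvd_imp_le)
    hence "\<not> p dvd x ^ 2" using assms prime_dvd_power by blast
    hence "x ^ 2 mod p \<noteq> 0" by (simp add: dvd_eq_mod_eq_0)
    moreover have "x ^ 2 mod p < p" using assms by simp
    ultimately show "f x \<in> {1..p-1}" unfolding f_def by simp
  qed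
  have "\<not> inj_on f {1..p-1}"
  proof
    assume inj: "inj_on f {1..p-1}"
    have "(p - 1) ^ 2 = p * (p - 2) + 1"
    proof -
      obtain k where "p = k + 2" using assms(2) by (metis add.commute le_Suc_ex less_imp_le)
      thus ?thesis by (simp add: power2_eq_square)
    qed
    hence "f (p - 1) = f 1" unfolding f_def using assms by (simp only: mod_mult_self4 power_one)
    hence "p - 1 = 1" using inj assms by (auto simp: inj_on_def)
    thus False using assms by simp
  qed
  hence "f ` {1..p-1} \<noteq> {1..p-1}"
    using eq_card_imp_inj_on[of "{1..p-1}" f] by auto
  then obtain a where a: "a \<in> {1..p-1}" "a \<notin> f ` {1..p-1}" using img by blast
  have "\<not> QuadRes (int p) (int a)"
  proof
    assume "QuadRes (int p) (int a)"
    then obtain y where y: "[y ^ 2 = int a] (mod int p)" unfolding QuadRes_def by auto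
    define x where "x = nat (y mod int p)"
    have x: "int x = y mod int p" unfolding x_def using assms by simp
    have "[int x ^ 2 = int a] (mod int p)"
      using y unfolding x by (metis cong_def power_mod)
    hence "[x ^ 2 = a] (mod p)" by (metis cong_int_iff of_nat_power)
    moreover have "a < p" using a(1) assms(2) by auto
    ultimately have fx: "f x = a" unfolding f_def cong_def by simp
    moreover have "x < p" unfolding x_def using assms by (simp add: nat_less_iff)
    moreover have "x \<noteq> 0" using fx a unfolding f_def by (intro notI) auto
    ultimately show False using a by auto
  qed
  moreover have "\<not> int p dvd int a" using a by (auto dest!: dvd_imp_le)
  ultimately have "Legendre (int a) (int p) = -1" by (simp add: Legendre_def cong_0_iff)
  thus ?thesis by blast
qed

lemma nonsquare_odd_multiplicity:
  assumes "(N::nat) > 0" "\<not> (\<exists>m. N = m ^ 2)"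
  shows "\<exists>q\<in>prime_factors N. odd (multiplicity q N)"
proof (rule ccontr)
  assume "\<not> ?thesis"
  hence "(\<Prod>q\<in>prime_factors N. q ^ multiplicity q N) = (\<Prod>q\<in>prime_factors N. (q ^ (multiplicity q N div 2)) ^ 2)"
    by (intro prod.cong refl) (auto simp flip: power_mult)
  hence "N = (\<Prod>q\<in>prime_factors N. q ^ (multiplicity q N div 2)) ^ 2"
    using prime_factorization_nat[OF assms(1)] by (simp add: prod_power_distrib)
  thus False using assms(2) by blast
qed

text \<open>A nonsquare has a prime q of odd multiplicity. The Chinese remainder theorem gives an n
  at which the factor of q is -1 and the factors of all other primes are 1; the odd exponent
  preserves the sign.\<close>

lemma quad_char_nonprincipal:
  assumes N: "N > 0" "\<not> (\<exists>m. N = m ^ 2)"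
  shows "\<exists>n. quad_char N n = -1"
proof -
  obtain q where q: "q \<in> prime_factors N" "odd (multiplicity q N)"
    using nonsquare_odd_multiplicity[OF N] by blast
  hence qp: "prime q" "q dvd N" by auto
  define r where "r = multiplicity q N"
  obtain N' where N': "N = q ^ r * N'" "\<not> q dvd N'"
    using multiplicity_decompose'[of N q] N qp unfolding r_def by (metis not_prime_unit not_gr_zero)
  have other: "p dvd N'" if "p \<in> prime_factors N" "p \<noteq> q" for p
  proof -
    have p: "prime p" "p dvd q ^ r * N'" using that N' by auto
    moreover have "\<not> p dvd q ^ r"
      using p(1) qp(1) that(2) by (meson prime_dvd_power primes_dvd_imp_eq)
    ultimately show ?thesis by (simp add: prime_dvd_mult_iff)
  qed
  obtain n where n: "recip q n = -1" "odd n" "\<And>p. p \<in> prime_factors N \<Longrightarrow> p \<noteq> q \<Longrightarrow> recip p n = 1"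
      "coprime n N'" "\<not> q dvd n"
  proof (cases "q = 2")
    case True
    have "coprime 8 N'"
    proof -
      have "coprime (2 ^ 3) N'" using N' True by (simp only: coprime_power_left_iff) simp
      thus ?thesis by simp
    qed
    \<comment> \<open>The class 5 modulo 8 has \<open>chi8\<close> equal to -1, but it is 1 modulo
      4, so that \<open>chi4\<close> does not disturb the other primes.\<close>
    then obtain n where n: "[n = 5] (mod 8)" "[n = 1] (mod N')"
      using binary_chinese_remainder_nat[of 8 N' 5 1] by auto
    have n8: "n mod 8 = 5" using n(1) by (simp add: cong_def)
    hence n4: "n mod 4 = 1" "odd n" by presburger+
    have "recip p n = 1" if "p \<in> prime_factors N" "p \<noteq> q" for p
    proof -
      have "[n = 1] (mod p)" using n(2) other[OF that] by (rule cong_dvd_modulus_nat)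
      hence "Legendre (int n) (int p) = Legendre 1 (int p)"
        by (intro Legendre_cong) (metis cong_int_iff of_nat_1)
      thus ?thesis using that True n4 prime_gt_1_nat[of p] by (simp add: recip_def chi4_def in_prime_factors_iff)
    qed
    moreover have "coprime n N'" using n(2) by (metis cong_imp_coprime cong_sym coprime_1_left)
    ultimately show ?thesis using that[of n] n8 n4 True by (simp add: recip_def chi8_def)
  next
    case False
    hence q2: "q > 2" using prime_ge_2_nat[OF qp(1)] by simp
    obtain a where a: "Legendre (int a) (int q) = -1" using ex_nonresidue[OF qp(1) q2] by blast
    have "coprime q (8 * N')"
    proof -
      have "coprime q 2" using qp q2 by (simp add: prime_odd_nat)
      hence "coprime q (2 ^ 3)" by (simp only: coprime_power_right_iff) simp
      moreover have "coprime q N'" using N' qp by (simp add: prime_imp_coprime)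
      ultimately show ?thesis by simp
    qed
    \<comment> \<open>The class 1 modulo 8 makes all \<open>chi4\<close> and \<open>chi8\<close>
      trivial, which leaves the nonresidue modulo q as the only source of a sign.\<close>
    then obtain n where n: "[n = a] (mod q)" "[n = 1] (mod (8 * N'))"
      using binary_chinese_remainder_nat[of q "8 * N'" a 1] by auto
    have "[n = 1] (mod 8)" using n(2) by (rule cong_dvd_modulus_nat) simp
    hence n8: "n mod 8 = 1" by (simp add: cong_def)
    hence n4: "n mod 4 = 1" "odd n" by presburger+
    have n': "[n = 1] (mod N')" using n(2) by (rule cong_dvd_modulus_nat) simp
    have "recip p n = 1" if "p \<in> prime_factors N" "p \<noteq> q" for p
    proof -
      have "[n = 1] (mod p)" using n' other[OF that] by (rule cong_dvd_modulus_nat)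
      hence "Legendre (int n) (int p) = Legendre 1 (int p)"
        by (intro Legendre_cong) (metis cong_int_iff of_nat_1)
      thus ?thesis using that n4 n8 prime_gt_1_nat[of p]
        by (simp add: recip_def chi4_def chi8_def in_prime_factors_iff)
    qed
    moreover have "coprime n N'" using n' by (metis cong_imp_coprime cong_sym coprime_1_left)
    moreover have Lq: "Legendre (int n) (int q) = -1"
      using a Legendre_cong[of "int n" "int a" "int q"] n(1) by (simp add: cong_int_iff)
    moreover have "\<not> q dvd n" using Lq Legendre_eq_0_iff[of "int n" "int q"] by auto
    ultimately show ?thesis using that[of n] n4 False by (simp add: recip_def chi4_def)
  qed
  have "coprime n (2 * N)"
  proof -
    have "coprime n q" using n(5) qp by (metis coprime_commute prime_imp_coprime)
    thus ?thesis using n(2,4) unfolding N'(1) by simp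
  qed
  hence "quad_char N n = (\<Prod>p\<in>prime_factors N. recip p n ^ multiplicity p N)"
    by (simp add: quad_char_def)
  also have "\<dots> = recip q n ^ multiplicity q N * (\<Prod>p\<in>prime_factors N - {q}. recip p n ^ multiplicity p N)"
    using q by (intro prod.remove) auto
  also have "(\<Prod>p\<in>prime_factors N - {q}. recip p n ^ multiplicity p N) = 1"
    by (rule prod.neutral) (use n(3) in auto)
  finally show ?thesis using n(1) q(2) by auto
qed

section \<open>Chebyshev bounds and the Gaussian weight\<close>

definition psi :: "nat \<Rightarrow> real" where
  "psi n = (\<Sum>k=1..n. mangoldt k)"

text \<open>Legendre's formula. Passing from n to n + 1 raises \<open>n div k\<close> by one exactly
  when k divides n + 1, and the von Mangoldt function sums to \<open>ln (n + 1)\<close> over these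
  k.\<close>

lemma ln_fact_eq_sum_mangoldt:
  "ln (fact n :: real) = (\<Sum>k=1..n. mangoldt k * real (n div k))"
proof (induction n)
  case (Suc n)
  have dv: "{d. d dvd Suc n} = {k \<in> {1..Suc n}. k dvd Suc n}"
    by (auto dest: dvd_imp_le intro!: Suc_leI Nat.gr0I)
  have "(\<Sum>k=1..Suc n. mangoldt k * real (Suc n div k)) =
        (\<Sum>k=1..Suc n. mangoldt k * real (n div k) + (if k dvd Suc n then mangoldt k else 0))"
    by (intro sum.cong) (auto simp: div_Suc dvd_eq_mod_eq_0 algebra_simps)
  also have "\<dots> = (\<Sum>k=1..n. mangoldt k * real (n div k)) + (\<Sum>d | d dvd Suc n. mangoldt d)"
  proof -
    have "(\<Sum>k=1..Suc n. if k dvd Suc n then mangoldt k else 0 :: real) = (\<Sum>d | d dvd Suc n. mangoldt d)"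
      unfolding dv by (rule sum.inter_filter [symmetric]) simp
    thus ?thesis unfolding sum.distrib by simp
  qed
  also have "(\<Sum>d | d dvd Suc n. mangoldt d) = ln (real (Suc n))"
    using mangoldt_sum[of "Suc n", where 'a = real] by simp
  also have "(\<Sum>k=1..n. mangoldt k * real (n div k)) = ln (fact n :: real)"
    using Suc.IH by simp
  finally show ?case
    by (simp add: ln_mult fact_gt_zero)
qed auto

text \<open>The coefficient of each \<open>mangoldt k\<close> is 0 or 1, and it is 1 for n < k \<le>
  2n. The first fact bounds \<open>psi\<close> from below, the second bounds it from above.\<close>

lemma ln_central_binomial:
  "ln (real ((2 * n) choose n)) =
     (\<Sum>k=1..2*n. mangoldt k * (real (2 * n div k) - 2 * real (n div k)))"
proof -
  have "real ((2 * n) choose n) = fact (2 * n) / (fact n * fact n)"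
    by (simp add: binomial_fact mult_2)
  hence "ln (real ((2 * n) choose n)) = ln (fact (2 * n) :: real) - 2 * ln (fact n :: real)"
    by (simp add: ln_div ln_mult fact_gt_zero)
  moreover have "(\<Sum>k=1..n. mangoldt k * real (n div k)) = (\<Sum>k=1..2*n. mangoldt k * real (n div k) :: real)"
    by (rule sum.mono_neutral_left) auto
  ultimately show ?thesis
    by (simp add: ln_fact_eq_sum_mangoldt sum_subtractf sum_distrib_left[symmetric] right_diff_distrib mult.left_commute[of _ 2])
qed

lemma div_double_bounds:
  fixes n k :: nat
  assumes "k > 0"
  shows "2 * (n div k) \<le> 2 * n div k" "2 * n div k \<le> 2 * (n div k) + 1"
proof -
  show "2 * (n div k) \<le> 2 * n div k"
    using assms by (simp add: less_eq_div_iff_mult_less_eq)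
  have "n < k * Suc (n div k)"
    using assms by (metis mult.commute dividend_less_times_div mult_Suc_right)
  hence "2 * n < Suc (2 * (n div k) + 1) * k"
    by (simp add: algebra_simps)
  thus "2 * n div k \<le> 2 * (n div k) + 1"
    using assms by (metis less_mult_imp_div_less less_Suc_eq_le)
qed

lemma psi_double_le: "psi (2 * n) \<le> psi n + 2 * real n * ln 2"
proof -
  have "psi (2 * n) = psi n + (\<Sum>k\<in>{n<..2*n}. mangoldt k)"
    unfolding psi_def
    by (subst sum.union_disjoint [symmetric]) (auto intro!: sum.cong)
  moreover have "(\<Sum>k\<in>{n<..2*n}. mangoldt k) \<le> ln (real ((2 * n) choose n))"
  proof -
    have "(\<Sum>k\<in>{n<..2*n}. mangoldt k :: real) =
        (\<Sum>k\<in>{n<..2*n}. mangoldt k * (real (2 * n div k) - 2 * real (n div k)))"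
    proof (rule sum.cong)
      fix k assume k: "k \<in> {n<..2*n}"
      hence "n div k = 0" "2 * n div k > 0" "k > 0"
        by (auto simp: div_greater_zero_iff)
      thus "mangoldt k = mangoldt k * (real (2 * n div k) - 2 * real (n div k))"
        using div_double_bounds[of k n] by auto
    qed simp
    also have "\<dots> \<le> (\<Sum>k=1..2*n. mangoldt k * (real (2 * n div k) - 2 * real (n div k)))"
    proof (rule sum_mono2)
      fix k assume "k \<in> {1..2*n} - {n<..2*n}"
      hence "2 * real (n div k) \<le> real (2 * n div k)"
        using div_double_bounds(1)[of k n] by simp
      thus "0 \<le> mangoldt k * (real (2 * n div k) - 2 * real (n div k))"
        by (intro mult_nonneg_nonneg mangoldt_nonneg) auto
    qed auto
    finally show ?thesis by (simp add: ln_central_binomial)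
  qed
  moreover have "ln (real ((2 * n) choose n)) \<le> ln (2 ^ (2 * n))"
  proof (subst ln_le_cancel_iff)
    show "real (2 * n choose n) \<le> 2 ^ (2 * n)"
      using binomial_le_pow2[of "2*n" n] by (metis of_nat_le_iff of_nat_numeral of_nat_power)
  qed auto
  ultimately show ?thesis
    by (simp add: ln_realpow)
qed

lemma psi_mono: "m \<le> n \<Longrightarrow> psi m \<le> psi n"
  unfolding psi_def by (intro sum_mono2) (auto simp: mangoldt_nonneg)

text \<open>Iterated doubling gives a geometric sum, hence a factor 2 at powers of two; rounding n
  up to such a power gives another 2, and ln 2 < 1.\<close>

lemma psi_le: "psi n \<le> 4 * real n"
proof (cases "n = 0")
  case False
  have pow2: "psi (2 ^ k) \<le> 2 * 2 ^ k * ln 2" for k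
  proof (induction k)
    case (Suc k)
    thus ?case using psi_double_le[of "2 ^ k"] by (simp add: algebra_simps)
  qed (auto simp: psi_def)
  obtain k where k: "2 ^ k \<le> n" "n < 2 ^ (k + 1)"
    using False ex_power_ivl1[of 2 n] by auto
  have "psi n \<le> psi (2 ^ (k + 1))" using k by (intro psi_mono) auto
  also have "\<dots> \<le> 4 * 2 ^ k * ln 2" using pow2[of "k+1"] by simp
  also have "\<dots> \<le> 4 * 2 ^ k * 1"
    using ln_2_less_1 by (intro mult_left_mono) auto
  also have "\<dots> \<le> 4 * real n"
    using k(1) by (metis (no_types) mult.right_neutral mult_left_mono of_nat_le_iff of_nat_numeral of_nat_power zero_le_numeral)
  finally show ?thesis .
qed (auto simp: psi_def)

lemma central_binomial_le_psi: "ln (real ((2 * n) choose n)) \<le> psi (2 * n)"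
  unfolding ln_central_binomial psi_def
proof (rule sum_mono)
  fix k assume "k \<in> {1..2*n}"
  hence "real (2 * n div k) \<le> 2 * real (n div k) + 1"
    using div_double_bounds(2)[of k n] by simp
  hence "mangoldt k * (real (2 * n div k) - 2 * real (n div k)) \<le> mangoldt k * 1"
    by (intro mult_left_mono mangoldt_nonneg) auto
  thus "mangoldt k * (real (2 * n div k) - 2 * real (n div k)) \<le> mangoldt k"
    by simp
qed

text \<open>A prime p has at most ln n / ln p powers up to n, each of weight ln p, so it contributes
  at most ln n. The bound is applied to all prime powers, with \<pi>(n) primes, and to the proper
  ones, whose primes are at most the square root of n.\<close>

lemma sum_mangoldt_le_card_primes:
  assumes A: "A \<subseteq> {k \<in> {1..n}. primepow k}"
  shows "(\<Sum>k\<in>A. mangoldt k) \<le> real (card (aprimedivisor ` A)) * ln (real n)"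
proof -
  have fin: "finite A" using A by (rule finite_subset) auto
  have "(\<Sum>k\<in>A. mangoldt k :: real) =
      (\<Sum>p\<in>aprimedivisor ` A. \<Sum>k\<in>{k\<in>A. aprimedivisor k = p}. mangoldt k)"
    by (rule sum.image_gen [OF fin])
  also have "\<dots> \<le> (\<Sum>p\<in>aprimedivisor ` A. ln (real n))"
  proof (rule sum_mono)
    fix p assume "p \<in> aprimedivisor ` A"
    then obtain k0 where k0: "k0 \<in> A" "p = aprimedivisor k0" by auto
    have p: "prime p"
      unfolding k0(2) using k0 A primepow_gt_Suc_0[of k0] by (intro prime_aprimedivisor') auto
    have lnp: "ln (real p) > 0" using prime_gt_1_nat[OF p] by simp
    have n: "n \<ge> 1" using k0 A by auto
    define m where "m = nat \<lfloor>ln (real n) / ln (real p)\<rfloor>"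
    have sub: "{k\<in>A. aprimedivisor k = p} \<subseteq> (\<lambda>j. p ^ j) ` {1..m}"
    proof safe
      fix k assume k: "k \<in> A" "p = aprimedivisor k"
      then have "primepow k" "k \<le> n" using A by auto
      then obtain q j where qj: "prime q" "j > 0" "k = q ^ j"
        by (auto simp: primepow_def)
      hence "q = p" using k by (simp add: aprimedivisor_prime_power)
      have "real p ^ j \<le> real n"
        using \<open>k \<le> n\<close> qj \<open>q = p\<close> by (metis of_nat_le_iff of_nat_power)
      hence "ln (real p ^ j) \<le> ln (real n)"
        using prime_gt_0_nat[OF p] n by simp
      hence "real j * ln (real p) \<le> ln (real n)"
        using prime_gt_0_nat[OF p] by (simp add: ln_realpow)
      hence "real j \<le> ln (real n) / ln (real p)"
        by (simp only: pos_le_divide_eq[OF lnp])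
      hence "j \<le> m" unfolding m_def by (simp add: le_nat_floor)
      thus "k \<in> (\<lambda>j. aprimedivisor k ^ j) ` {1..m}"
        using qj(2,3) \<open>q = p\<close> unfolding k(2)[symmetric] by (intro image_eqI[of _ _ j]) simp_all
    qed
    have "(\<Sum>k\<in>{k\<in>A. aprimedivisor k = p}. mangoldt k :: real) \<le> (\<Sum>k\<in>{k\<in>A. aprimedivisor k = p}. ln (real p))"
      using A by (intro sum_mono) (auto simp: mangoldt_def)
    also have "\<dots> = real (card {k\<in>A. aprimedivisor k = p}) * ln (real p)" by simp
    also have "\<dots> \<le> real m * ln (real p)"
    proof (intro mult_right_mono)
      have "card {k\<in>A. aprimedivisor k = p} \<le> card ((\<lambda>j. p ^ j) ` {1..m})"
        by (intro card_mono sub) auto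
      also have "\<dots> \<le> m" using card_image_le[of "{1..m}" "\<lambda>j. p ^ j"] by simp
      finally show "real (card {k\<in>A. aprimedivisor k = p}) \<le> real m" by simp
    qed (use lnp in auto)
    also have "\<dots> \<le> ln (real n) / ln (real p) * ln (real p)"
      unfolding m_def using lnp n by (intro mult_right_mono of_nat_floor) auto
    also have "\<dots> = ln (real n)" using lnp by simp
    finally show "(\<Sum>k\<in>{k\<in>A. aprimedivisor k = p}. mangoldt k) \<le> ln (real n)" .
  qed
  finally show ?thesis by simp
qed

lemma psi_le_prime_pi: "psi n \<le> real (prime_pi (real n)) * ln (real n)"
proof (cases "n = 0")
  case False
  let ?A = "{k \<in> {1..n}. primepow k}"
  have fin: "finite {p::nat. prime p \<and> p \<le> n}"
    by (rule finite_subset[of _ "{..n}"]) auto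
  have "psi n = (\<Sum>k\<in>?A. mangoldt k)"
    unfolding psi_def by (rule sum.mono_neutral_right) (auto simp: mangoldt_def)
  also have "\<dots> \<le> real (card (aprimedivisor ` ?A)) * ln (real n)"
    by (rule sum_mangoldt_le_card_primes) auto
  also have "\<dots> \<le> real (prime_pi (real n)) * ln (real n)"
  proof (intro mult_right_mono)
    have "aprimedivisor ` ?A \<subseteq> {p. prime p \<and> p \<le> n}"
      by (auto intro!: prime_aprimedivisor' dest: primepow_gt_Suc_0)
         (metis aprimedivisor_le_nat le_trans primepow_gt_Suc_0 One_nat_def)
    hence "card (aprimedivisor ` ?A) \<le> prime_pi (real n)"
      unfolding prime_pi_def using fin by (simp add: card_mono)
    thus "real (card (aprimedivisor ` ?A)) \<le> real (prime_pi (real n))" by simp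
  qed (use False in auto)
  finally show ?thesis .
qed (auto simp: psi_def)

lemma sum_mangoldt_nonprime_le:
  "(\<Sum>k=1..n. if prime k then 0 else mangoldt k) \<le> sqrt (real n) * ln (real n)"
proof (cases "n = 0")
  case False
  let ?A = "{k \<in> {1..n}. primepow k \<and> \<not> prime k}"
  have "(\<Sum>k=1..n. if prime k then 0 else mangoldt k :: real) = (\<Sum>k\<in>?A. mangoldt k)"
    by (rule sum.mono_neutral_cong_right) (auto simp: mangoldt_def)
  also have "\<dots> \<le> real (card (aprimedivisor ` ?A)) * ln (real n)"
    by (rule sum_mangoldt_le_card_primes) auto
  also have "\<dots> \<le> sqrt (real n) * ln (real n)"
  proof (intro mult_right_mono)
    have "aprimedivisor ` ?A \<subseteq> {1..nat \<lfloor>sqrt (real n)\<rfloor>}"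
    proof safe
      fix k assume k: "k \<in> {1..n}" "primepow k" "\<not> prime k"
      then obtain p j where pj: "prime p" "j > 0" "k = p ^ j"
        by (auto simp: primepow_def)
      hence "j \<ge> 2" using k by (cases "j = 1") auto
      hence "p ^ 2 \<le> p ^ j" using prime_gt_0_nat[OF pj(1)] by (intro power_increasing) auto
      hence "p ^ 2 \<le> n" using k pj by auto
      hence "real p ^ 2 \<le> real n" by (metis of_nat_le_iff of_nat_power)
      hence "real p \<le> sqrt (real n)" by (rule real_le_rsqrt)
      hence "p \<le> nat \<lfloor>sqrt (real n)\<rfloor>" by (simp add: le_nat_floor)
      thus "aprimedivisor k \<in> {1..nat \<lfloor>sqrt (real n)\<rfloor>}"
        using pj prime_gt_0_nat[OF pj(1)] by (simp add: aprimedivisor_prime_power)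
    qed
    hence "card (aprimedivisor ` ?A) \<le> card {1..nat \<lfloor>sqrt (real n)\<rfloor>}"
      by (intro card_mono) auto
    hence "real (card (aprimedivisor ` ?A)) \<le> real (nat \<lfloor>sqrt (real n)\<rfloor>)"
      by (simp only: card_atLeastAtMost of_nat_le_iff diff_Suc_1 Suc_eq_plus1 add_diff_cancel_right')
    also have "\<dots> \<le> sqrt (real n)" by (intro of_nat_floor) auto
    finally show "real (card (aprimedivisor ` ?A)) \<le> sqrt (real n)" .
  qed (use False in auto)
  finally show ?thesis .
qed auto

text \<open>With n about Q/2, the estimate 4^n / (2n) \<le> (2n choose n) gives
  \<open>psi (2 * n)\<close> at least Q/2 - 1 - ln Q, using ln 4 \<ge> 1. The value 1/8 leaves ample
  room for the lower order terms; any positive constant would serve.\<close>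

lemma prime_pi_lower_bound:
  "eventually (\<lambda>Q. Q / 8 \<le> real (prime_pi Q) * ln Q) at_top"
proof -
  have "eventually (\<lambda>Q::real. Q / 8 \<le> (Q / 2 - 1) - ln Q) at_top"
    by real_asymp
  thus ?thesis using eventually_ge_at_top[of 2]
  proof eventually_elim
    case (elim Q)
    define n where "n = nat \<lfloor>Q / 2\<rfloor>"
    have n: "real n \<le> Q / 2" "Q / 2 - 1 \<le> real n"
      unfolding n_def using elim by linarith+
    have "n > 0" unfolding n_def using elim by (simp add: le_floor_iff)
    have "(4::real) \<ge> exp 1" using e_less_272 by linarith
    hence "1 \<le> ln (4::real)" by (subst ln_ge_iff) auto
    hence "(Q / 2 - 1) * 1 \<le> real n * ln 4" using n elim by (intro mult_mono) auto
    also have "real n * ln 4 = ln (4 ^ n)" by (simp add: ln_realpow)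
    finally have "Q / 2 - 1 \<le> ln (4 ^ n)" by simp
    moreover have "ln (2 * real n) \<le> ln Q" using n \<open>n > 0\<close> by simp
    ultimately have "(Q / 2 - 1) - ln Q \<le> ln (4 ^ n) - ln (2 * real n)" by simp
    also have "\<dots> = ln (4 ^ n / (2 * real n))"
      using \<open>n > 0\<close> by (simp add: ln_div)
    also have "\<dots> \<le> ln (real ((2 * n) choose n))"
      using central_binomial_lower_bound[OF \<open>n > 0\<close>] \<open>n > 0\<close> by (subst ln_le_cancel_iff) auto
    also have "\<dots> \<le> psi (2 * n)" by (rule central_binomial_le_psi)
    also have "\<dots> \<le> real (prime_pi (real (2 * n))) * ln (real (2 * n))"
      by (rule psi_le_prime_pi)
    also have "\<dots> \<le> real (prime_pi Q) * ln Q"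
    proof (intro mult_mono)
      have "finite {p::nat. prime p \<and> real p \<le> Q}"
        by (rule finite_subset[of _ "{..nat \<lfloor>Q\<rfloor>}"]) (auto simp: le_nat_floor)
      thus "real (prime_pi (real (2 * n))) \<le> real (prime_pi Q)"
        unfolding prime_pi_def of_nat_le_iff using n by (intro card_mono) auto
      show "ln (real (2 * n)) \<le> ln Q" using n \<open>n > 0\<close> by simp
      show "0 \<le> ln (real (2 * n))" using \<open>n > 0\<close> by simp
    qed auto
    finally show ?case using elim by linarith
  qed
qed

section \<open>Sums against the Gaussian weight\<close>

definition gweight :: "real \<Rightarrow> nat \<Rightarrow> real" where
  "gweight X n = exp (- (ln (real n / X))\<^sup>2 / 4)"

lemma gweight_pos: "gweight X n > 0"
  by (simp add: gweight_def)

text \<open>Replacing the Gaussian by quadratic decay suffices for coefficients whose sums grow at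
  most linearly.\<close>

lemma gweight_le:
  assumes "n > 0" "X > 0"
  shows "gweight X n \<le> exp 4 * min 1 ((X / real n)\<^sup>2)"
proof -
  define L where "L = ln (real n / X)"
  have "gweight X n \<le> exp 4 * 1"
    unfolding gweight_def mult_1_right exp_le_cancel_iff
    using zero_le_power2[of "ln (real n / X)"] by linarith
  moreover have "gweight X n \<le> exp 4 * (X / real n)\<^sup>2"
  proof -
    \<comment> \<open>Completing the square, (L/2 - 2)^2 \<ge> 0; this is the origin of the factor
      \<open>exp 4\<close>.\<close>
    have "- L\<^sup>2 / 4 \<le> 4 - 2 * L"
      using zero_le_power2[of "L / 2 - 2"] by (simp add: power2_eq_square algebra_simps)
    hence "gweight X n \<le> exp (4 - 2 * L)" by (simp add: gweight_def L_def)
    also have "\<dots> = exp 4 * (exp (- L))\<^sup>2"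
      by (simp flip: exp_double exp_add)
    also have "exp (- L) = X / real n"
      unfolding L_def using assms by (simp add: exp_minus)
    finally show ?thesis .
  qed
  ultimately show ?thesis by (simp add: min_def)
qed

text \<open>On the block from 2^K X to 2^(K+1) X the weight is at most 4^(-K), while the mass is at
  most 2^(K+1) B X^\<kappa> because \<kappa> \<le> 1. The blocks therefore add at most 2 (1 + 1/2 +
  1/4 + ...) = 4, and the range up to X adds 1. The bound 5 - 4/2^K in the induction is the exact
  partial sum.\<close>

lemma sum_dyadic_weight_le:
  fixes a :: "nat \<Rightarrow> real"
  assumes nonneg: "\<And>n. a n \<ge> 0" and bound: "\<And>n. (\<Sum>k=1..n. a k) \<le> B * real n powr \<kappa>"
    and \<kappa>: "0 \<le> \<kappa>" "\<kappa> \<le> 1" and B: "B \<ge> 0" and X: "X \<ge> 1"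
  shows "(\<Sum>k=1..m. a k * min 1 ((X / real k)\<^sup>2)) \<le> 5 * B * X powr \<kappa>"
proof -
  define T where "T = (\<lambda>K. nat \<lfloor>2 ^ K * X\<rfloor>)"
  have T_le: "real (T K) \<le> 2 ^ K * X" for K
    unfolding T_def using X by (intro of_nat_floor) auto
  have T_mono: "T K \<le> T (Suc K)" for K
    unfolding T_def using X by (intro nat_mono floor_mono) auto
  have A: "(\<Sum>k=1..T K. a k) \<le> B * (2 ^ K * X) powr \<kappa>" for K
  proof -
    have "(\<Sum>k=1..T K. a k) \<le> B * real (T K) powr \<kappa>" by (rule bound)
    also have "\<dots> \<le> B * (2 ^ K * X) powr \<kappa>"
      using B \<kappa> by (intro mult_left_mono powr_mono2 T_le) auto
    finally show ?thesis .
  qed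
  have main: "(\<Sum>k=1..T K. a k * min 1 ((X / real k)\<^sup>2)) \<le> B * X powr \<kappa> * (5 - 4 / 2 ^ K)" for K
  proof (induction K)
    case 0
    have "(\<Sum>k=1..T 0. a k * min 1 ((X / real k)\<^sup>2)) \<le> (\<Sum>k=1..T 0. a k * 1)"
      using nonneg by (intro sum_mono mult_left_mono) auto
    also have "\<dots> \<le> B * X powr \<kappa>" using A[of 0] by simp
    finally show ?case by simp
  next
    case (Suc K)
    have "(\<Sum>k=1..T (Suc K). a k * min 1 ((X / real k)\<^sup>2)) =
        (\<Sum>k=1..T K. a k * min 1 ((X / real k)\<^sup>2)) + (\<Sum>k\<in>{T K<..T (Suc K)}. a k * min 1 ((X / real k)\<^sup>2))"
      by (subst sum.union_disjoint [symmetric]) (use T_mono[of K] in \<open>auto intro!: sum.cong\<close>)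
    also have "(\<Sum>k\<in>{T K<..T (Suc K)}. a k * min 1 ((X / real k)\<^sup>2)) \<le> (\<Sum>k\<in>{T K<..T (Suc K)}. a k * (1 / 2 ^ K)\<^sup>2)"
    proof (intro sum_mono mult_left_mono nonneg)
      fix k assume k: "k \<in> {T K<..T (Suc K)}"
      hence "\<not> real k \<le> 2 ^ K * X" unfolding T_def using le_nat_floor[of k "2 ^ K * X"] by auto
      hence "X / real k \<le> 1 / 2 ^ K"
        using k X by (simp add: field_simps)
      hence "(X / real k)\<^sup>2 \<le> (1 / 2 ^ K)\<^sup>2"
        using X by (intro power_mono) auto
      thus "min 1 ((X / real k)\<^sup>2) \<le> (1 / 2 ^ K)\<^sup>2" by simp
    qed
    also have "\<dots> = (\<Sum>k\<in>{T K<..T (Suc K)}. a k) * (1 / 2 ^ K)\<^sup>2"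
      by (simp add: sum_distrib_right)
    also have "\<dots> \<le> (\<Sum>k=1..T (Suc K). a k) * (1 / 2 ^ K)\<^sup>2"
      using nonneg by (intro mult_right_mono sum_mono2) auto
    also have "\<dots> \<le> (B * (2 ^ Suc K * X) powr \<kappa>) * (1 / 2 ^ K)\<^sup>2"
      by (intro mult_right_mono A) auto
    also have "(2 ^ Suc K * X) powr \<kappa> = (2 ^ Suc K) powr \<kappa> * X powr \<kappa>"
      using X by (simp only: powr_mult)
    also have "(B * ((2 ^ Suc K) powr \<kappa> * X powr \<kappa>)) * (1 / 2 ^ K)\<^sup>2
        \<le> (B * ((2 ^ Suc K) powr 1 * X powr \<kappa>)) * (1 / 2 ^ K)\<^sup>2"
      using \<kappa> B by (intro mult_right_mono mult_left_mono powr_mono one_le_power) auto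
    also have "\<dots> = B * X powr \<kappa> * (2 / 2 ^ K)"
      by (simp add: power2_eq_square field_simps)
    finally show ?case
      using Suc.IH by (simp add: field_simps)
  qed
  have "m \<le> T m"
  proof -
    have "real m \<le> 2 ^ m * 1"
      by (metis less_exp mult.right_neutral of_nat_le_iff of_nat_numeral of_nat_power order_less_imp_le)
    also have "\<dots> \<le> 2 ^ m * X" using X by (intro mult_left_mono) auto
    finally show ?thesis unfolding T_def by (simp add: le_nat_floor)
  qed
  hence "(\<Sum>k=1..m. a k * min 1 ((X / real k)\<^sup>2)) \<le> (\<Sum>k=1..T m. a k * min 1 ((X / real k)\<^sup>2))"
    using nonneg by (intro sum_mono2) auto
  also have "\<dots> \<le> B * X powr \<kappa> * (5 - 4 / 2 ^ m)" by (rule main)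
  also have "\<dots> \<le> B * X powr \<kappa> * 5" using B by (intro mult_left_mono) auto
  finally show ?thesis by (simp add: mult_ac)
qed

text \<open>The condition \<open>a 0 = 0\<close> discards the meaningless value of the weight at 0.
  The lemma is used with \<kappa> = 1 for all prime powers and with \<kappa> slightly above 1/2 for
  the proper ones.\<close>

lemma gweight_series_le:
  fixes a :: "nat \<Rightarrow> real"
  assumes nonneg: "\<And>n. a n \<ge> 0" and bound: "\<And>n. (\<Sum>k=1..n. a k) \<le> B * real n powr \<kappa>"
    and \<kappa>: "0 \<le> \<kappa>" "\<kappa> \<le> 1" and B: "B \<ge> 0" and X: "X \<ge> 1" and a0: "a 0 = 0"
  shows "summable (\<lambda>n. a n * gweight X n)" (is ?th1)
    and "(\<Sum>n. a n * gweight X n) \<le> 5 * exp 4 * B * X powr \<kappa>" (is ?th2)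
proof -
  have part: "(\<Sum>n<m. a n * gweight X n) \<le> 5 * exp 4 * B * X powr \<kappa>" for m
  proof -
    have "(\<Sum>n<m. a n * gweight X n) = (\<Sum>n=1..<m. a n * gweight X n)"
      by (rule sum.mono_neutral_right) (use a0 in \<open>auto simp: not_less_eq_eq\<close>)
    also have "\<dots> \<le> (\<Sum>n=1..m. a n * gweight X n)"
      by (intro sum_mono2) (auto intro!: mult_nonneg_nonneg nonneg less_imp_le[OF gweight_pos])
    also have "\<dots> \<le> (\<Sum>n=1..m. a n * (exp 4 * min 1 ((X / real n)\<^sup>2)))"
      using X by (intro sum_mono mult_left_mono gweight_le nonneg) auto
    also have "\<dots> = exp 4 * (\<Sum>n=1..m. a n * min 1 ((X / real n)\<^sup>2))"
      by (simp add: sum_distrib_left mult_ac)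
    also have "\<dots> \<le> exp 4 * (5 * B * X powr \<kappa>)"
      using assms by (intro mult_left_mono sum_dyadic_weight_le) auto
    finally show ?thesis by (simp add: mult_ac)
  qed
  show th1: ?th1
    by (intro summableI_nonneg_bounded[OF _ part] mult_nonneg_nonneg nonneg less_imp_le[OF gweight_pos])
  show ?th2
    by (rule suminf_le_const[OF th1 part])
qed

section \<open>Non-vanishing at 1\<close>

text \<open>Removing a full prime power at once sets up strong induction for multiplicative
  functions.\<close>

lemma prime_split:
  assumes "(n::nat) > 1"
  obtains p a m where "prime p" "n = p ^ a * m" "m > 0" "\<not> p dvd m" "m < n"
proof -
  obtain p where p: "prime p" "p dvd n" using assms prime_factor_nat[of n] by auto
  obtain m where m: "n = p ^ multiplicity p n * m" "\<not> p dvd m"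
    using multiplicity_decompose'[of n p] assms p by (metis not_prime_unit not_one_less_zero)
  have "multiplicity p n > 0" using p assms by (simp add: prime_multiplicity_gt_zero_iff)
  hence "p ^ multiplicity p n > 1" using prime_gt_1_nat[OF p(1)] by (intro one_less_power)
  moreover have "m > 0" using m assms by (intro Nat.gr0I) auto
  ultimately have "m < n" using m(1) by (metis mult_less_cancel2 mult_1)
  thus ?thesis using that p m \<open>m > 0\<close> by blast
qed

locale real_char =
  fixes q :: nat and chi :: "nat \<Rightarrow> real"
  assumes char: "dirichlet_character q (\<lambda>n. complex_of_real (chi n))"
    and vals: "\<And>n. chi n \<in> {-1, 0, 1}"
    and nonprincipal: "\<exists>n. chi n = -1"
begin

lemma q_pos: "q > 0" and periodic: "chi (n + q) = chi n" and mult: "chi (m * n) = chi m * chi n"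
  and one: "chi 1 = 1" and zero_iff: "chi n = 0 \<longleftrightarrow> \<not> coprime n q"
  using char unfolding dirichlet_character_def
  by (simp_all add: of_real_eq_iff of_real_eq_1_iff flip: of_real_mult)

lemma abs_le_1: "\<bar>chi n\<bar> \<le> 1"
  using vals[of n] by auto

lemma periodic_mult: "chi (n + k * q) = chi n"
  by (induction k) (simp_all add: periodic flip: add.assoc, metis add.assoc add.commute periodic)

lemma mod_eq: "chi (n mod q) = chi n"
  using periodic_mult[of "n mod q" "n div q"] by simp

lemma q_gt_1: "q > 1"
proof (rule ccontr)
  assume "\<not> q > 1"
  hence "q = 1" using q_pos by simp
  hence "chi n = chi 0" for n using mod_eq[of n] by simp
  thus False using one nonprincipal by (metis one_neq_neg_one)
qed

lemma zero: "chi 0 = 0"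
  using zero_iff[of 0] q_gt_1 by simp

lemma power: "chi (n ^ k) = chi n ^ k"
  using one by (induction k) (simp_all add: mult)

definition P :: "nat \<Rightarrow> real" where "P m = (\<Sum>n<m. chi n)"

text \<open>Multiplication by an \<open>a\<close> with \<open>chi a = -1\<close> permutes the
  residues and changes the sign of the sum.\<close>

lemma P_period: "P q = 0"
proof -
  obtain a where a: "chi a = -1" using nonprincipal by blast
  hence cop: "coprime a q" using zero_iff[of a] by auto
  define f where "f = (\<lambda>n. a * n mod q)"
  have "inj_on f {..<q}"
  proof (rule inj_onI)
    fix x y assume xy: "x \<in> {..<q}" "y \<in> {..<q}" "f x = f y"
    hence "[a * x = a * y] (mod q)" by (simp add: f_def cong_def)
    hence "[x = y] (mod q)" using cop by (simp add: cong_mult_lcancel_nat)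
    thus "x = y" using xy by (simp add: cong_def)
  qed
  moreover have "f ` {..<q} \<subseteq> {..<q}" using q_pos by (auto simp: f_def)
  ultimately have bij: "bij_betw f {..<q} {..<q}"
    unfolding bij_betw_def using endo_inj_surj[of "{..<q}" f] by auto
  have "P q = (\<Sum>n<q. chi (f n))"
    unfolding P_def by (rule sum.reindex_bij_betw[OF bij, symmetric])
  also have "\<dots> = (\<Sum>n<q. - chi n)"
    by (intro sum.cong refl) (simp add: f_def mod_eq mult a)
  also have "\<dots> = - P q" by (simp add: P_def sum_negf)
  finally show ?thesis by simp
qed

lemma P_add_q: "P (m + q) = P m"
  by (induction m) (simp_all add: P_period[unfolded P_def] P_def periodic)

text \<open>A bound of size q is good enough, since the modulus will enter only through its
  logarithm.\<close>

lemma abs_P_le: "\<bar>P m\<bar> \<le> q"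
proof (induction m rule: less_induct)
  case (less m)
  show ?case
  proof (cases "m < q")
    case True
    have "\<bar>P m\<bar> \<le> (\<Sum>n<m. \<bar>chi n\<bar>)" unfolding P_def by (rule sum_abs)
    also have "\<dots> \<le> (\<Sum>n<m. 1)" by (intro sum_mono abs_le_1)
    finally show ?thesis using True by simp
  next
    case False
    thus ?thesis using less.IH[of "m - q"] P_add_q[of "m - q"] q_pos by simp
  qed
qed

text \<open>The shift in \<open>P (n + 2)\<close> arises because \<open>P m\<close> stops before m
  while the sum starts at \<open>chi 1\<close>; at the lower end \<open>P 1 = chi 0 = 0\<close>.
  Values in a vector space allow both Monsky's real sequence and complex powers.\<close>

lemma sum_by_parts:
  fixes c :: "nat \<Rightarrow> 'b :: real_vector"
  shows "(\<Sum>n<m. chi (Suc n) *\<^sub>R c n) = (\<Sum>n<m. P (n + 2) *\<^sub>R (c n - c (Suc n))) + P (m + 1) *\<^sub>R c m"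
proof (induction m)
  case 0
  show ?case by (simp add: P_def zero)
next
  case (Suc m)
  have "chi (Suc m) *\<^sub>R c m = P (m + 2) *\<^sub>R c m - P (m + 1) *\<^sub>R c m"
    by (simp add: P_def flip: scaleR_left_diff_distrib)
  thus ?case using Suc.IH by (simp add: scaleR_right_diff_distrib)
qed

lemma abel_bound:
  fixes b :: "nat \<Rightarrow> real"
  assumes "\<And>n. b (Suc n) \<le> b n" "\<And>n. b n \<ge> 0"
  shows "\<bar>\<Sum>n<m. chi (Suc n) * b n\<bar> \<le> q * b 0"
proof -
  have "(\<Sum>n<m. chi (Suc n) * b n) = (\<Sum>n<m. P (n + 2) * (b n - b (Suc n))) + P (m + 1) * b m"
    using sum_by_parts[of b m] by simp
  also have "\<bar>\<dots>\<bar> \<le> (\<Sum>n<m. \<bar>P (n + 2) * (b n - b (Suc n))\<bar>) + \<bar>P (m + 1) * b m\<bar>"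
    by (intro order.trans[OF abs_triangle_ineq] add_mono sum_abs order.refl)
  also have "\<dots> \<le> (\<Sum>n<m. q * (b n - b (Suc n))) + q * b m"
    using assms abs_P_le by (intro add_mono sum_mono) (auto simp: abs_mult intro!: mult_right_mono)
  also have "\<dots> = q * b 0"
    using sum_lessThan_telescope'[of b m] by (simp flip: sum_distrib_left distrib_left)
  finally show ?thesis .
qed

text \<open>The Dirichlet convolution of 1 and \<open>chi\<close>, that is, the coefficients of
  zeta(s) L(s, chi).\<close>

definition r :: "nat \<Rightarrow> real" where "r m = (\<Sum>d | d dvd m. chi d)"

text \<open>Going from p^a m to p^(a+1) m adds exactly the divisors p^(a+1) d with d dividing m. The
  result reduces the sign of \<open>r\<close> to that of geometric sums of
  \<open>chi p\<close>.\<close>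

lemma r_prime_power_mult:
  assumes p: "prime p" and m: "m > 0" "\<not> p dvd m"
  shows "r (p ^ a * m) = (\<Sum>i\<le>a. chi p ^ i) * r m"
proof (induction a)
  case (Suc a)
  have fin: "finite {d. d dvd p ^ k * m}" for k
    using m p prime_gt_0_nat[OF p] by (intro finite_divisors_nat) auto
  have split: "{d. d dvd p ^ Suc a * m} = {d. d dvd p ^ a * m} \<union> (\<lambda>d. p ^ Suc a * d) ` {d. d dvd m}"
  proof (intro equalityI subsetI)
    fix d assume "d \<in> {d. d dvd p ^ Suc a * m}"
    hence d: "d dvd p ^ Suc a * m" by simp
    then obtain x y where xy: "d = x * y" "x dvd p ^ Suc a" "y dvd m"
      by (elim dvd_productE)
    obtain i where i: "i \<le> Suc a" "x = p ^ i"
      using xy(2) divides_primepow_nat[OF p, of x "Suc a"] by auto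
    show "d \<in> {d. d dvd p ^ a * m} \<union> (\<lambda>d. p ^ Suc a * d) ` {d. d dvd m}"
    proof (cases "i = Suc a")
      case True
      thus ?thesis using xy i by auto
    next
      case False
      hence "x dvd p ^ a" using i by (simp add: le_imp_power_dvd)
      thus ?thesis using xy by (auto intro: mult_dvd_mono)
    qed
  next
    fix d assume "d \<in> {d. d dvd p ^ a * m} \<union> (\<lambda>d. p ^ Suc a * d) ` {d. d dvd m}"
    thus "d \<in> {d. d dvd p ^ Suc a * m}"
      by (auto simp: mult.assoc intro: dvd_mult mult_dvd_mono)
  qed
  have disj: "{d. d dvd p ^ a * m} \<inter> (\<lambda>d. p ^ Suc a * d) ` {d. d dvd m} = {}"
  proof -
    have False if "p ^ Suc a * e dvd p ^ a * m" for e
    proof -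
      have "p ^ Suc a dvd p ^ a * m" using that dvd_mult_left by blast
      hence "p ^ a * p dvd p ^ a * m" by (simp add: mult.commute)
      hence "p dvd m" using prime_gt_0_nat[OF p] by simp
      thus False using m by simp
    qed
    thus ?thesis by blast
  qed
  have "r (p ^ Suc a * m) = r (p ^ a * m) + (\<Sum>d\<in>(\<lambda>d. p ^ Suc a * d) ` {d. d dvd m}. chi d)"
    unfolding r_def split using fin[of a] m disj by (intro sum.union_disjoint) auto
  also have "(\<Sum>d\<in>(\<lambda>d. p ^ Suc a * d) ` {d. d dvd m}. chi d) = (\<Sum>d | d dvd m. chi (p ^ Suc a * d))"
    using prime_gt_0_nat[OF p] by (subst sum.reindex) (auto simp: inj_on_def)
  also have "\<dots> = chi p ^ Suc a * r m"
    unfolding r_def sum_distrib_left by (intro sum.cong refl) (simp only: mult power)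
  finally show ?case using Suc.IH by (simp add: algebra_simps)
qed auto

lemma sum_powers_nonneg: "(\<Sum>i\<le>a. chi p ^ i) \<ge> 0" "even a \<Longrightarrow> (\<Sum>i\<le>a. chi p ^ i) \<ge> 1"
proof -
  consider "chi p = -1" | "chi p \<ge> 0" using vals[of p] by auto
  hence "(\<Sum>i\<le>a. chi p ^ i) \<ge> (if even a then 1 else 0)"
  proof cases
    case 1
    have "(\<Sum>i\<le>a. (-1) ^ i :: real) = (if even a then 1 else 0)"
      by (induction a) auto
    thus ?thesis using 1 by simp
  next
    case 2
    have "(1::real) = (\<Sum>i\<in>{0}. chi p ^ i)" by simp
    also have "\<dots> \<le> (\<Sum>i\<le>a. chi p ^ i)" using 2 by (intro sum_mono2) auto
    finally show ?thesis by simp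
  qed
  thus "(\<Sum>i\<le>a. chi p ^ i) \<ge> 0" "even a \<Longrightarrow> (\<Sum>i\<le>a. chi p ^ i) \<ge> 1" by (auto split: if_splits)
qed

lemma r_nonneg: "n > 0 \<Longrightarrow> r n \<ge> 0"
proof (induction n rule: less_induct)
  case (less n)
  show ?case
  proof (cases "n = 1")
    case False
    then obtain p a m where "prime p" "n = p ^ a * m" "m > 0" "\<not> p dvd m" "m < n"
      using prime_split[of n] less.prems by auto
    thus ?thesis using less.IH[of m] sum_powers_nonneg(1) by (simp add: r_prime_power_mult)
  qed (use one in \<open>simp add: r_def\<close>)
qed

lemma r_square: "n > 0 \<Longrightarrow> r (n ^ 2) \<ge> 1"
proof (induction n rule: less_induct)
  case (less n)
  show ?case
  proof (cases "n = 1")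
    case False
    then obtain p a m where p: "prime p" "n = p ^ a * m" "m > 0" "\<not> p dvd m" "m < n"
      using prime_split[of n] less.prems by auto
    have "n ^ 2 = p ^ (2 * a) * m ^ 2"
      using p by (simp add: power_mult_distrib power_mult power2_eq_square mult.commute)
    moreover have "\<not> p dvd m ^ 2" using p prime_dvd_power by blast
    ultimately have "r (n ^ 2) = (\<Sum>i\<le>2*a. chi p ^ i) * r (m ^ 2)"
      using r_prime_power_mult[of p "m ^ 2" "2 * a"] p by simp
    also have "\<dots> \<ge> 1 * 1"
      using less.IH[OF p(5,3)] sum_powers_nonneg(2)[of "2 * a" p] by (intro mult_mono) auto
    finally show ?thesis by simp
  qed (use one in \<open>simp add: r_def\<close>)
qed

end

section \<open>Inequalities for Monsky's sequence\<close>

lemma geom_ge: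
  fixes y :: real
  assumes "0 \<le> y" "y \<le> 1"
  shows "y * (\<Sum>i<n. (y\<^sup>2) ^ i) \<ge> real n * y ^ n"
proof (induction n rule: nat_induct2)
  case (step n)
  have "(\<Sum>i<n+2. (y\<^sup>2) ^ i) = 1 + (\<Sum>i<n. (y\<^sup>2) ^ Suc i) + (y\<^sup>2) ^ Suc n"
    using sum.lessThan_Suc_shift[of "\<lambda>i. (y\<^sup>2) ^ i" "Suc n"] by simp
  also have "(\<Sum>i<n. (y\<^sup>2) ^ Suc i) = y\<^sup>2 * (\<Sum>i<n. (y\<^sup>2) ^ i)"
    by (simp add: sum_distrib_left)
  finally have "y * (\<Sum>i<n+2. (y\<^sup>2) ^ i) = y * (1 + (y\<^sup>2) ^ Suc n) + y\<^sup>2 * (y * (\<Sum>i<n. (y\<^sup>2) ^ i))"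
    by (simp add: algebra_simps)
  \<comment> \<open>The left side is y + y^3 + ... with geometric mean y^(n+2). The induction in
    steps of two splits off the outermost pair of terms, to which the inequality of arithmetic and
    geometric means for two numbers applies.\<close>
  also have "\<dots> \<ge> y * (2 * y ^ Suc n) + y\<^sup>2 * (real n * y ^ n)"
  proof (intro add_mono mult_left_mono step)
    have "0 \<le> (1 - y ^ Suc n)\<^sup>2" by simp
    also have "\<dots> = 1 + (y\<^sup>2) ^ Suc n - 2 * y ^ Suc n"
      by (simp add: power2_eq_square algebra_simps power_mult_distrib)
    finally show "2 * y ^ Suc n \<le> 1 + (y\<^sup>2) ^ Suc n" by simp
  qed (use assms in auto)
  also have "y * (2 * y ^ Suc n) + y\<^sup>2 * (real n * y ^ n) = real (n + 2) * y ^ (n + 2)"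
    by (simp add: power2_eq_square algebra_simps)
  finally show ?case .
qed auto

lemma geom_mult_ge:
  fixes x :: real
  assumes "0 < x" "x < 1"
  shows "(\<Sum>i<n. x ^ i) * (\<Sum>i<Suc n. x ^ i) \<ge> real n * real (Suc n) * x ^ n"
proof -
  \<comment> \<open>The square root turns the powers of x into the odd powers of
    \<open>geom_ge\<close>. Multiplying its cases n and n + 1 gives y^(2n+1), a factor y \<le> 1
    better than necessary.\<close>
  define y where "y = sqrt x"
  have y: "0 < y" "y \<le> 1" "y\<^sup>2 = x" unfolding y_def using assms by auto
  have "y\<^sup>2 * (real n * real (Suc n) * x ^ n) = (real n * y ^ n) * (real (Suc n) * y ^ Suc n) * y"
    unfolding y(3)[symmetric] by (simp add: power2_eq_square power_mult_distrib algebra_simps)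
  also have "\<dots> \<le> (y * (\<Sum>i<n. x ^ i)) * (y * (\<Sum>i<Suc n. x ^ i)) * 1"
  proof (rule mult_mono[OF mult_mono])
    show "real n * y ^ n \<le> y * (\<Sum>i<n. x ^ i)" "real (Suc n) * y ^ Suc n \<le> y * (\<Sum>i<Suc n. x ^ i)"
      using geom_ge[of y n] geom_ge[of y "Suc n"] y by simp_all
  qed (use y assms in \<open>auto intro!: mult_nonneg_nonneg sum_nonneg simp del: sum.lessThan_Suc\<close>)
  also have "\<dots> = y\<^sup>2 * ((\<Sum>i<n. x ^ i) * (\<Sum>i<Suc n. x ^ i))"
    by (simp add: power2_eq_square mult_ac)
  finally show ?thesis using y(1) by (metis mult_le_cancel_left_pos zero_less_power)
qed

text \<open>The Lambert coefficient subtracted from its leading behaviour as x tends to 1. Summed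
  against \<open>chi\<close>, the leading part is L(1)/(1 - x), so L(1) = 0 would leave only this
  sequence.\<close>

definition monsky :: "real \<Rightarrow> nat \<Rightarrow> real" where
  "monsky x n = 1 / (real n * (1 - x)) - x ^ n / (1 - x ^ n)"

lemma monsky_props:
  fixes x :: real
  assumes x: "0 < x" "x < 1" and n: "n > 0"
  shows "monsky x n \<ge> 0" "monsky x (Suc n) \<le> monsky x n"
proof -
  define G where "G = (\<lambda>n. \<Sum>i<n. x ^ i)"
  have G: "1 - x ^ n = (1 - x) * G n" for n
    unfolding G_def by (simp add: one_diff_power_eq)
  have Gpos: "G n > 0" if "n > 0" for n
    unfolding G_def using x that by (intro sum_pos) auto
  have "real n * x ^ n = (\<Sum>i<n. x ^ n)" by simp
  also have "\<dots> \<le> G n" unfolding G_def using x by (intro sum_mono power_decreasing) auto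
  finally have "x ^ n / G n \<le> 1 / real n" using Gpos[OF n] n by (simp add: field_simps)
  moreover have m: "monsky x n = (1 / real n - x ^ n / G n) / (1 - x)" if "n > 0" for n
    unfolding monsky_def G using x that Gpos[OF that] by (simp add: diff_divide_distrib mult.commute)
  ultimately show "monsky x n \<ge> 0" using n x by simp
  have "x ^ n / G n - x ^ Suc n / G (Suc n) = (x ^ n * G (Suc n) - x ^ Suc n * G n) / (G n * G (Suc n))"
    using Gpos[OF n] Gpos[of "Suc n"] by (simp add: field_simps)
  also have "x ^ n * G (Suc n) - x ^ Suc n * G n = x ^ n"
  proof -
    have "G (Suc n) = 1 + x * G n"
      unfolding G_def sum.lessThan_Suc_shift by (simp add: sum_distrib_left)
    thus ?thesis by (simp add: algebra_simps)
  qed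
  \<comment> \<open>Up to the factor 1/(1 - x), monotonicity compares two decrements: x^n / (G n
    G(n+1)) and 1/n - 1/(n+1). This is exactly \<open>geom_mult_ge\<close>.\<close>
  also have "x ^ n / (G n * G (Suc n)) \<le> 1 / (real n * real (Suc n))"
  proof -
    have "real n * real (Suc n) * x ^ n \<le> G n * G (Suc n)"
      unfolding G_def by (rule geom_mult_ge[OF x])
    moreover have "c / A \<le> 1 / B" if "B * c \<le> A" "A > 0" "B > 0" for A B c :: real
      using that by (simp add: field_simps)
    ultimately show ?thesis using Gpos[OF n] Gpos[of "Suc n"] n by simp
  qed
  also have "\<dots> = 1 / real n - 1 / real (Suc n)" using n by (simp add: field_simps)
  finally have "1 / real (Suc n) - x ^ Suc n / G (Suc n) \<le> 1 / real n - x ^ n / G n" by simp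
  thus "monsky x (Suc n) \<le> monsky x n"
    unfolding m[OF n] m[OF zero_less_Suc] using x by (intro divide_right_mono) auto
qed

text \<open>The omitted terms are the powers at multiples of n beyond N, a geometric series starting
  no earlier than x^N. The error is uniform in n, so even N of them together vanish as N
  grows.\<close>

lemma lambert_tail:
  fixes x :: real
  assumes x: "0 < x" "x < 1" and n: "n > 0"
  shows "\<bar>x ^ n / (1 - x ^ n) - (\<Sum>m | m \<in> {1..N} \<and> n dvd m. x ^ m)\<bar> \<le> x ^ N / (1 - x)"
proof -
  define K where "K = N div n"
  have "{m. m \<in> {1..N} \<and> n dvd m} = (\<lambda>k. n * Suc k) ` {..<K}"
  proof (intro equalityI subsetI)
    fix m assume "m \<in> {m. m \<in> {1..N} \<and> n dvd m}"
    then obtain k where k: "m = n * k" "m \<ge> 1" "m \<le> N" by auto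
    hence "k \<noteq> 0" by (intro notI) auto
    moreover have "k \<le> K" unfolding K_def using k n by (simp add: less_eq_div_iff_mult_less_eq mult.commute)
    ultimately show "m \<in> (\<lambda>k. n * Suc k) ` {..<K}"
      using k by (intro image_eqI[of _ _ "k - 1"]) auto
  next
    fix m assume "m \<in> (\<lambda>k. n * Suc k) ` {..<K}"
    then obtain k where k: "m = n * Suc k" "k < K" by blast
    hence "Suc k \<le> K" by simp
    hence "m \<le> N" unfolding K_def k(1) using n by (simp add: less_eq_div_iff_mult_less_eq mult.commute)
    thus "m \<in> {m. m \<in> {1..N} \<and> n dvd m}" using k n by simp
  qed
  hence "(\<Sum>m | m \<in> {1..N} \<and> n dvd m. x ^ m) = (\<Sum>k<K. x ^ (n * Suc k))"
    using n by (simp only:) (subst sum.reindex, auto simp: inj_on_def)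
  also have "\<dots> = x ^ n * (\<Sum>k<K. (x ^ n) ^ k)"
    by (simp add: sum_distrib_left power_mult power_add)
  finally have S: "(\<Sum>m | m \<in> {1..N} \<and> n dvd m. x ^ m) = x ^ n * (\<Sum>k<K. (x ^ n) ^ k)" .
  have xn: "x ^ n < 1" "x ^ n \<le> x" "x ^ n > 0"
    using x n power_decreasing[of 1 n x] by (auto simp: power_less_one_iff)
  have "(\<Sum>k<K. (x ^ n) ^ k) = (1 - (x ^ n) ^ K) / (1 - x ^ n)"
    using xn one_diff_power_eq[of "x ^ n" K] by (simp add: field_simps)
  hence "x ^ n / (1 - x ^ n) - (\<Sum>m | m \<in> {1..N} \<and> n dvd m. x ^ m) = x ^ n * (x ^ n) ^ K / (1 - x ^ n)"
    unfolding S by (simp only: right_diff_distrib diff_divide_distrib times_divide_eq_right mult_1_right)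
  also have "x ^ n * (x ^ n) ^ K = x ^ (n * Suc K)" by (simp add: power_mult power_add)
  finally have eq: "x ^ n / (1 - x ^ n) - (\<Sum>m | m \<in> {1..N} \<and> n dvd m. x ^ m) = x ^ (n * Suc K) / (1 - x ^ n)" .
  have "N \<le> n * Suc K"
    unfolding K_def using n dividend_less_times_div[of n N] by simp
  hence "x ^ (n * Suc K) \<le> x ^ N" using x by (intro power_decreasing) auto
  hence "x ^ (n * Suc K) / (1 - x ^ n) \<le> x ^ N / (1 - x)"
    using x xn by (intro frac_le) auto
  moreover have "x ^ (n * Suc K) / (1 - x ^ n) \<ge> 0" using x xn by simp
  ultimately show ?thesis unfolding eq by (simp only: abs_of_nonneg)
qed

context real_char
begin

text \<open>Truncating at N keeps the exchange of summation finite: it yields the sum of r(m) x^m,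
  from which all terms but those at squares may be dropped. The subtracted term collects the N
  Lambert tails.\<close>

lemma lambert_ge:
  assumes x: "0 < x" "x < 1" and K: "K ^ 2 \<le> N"
  shows "(\<Sum>n=1..N. chi n * (x ^ n / (1 - x ^ n))) \<ge> (\<Sum>j=1..K. x ^ (j\<^sup>2)) - real N * (x ^ N / (1 - x))"
proof -
  have "(\<Sum>j=1..K. x ^ (j\<^sup>2)) = (\<Sum>m\<in>(\<lambda>j. j\<^sup>2) ` {1..K}. x ^ m)"
    by (subst sum.reindex) (auto simp: inj_on_def)
  also have "\<dots> \<le> (\<Sum>m\<in>(\<lambda>j. j\<^sup>2) ` {1..K}. r m * x ^ m)"
  proof (intro sum_mono)
    fix m assume "m \<in> (\<lambda>j. j\<^sup>2) ` {1..K}"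
    hence "r m \<ge> 1" using r_square by auto
    thus "x ^ m \<le> r m * x ^ m" using x mult_right_mono[of 1 "r m" "x ^ m"] by simp
  qed
  also have "\<dots> \<le> (\<Sum>m=1..N. r m * x ^ m)"
  proof (intro sum_mono2)
    show "(\<lambda>j. j\<^sup>2) ` {1..K} \<subseteq> {1..N}"
    proof safe
      fix j assume j: "j \<in> {1..K}"
      hence "j\<^sup>2 \<le> K\<^sup>2" by (intro power_mono) auto
      hence "j\<^sup>2 \<le> N" using K by (rule order.trans)
      thus "j\<^sup>2 \<in> {1..N}" using j by simp
    qed
  qed (use r_nonneg x in auto)
  also have "\<dots> = (\<Sum>m=1..N. \<Sum>n=1..N. if n dvd m then chi n * x ^ m else 0)"
  proof (intro sum.cong refl)
    fix m assume m: "m \<in> {1..N}"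
    hence "{d. d dvd m} = {n \<in> {1..N}. n dvd m}"
      by (auto dest: dvd_imp_le intro!: Suc_leI Nat.gr0I)
    hence "r m = (\<Sum>n\<in>{n \<in> {1..N}. n dvd m}. chi n)" by (simp add: r_def)
    also have "\<dots> = (\<Sum>n=1..N. if n dvd m then chi n else 0)"
      by (rule sum.inter_filter) simp
    finally show "r m * x ^ m = (\<Sum>n=1..N. if n dvd m then chi n * x ^ m else 0)"
      by (simp add: sum_distrib_right if_distrib[of "\<lambda>t. t * x ^ m"] cong: if_cong)
  qed
  also have "\<dots> = (\<Sum>n=1..N. \<Sum>m=1..N. if n dvd m then chi n * x ^ m else 0)"
    by (rule sum.swap)
  also have "\<dots> = (\<Sum>n=1..N. chi n * (\<Sum>m | m \<in> {1..N} \<and> n dvd m. x ^ m))"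
  proof (intro sum.cong refl)
    fix n
    have "(\<Sum>m | m \<in> {1..N} \<and> n dvd m. x ^ m) = (\<Sum>m=1..N. if n dvd m then x ^ m else 0)"
      by (rule sum.inter_filter) simp
    thus "(\<Sum>m=1..N. if n dvd m then chi n * x ^ m else 0) = chi n * (\<Sum>m | m \<in> {1..N} \<and> n dvd m. x ^ m)"
      by (simp only: sum_distrib_left if_distrib mult_zero_right cong: if_cong)
  qed
  also have "\<dots> \<le> (\<Sum>n=1..N. chi n * (x ^ n / (1 - x ^ n)) + x ^ N / (1 - x))"
  proof (intro sum_mono)
    fix n assume n: "n \<in> {1..N}"
    have "chi n * ((\<Sum>m | m \<in> {1..N} \<and> n dvd m. x ^ m) - x ^ n / (1 - x ^ n))
        \<le> \<bar>chi n\<bar> * \<bar>x ^ n / (1 - x ^ n) - (\<Sum>m | m \<in> {1..N} \<and> n dvd m. x ^ m)\<bar>"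
      unfolding abs_minus_commute[of "x ^ n / (1 - x ^ n)"] abs_mult[symmetric] by (rule abs_ge_self)
    also have "\<dots> \<le> 1 * (x ^ N / (1 - x))"
      using lambert_tail[OF x, of n N] n abs_le_1 by (intro mult_mono) auto
    finally show "chi n * (\<Sum>m | m \<in> {1..N} \<and> n dvd m. x ^ m) \<le> chi n * (x ^ n / (1 - x ^ n)) + x ^ N / (1 - x)"
      by (simp add: algebra_simps)
  qed
  also have "\<dots> = (\<Sum>n=1..N. chi n * (x ^ n / (1 - x ^ n))) + real N * (x ^ N / (1 - x))"
    by (simp add: sum.distrib)
  finally show ?thesis by simp
qed

text \<open>Monsky's argument: if the sum of \<open>chi(n)/n\<close> were zero, the Lambert series
  \<open>\<Sum> chi(n) x^n/(1 - x^n)\<close> would stay bounded as \<open>x \<rightarrow> 1\<close>, whereas its power series coefficients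
  \<open>r(m)\<close> are nonnegative, and at least 1 at the squares.\<close>

lemma L_1_nonzero:
  assumes sums: "(\<lambda>n. chi (Suc n) / real (Suc n)) sums l"
  shows "l \<noteq> 0"
proof
  assume "l = 0"
  \<comment> \<open>The sum over j = 1..K tends to K as x tends to 1, while the bound derived below
    is \<open>q\<close> times the first term of Monsky's sequence, which is 1. One square more than
    \<open>q\<close> thus gives the contradiction.\<close>
  define K where "K = q + 1"
  have bound: "(\<Sum>j=1..K. x ^ (j\<^sup>2)) \<le> real q" if x: "0 < x" "x < 1" for x :: real
  proof -
    have "(\<Sum>j=1..K. x ^ (j\<^sup>2)) - real N * (x ^ N / (1 - x))
        \<le> (\<Sum>n<N. chi (Suc n) / real (Suc n)) / (1 - x) + real q" if "K ^ 2 \<le> N" for N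
    proof -
      have "(\<Sum>j=1..K. x ^ (j\<^sup>2)) - real N * (x ^ N / (1 - x)) \<le> (\<Sum>n=1..N. chi n * (x ^ n / (1 - x ^ n)))"
        by (rule lambert_ge[OF x that])
      also have "\<dots> = (\<Sum>n<N. chi (Suc n) * (x ^ Suc n / (1 - x ^ Suc n)))"
        by (simp add: sum.atLeast1_atMost_eq)
      also have "\<dots> = (\<Sum>n<N. chi (Suc n) / real (Suc n) / (1 - x) - chi (Suc n) * monsky x (Suc n))"
        by (intro sum.cong refl) (simp add: monsky_def right_diff_distrib)
      also have "\<dots> = (\<Sum>n<N. chi (Suc n) / real (Suc n)) / (1 - x) - (\<Sum>n<N. chi (Suc n) * monsky x (Suc n))"
        by (simp add: sum_subtractf sum_divide_distrib)
      also have "\<bar>\<Sum>n<N. chi (Suc n) * monsky x (Suc n)\<bar> \<le> real q * monsky x (Suc 0)"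
        using monsky_props[OF x] by (intro abel_bound) auto
      hence "- (\<Sum>n<N. chi (Suc n) * monsky x (Suc n)) \<le> real q * monsky x (Suc 0)" by linarith
      hence "(\<Sum>n<N. chi (Suc n) / real (Suc n)) / (1 - x) - (\<Sum>n<N. chi (Suc n) * monsky x (Suc n))
          \<le> (\<Sum>n<N. chi (Suc n) / real (Suc n)) / (1 - x) + real q * monsky x (Suc 0)" by linarith
      also have "monsky x (Suc 0) = 1" using x by (simp add: monsky_def field_simps)
      finally show ?thesis by simp
    qed
    hence ev: "eventually (\<lambda>N. (\<Sum>j=1..K. x ^ (j\<^sup>2)) - real N * (x ^ N / (1 - x))
        \<le> (\<Sum>n<N. chi (Suc n) / real (Suc n)) / (1 - x) + real q) sequentially"
      using eventually_ge_at_top by (rule eventually_mono[rotated])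
    have "(\<lambda>N. real N * x ^ N) \<longlonglongrightarrow> 0"
      using powser_times_n_limit_0[of x] x by simp
    hence "(\<lambda>N. (\<Sum>j=1..K. x ^ (j\<^sup>2)) - real N * x ^ N / (1 - x)) \<longlonglongrightarrow> (\<Sum>j=1..K. x ^ (j\<^sup>2)) - 0 / (1 - x)"
      using x by (intro tendsto_intros) auto
    \<comment> \<open>The assumption that the series sums to 0 removes the only term that could blow
      up as x tends to 1.\<close>
    moreover have "(\<lambda>N. (\<Sum>n<N. chi (Suc n) / real (Suc n)) / (1 - x) + real q) \<longlonglongrightarrow> 0 / (1 - x) + real q"
      using x sums \<open>l = 0\<close> unfolding sums_def by (intro tendsto_intros) auto
    ultimately have "(\<Sum>j=1..K. x ^ (j\<^sup>2)) - 0 / (1 - x) \<le> 0 / (1 - x) + real q"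
      using ev by (intro tendsto_le[OF sequentially_bot]) (auto simp: times_divide_eq_right)
    thus ?thesis by simp
  qed
  have lim: "((\<lambda>x::real. \<Sum>j=1..K. x ^ (j\<^sup>2)) \<longlongrightarrow> (\<Sum>j=1..K. (1::real) ^ (j\<^sup>2))) (at_left 1)"
    by (intro tendsto_intros)
  have "eventually (\<lambda>x::real. 0 < x \<and> x < 1) (at_left 1)"
    using eventually_at_left_real[of 0 1] by auto
  hence "eventually (\<lambda>x::real. (\<Sum>j=1..K. x ^ (j\<^sup>2)) \<le> real q) (at_left 1)"
    by eventually_elim (use bound in auto)
  hence "(\<Sum>j=1..K. (1::real) ^ (j\<^sup>2)) \<le> real q"
    by (intro tendsto_upperbound[OF lim]) (simp_all add: trivial_limit_at_left_real)
  thus False by (simp add: K_def)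
qed

end

section \<open>The L-function in the right half plane\<close>

lemma norm_nat_powr: "n > 0 \<Longrightarrow> norm (of_nat n powr z :: complex) = real n powr Re z"
  by (simp add: norm_powr_real_powr)

text \<open>Mean value inequality on the segment from n to n + 1. The gain of a power of n is what
  makes the partially summed series converge absolutely for Re z > 0.\<close>

lemma powr_diff_bound:
  assumes "n > 0" "Re z \<ge> 0"
  shows "norm (of_nat n powr (-z) - of_nat (Suc n) powr (-z) :: complex) \<le> norm z * real n powr (- Re z - 1)"
proof -
  let ?S = "closed_segment (of_nat n) (of_nat (Suc n)) :: complex set"
  have seg: "w = of_real (Re w)" "Re w \<ge> real n" if "w \<in> ?S" for w
  proof -
    obtain u where u: "0 \<le> u" "u \<le> 1" "w = (1 - u) *\<^sub>R of_nat n + u *\<^sub>R of_nat (Suc n)"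
      using \<open>w \<in> ?S\<close> by (auto simp: in_segment)
    hence "w = of_real (real n + u)" by (simp add: scaleR_conv_of_real algebra_simps)
    thus "w = of_real (Re w)" "Re w \<ge> real n" using u(1) by simp_all
  qed
  have "norm (of_nat n powr (-z) - of_nat (Suc n) powr (-z) :: complex)
      \<le> norm z * real n powr (- Re z - 1) * norm (of_nat n - of_nat (Suc n) :: complex)"
  proof (rule field_differentiable_bound[of ?S])
    fix w assume w: "w \<in> ?S"
    have pos: "Re w > 0" using seg(2)[OF w] assms by simp
    hence "w \<notin> \<real>\<^sub>\<le>\<^sub>0" by (auto simp: complex_nonpos_Reals_iff)
    thus "((\<lambda>w. w powr (-z)) has_field_derivative (-z) * w powr (-z - 1)) (at w within ?S)"
      by (rule has_field_derivative_at_within[OF has_field_derivative_powr])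
    have wR: "w \<in> \<real>" by (metis seg(1)[OF w] Reals_of_real)
    have "norm (w powr (-z - 1)) = Re w powr (- Re z - 1)"
      using pos by (subst norm_powr_real_powr[OF wR]) auto
    also have "\<dots> \<le> real n powr (- Re z - 1)"
      using seg(2)[OF w] assms by (intro powr_mono2') auto
    finally show "norm (- z * w powr (- z - 1)) \<le> norm z * real n powr (- Re z - 1)"
      by (simp add: norm_mult mult_left_mono)
  qed (auto intro: ends_in_segment)
  also have "norm (of_nat n - of_nat (Suc n) :: complex) = 1" by simp
  finally show ?thesis by simp
qed

lemma DERIV_powr_neg:
  fixes w :: complex
  assumes "w \<noteq> 0"
  shows "((\<lambda>z. w powr (-z)) has_field_derivative - (Ln w * w powr (-z))) (at z)"
  unfolding powr_def using assms by (auto intro!: derivative_eq_intros)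

lemma summable_Suc_powr: "s < -1 \<Longrightarrow> summable (\<lambda>n. real (Suc n) powr s)"
  using summable_real_powr_iff[of s] by (subst summable_Suc_iff) auto

text \<open>The number zeta(3/2), from the exponent -1/2 - 1 at the edge Re z = 1/2.\<close>

definition K32 :: real where "K32 = (\<Sum>n. real (Suc n) powr (-3/2))"

lemma K32_ge_1: "K32 \<ge> 1"
proof -
  have "(\<Sum>n<1. real (Suc n) powr (-3/2)) \<le> K32"
    unfolding K32_def by (intro sum_le_suminf summable_Suc_powr) auto
  thus ?thesis by simp
qed

context real_char
begin

text \<open>\<open>L\<close> is defined through these terms because the Dirichlet series itself
  converges only conditionally for 0 < Re z \<le> 1.\<close>

definition abel_term :: "nat \<Rightarrow> complex \<Rightarrow> complex" where
  "abel_term n z = P (n + 2) *\<^sub>R (of_nat (Suc n) powr (-z) - of_nat (Suc (Suc n)) powr (-z))"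

definition L :: "complex \<Rightarrow> complex" where "L z = (\<Sum>n. abel_term n z)"

lemma norm_abel_term_le:
  assumes "Re z \<ge> 0"
  shows "norm (abel_term n z) \<le> real q * norm z * real (Suc n) powr (- Re z - 1)"
proof -
  have "norm (abel_term n z) \<le> real q * (norm z * real (Suc n) powr (- Re z - 1))"
    unfolding abel_term_def norm_scaleR using assms abs_P_le
    by (intro mult_mono powr_diff_bound) auto
  thus ?thesis by (simp add: mult.assoc)
qed

lemma abel_term_summable: "Re z > 0 \<Longrightarrow> summable (\<lambda>n. abel_term n z)"
proof (rule summable_comparison_test'[where N = 0])
  assume z: "Re z > 0"
  show "summable (\<lambda>n. real q * norm z * real (Suc n) powr (- Re z - 1))"
    using z by (intro summable_mult summable_Suc_powr) auto
  show "norm (abel_term n z) \<le> real q * norm z * real (Suc n) powr (- Re z - 1)" for n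
    using z by (intro norm_abel_term_le) auto
qed

lemma L_holomorphic: "L holomorphic_on {z. Re z > 0}"
proof -
  let ?S = "{z::complex. Re z > 0}"
  let ?D = "\<lambda>n z. P (n + 2) *\<^sub>R (- (Ln (of_nat (Suc n)) * of_nat (Suc n) powr (-z)) + Ln (of_nat (Suc (Suc n))) * of_nat (Suc (Suc n)) powr (-z)) :: complex"
  have "\<exists>g g'. \<forall>x\<in>?S. (\<lambda>n. abel_term n x) sums g x \<and> (\<lambda>n. ?D n x) sums g' x \<and> (g has_field_derivative g' x) (at x)"
  proof (rule series_and_derivative_comparison_local)
    show "open ?S" by (simp add: open_halfspace_Re_gt)
    show "(abel_term n has_field_derivative ?D n x) (at x)" if "x \<in> ?S" for n x
      unfolding abel_term_def scaleR_conv_of_real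
      by (rule derivative_eq_intros DERIV_powr_neg refl of_nat_neq_0 | simp del: of_nat_Suc)+
    fix x assume x: "x \<in> ?S"
    define d where "d = Re x / 2"
    have d: "d > 0" using x by (simp add: d_def)
    have "norm (abel_term n y) \<le> real q * (norm x + d) * real (Suc n) powr (- d - 1)"
      if "y \<in> ball x d" for n y
    proof -
      have dist: "norm (x - y) < d" using that by (simp add: dist_norm)
      have "Re (x - y) < d" using dist complex_Re_le_cmod[of "x - y"] by linarith
      hence re: "Re y > d" by (simp add: d_def)
      have nm: "norm y \<le> norm x + d" using dist norm_triangle_ineq2[of y x] by (simp add: norm_minus_commute)
      have "norm (abel_term n y) \<le> real q * norm y * real (Suc n) powr (- Re y - 1)"
        using re d by (intro norm_abel_term_le) auto
      also have "\<dots> \<le> real q * (norm x + d) * real (Suc n) powr (- d - 1)"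
        using re nm d by (intro mult_mono powr_mono) auto
      finally show ?thesis .
    qed
    moreover have "summable (\<lambda>n. real q * (norm x + d) * real (Suc n) powr (- d - 1))"
      using d by (intro summable_mult summable_Suc_powr) auto
    ultimately show "\<exists>d h. 0 < d \<and> summable h \<and> (\<forall>\<^sub>F n in sequentially. \<forall>y\<in>ball x d \<inter> ?S. norm (abel_term n y) \<le> h n)"
      using d by (intro exI[of _ d] exI[of _ "\<lambda>n. real q * (norm x + d) * real (Suc n) powr (- d - 1)"]) auto
  qed
  then obtain g g' where g: "\<And>x. x \<in> ?S \<Longrightarrow> (\<lambda>n. abel_term n x) sums g x" "\<And>x. x \<in> ?S \<Longrightarrow> (g has_field_derivative g' x) (at x)"
    by blast
  have "g holomorphic_on ?S"
    using g(2) by (auto simp: holomorphic_on_open open_halfspace_Re_gt)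
  moreover have "L x = g x" if "x \<in> ?S" for x
    using g(1)[OF that] by (simp add: L_def sums_iff)
  ultimately show ?thesis by (metis (no_types, lifting) holomorphic_cong)
qed

lemma L_sums:
  assumes "Re z > 0"
  shows "(\<lambda>n. chi (Suc n) *\<^sub>R (of_nat (Suc n) powr (-z))) sums L z"
proof -
  have "(\<lambda>m. P (m + 1) *\<^sub>R (of_nat (Suc m) powr (-z) :: complex)) \<longlonglongrightarrow> 0"
  proof (rule Lim_null_comparison)
    have "norm (P (m + 1) *\<^sub>R (of_nat (Suc m) powr (-z) :: complex)) \<le> real q * real (Suc m) powr (- Re z)" for m
      using abs_P_le[of "m + 1"] norm_nat_powr[of "Suc m" "-z"] by (simp add: mult_right_mono)
    thus "\<forall>\<^sub>F m in sequentially. norm (P (m + 1) *\<^sub>R (of_nat (Suc m) powr (-z) :: complex)) \<le> real q * real (Suc m) powr (- Re z)"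
      by simp
    have "(\<lambda>m. real (Suc m) powr (- Re z)) \<longlonglongrightarrow> 0"
      using assms by (intro tendsto_neg_powr filterlim_compose[OF filterlim_real_sequentially filterlim_Suc]) auto
    thus "(\<lambda>m. real q * real (Suc m) powr (- Re z)) \<longlonglongrightarrow> 0"
      by (rule tendsto_mult_right_zero)
  qed
  moreover have "(\<lambda>m. \<Sum>n<m. abel_term n z) \<longlonglongrightarrow> L z"
    using abel_term_summable[OF assms] unfolding L_def by (rule summable_LIMSEQ)
  ultimately have "(\<lambda>m. (\<Sum>n<m. abel_term n z) + P (m + 1) *\<^sub>R (of_nat (Suc m) powr (-z))) \<longlonglongrightarrow> L z + 0"
    by (intro tendsto_add)
  thus ?thesis
    unfolding sums_def using sum_by_parts[of "\<lambda>n. of_nat (Suc n) powr (-z) :: complex"]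
    by (simp add: abel_term_def)
qed

lemma norm_L_le:
  assumes "Re z \<ge> 1/2"
  shows "norm (L z) \<le> real q * norm z * K32"
proof -
  have sm: "summable (\<lambda>n. real q * norm z * real (Suc n) powr (-3/2))"
    by (intro summable_mult summable_Suc_powr) auto
  have le: "norm (abel_term n z) \<le> real q * norm z * real (Suc n) powr (-3/2)" for n
  proof -
    have "norm (abel_term n z) \<le> real q * norm z * real (Suc n) powr (- Re z - 1)"
      using assms by (intro norm_abel_term_le) auto
    also have "\<dots> \<le> real q * norm z * real (Suc n) powr (-3/2)"
      using assms by (intro mult_left_mono powr_mono) auto
    finally show ?thesis .
  qed
  have "norm (L z) \<le> (\<Sum>n. real q * norm z * real (Suc n) powr (-3/2))"
    unfolding L_def by (rule norm_suminf_le[OF le sm])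
  also have "\<dots> = real q * norm z * K32"
    unfolding K32_def by (intro suminf_mult summable_Suc_powr) auto
  finally show ?thesis .
qed

text \<open>The terms after the first add up to at most 2/3, since 1/k^2 \<le> 1/(k - 1/2) - 1/(k +
  1/2) telescopes from k = 2. This is the lower bound at the centre of the discs.\<close>

lemma norm_L_ge:
  assumes "Re z = 2"
  shows "norm (L z) \<ge> 1/3"
proof -
  let ?f = "\<lambda>n. chi (Suc n) *\<^sub>R (of_nat (Suc n) powr (-z) :: complex)"
  have "?f sums L z" using assms by (intro L_sums) auto
  hence sf: "(\<lambda>n. ?f (Suc n)) sums (L z - 1)"
    using one by (subst sums_Suc_iff) auto
  have "(\<lambda>n. 1 / (real n + 3/2)) \<longlonglongrightarrow> 0" by real_asymp
  hence tel: "(\<lambda>n. 1 / (real n + 3/2) - 1 / (real (Suc n) + 3/2)) sums (1 / (real 0 + 3/2) - 0)"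
    by (rule telescope_sums')
  have le: "norm (?f (Suc n)) \<le> 1 / (real n + 3/2) - 1 / (real (Suc n) + 3/2)" for n
  proof -
    have "norm (?f (Suc n)) \<le> 1 * real (Suc (Suc n)) powr (-2)"
      unfolding norm_scaleR using abs_le_1 assms norm_nat_powr[of "Suc (Suc n)" "-z"]
      by (intro mult_mono) auto
    also have "\<dots> = 1 / (real n + 2)\<^sup>2"
      by (simp add: powr_minus_divide add.commute)
    also have "\<dots> \<le> 1 / ((real n + 3/2) * (real n + 5/2))"
      by (intro divide_left_mono) (auto simp: power2_eq_square algebra_simps intro!: mult_pos_pos add_pos_nonneg)
    also have "\<dots> = 1 / (real n + 3/2) - 1 / (real (Suc n) + 3/2)"
      by (simp add: field_simps)
    finally show ?thesis .
  qed
  have "norm (\<Sum>n. ?f (Suc n)) \<le> (\<Sum>n. 1 / (real n + 3/2) - 1 / (real (Suc n) + 3/2))"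
    by (rule norm_suminf_le[OF le sums_summable[OF tel]])
  hence "norm (L z - 1) \<le> 2/3"
    using sums_unique[OF sf] sums_unique[OF tel] by simp
  thus ?thesis using norm_triangle_ineq2[of 1 "1 - L z"] by (simp add: norm_minus_commute)
qed

text \<open>\<open>GRH\<close> supplies some function on the half plane without 1; removing a point
  keeps that domain connected, so the identity theorem identifies it with \<open>L\<close>. At 1 the
  value comes from Monsky's argument.\<close>

lemma L_nonzero:
  assumes grh: GRH and z: "Re z > 1/2"
  shows "L z \<noteq> 0"
proof (cases "z = 1")
  case True
  have "(\<lambda>n. complex_of_real (chi (Suc n) / real (Suc n))) sums L 1"
    using L_sums[of 1] by (simp add: scaleR_conv_of_real powr_minus_divide)
  hence "(\<lambda>n. chi (Suc n) / real (Suc n)) sums Re (L 1)"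
    using sums_Re by fastforce
  hence "Re (L 1) \<noteq> 0" by (rule L_1_nonzero)
  thus ?thesis using True by auto
next
  case False
  obtain F where F: "F holomorphic_on ({z. Re z > 1/2} - {1})"
      "\<And>z. Re z > 1 \<Longrightarrow> (\<lambda>n. complex_of_real (chi (Suc n)) / of_nat (Suc n) powr z) sums F z"
      "\<And>z. Re z > 1/2 \<Longrightarrow> z \<noteq> 1 \<Longrightarrow> F z \<noteq> 0"
    using grh char unfolding GRH_def by blast
  have op: "open {z::complex. Re z > c}" for c by (rule open_halfspace_Re_gt)
  have "F z = L z"
  proof (rule analytic_continuation_open[of "{z. Re z > 1}" "{z. Re z > 1/2} - {1}" F L])
    show "{z::complex. Re z > 1} \<noteq> {}" by (auto intro!: exI[of _ 2])
    show "connected ({z. Re z > 1/2} - {1::complex})"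
      by (intro connected_open_delete convex_connected convex_halfspace_Re_gt op) auto
    show "open ({z. Re z > 1/2} - {1::complex})" by (intro open_Diff op closed_singleton)
    show "L holomorphic_on {z. Re z > 1/2} - {1}"
      by (rule holomorphic_on_subset[OF L_holomorphic]) auto
    fix w :: complex assume "w \<in> {z. Re z > 1}"
    hence w: "Re w > 1" by simp
    have "(\<lambda>n. complex_of_real (chi (Suc n)) / of_nat (Suc n) powr w) sums L w"
      using L_sums[of w] w by (simp add: scaleR_conv_of_real powr_minus_divide)
    thus "F w = L w" using F(2)[OF w] sums_unique2 by blast
  qed (use F(1) op z False in auto)
  thus ?thesis using F(3)[OF z False] by simp
qed

end

section \<open>Bounding the logarithmic derivative of \<open>L\<close>\<close>

lemma borel_caratheodory:
  fixes f :: "complex \<Rightarrow> complex"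
  assumes hol: "f holomorphic_on ball c R" and f0: "f c = 0" and R: "R > 0"
    and Re: "\<And>z. z \<in> ball c R \<Longrightarrow> Re (f z) < A" and r: "r < R" and z: "norm (z - c) \<le> r"
  shows "norm (f z) \<le> 2 * A * r / (R - r)"
proof -
  have A: "A > 0" using Re[of c] f0 R by simp
  define h where "h = (\<lambda>w. c + of_real R * w)"
  have h: "h w \<in> ball c R" if "norm w < 1" for w
    using that R by (simp add: h_def dist_norm norm_mult)
  \<comment> \<open>Re f < A says that f lies closer to 0 than to 2A, so \<open>g\<close> maps the
    unit disc into itself and fixes 0. The Schwarz lemma then bounds \<open>g\<close>, and solving
    for f gives the claim.\<close>
  define g where "g = (\<lambda>w. f (h w) / (of_real (2 * A) - f (h w)))"
  have nz: "of_real (2 * A) - f (h w) \<noteq> 0" if "norm w < 1" for w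
  proof
    assume "of_real (2 * A) - f (h w) = 0"
    hence "Re (f (h w)) = 2 * A" by (simp add: complex_eq_iff)
    thus False using Re[OF h[OF that]] A by simp
  qed
  define w where "w = (z - c) / of_real R"
  have w: "norm w \<le> r / R" "norm w < 1" "h w = z"
    using z r R by (auto simp: w_def h_def norm_divide divide_right_mono)
  have "norm (g w) \<le> norm w"
  proof (rule Schwarz_Lemma(1))
    have "(\<lambda>w. f (h w)) holomorphic_on ball 0 1"
    proof (rule holomorphic_on_compose_gen[unfolded o_def, OF _ hol])
      show "h holomorphic_on ball 0 1" unfolding h_def by (intro holomorphic_intros)
      show "h ` ball 0 1 \<subseteq> ball c R" using h by auto
    qed
    thus "g holomorphic_on ball 0 1" unfolding g_def using nz
      by (intro holomorphic_intros) auto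
    show "g 0 = 0" by (simp add: g_def h_def f0)
    show "norm (g w) < 1" if "norm w < 1" for w
    proof -
      let ?v = "f (h w)"
      have "Re ?v < A" using Re[OF h[OF that]] .
      moreover have "(norm (of_real (2 * A) - ?v))\<^sup>2 = (norm ?v)\<^sup>2 + 4 * A * (A - Re ?v)"
        unfolding cmod_power2 by (simp add: power2_eq_square algebra_simps)
      ultimately have "(norm ?v)\<^sup>2 < (norm (of_real (2 * A) - ?v))\<^sup>2"
        using A by simp
      hence "norm ?v < norm (of_real (2 * A) - ?v)"
        by (rule power_less_imp_less_base) simp
      thus ?thesis unfolding g_def using nz[OF that] by (simp add: norm_divide)
    qed
  qed (use w in auto)
  hence "norm (f z) \<le> norm w * norm (of_real (2 * A) - f z)"
    using nz[OF w(2)] by (simp add: g_def w(3) norm_divide field_simps)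
  also have "\<dots> \<le> norm w * (2 * A + norm (f z))"
    using norm_triangle_ineq4[of "of_real (2 * A)" "f z"] A by (intro mult_left_mono) auto
  also have "\<dots> \<le> r / R * (2 * A + norm (f z))"
    using w A by (intro mult_right_mono) auto
  finally have "norm (f z) * (R - r) \<le> 2 * A * r"
    using R by (simp add: field_simps)
  thus ?thesis using r by (simp add: field_simps)
qed

definition logderiv_const :: real where "logderiv_const = 4 + ln (3 * K32)"

context real_char
begin

text \<open>Since \<open>L\<close> has no zeros, log L exists on the half plane, and the size of
  \<open>L\<close> bounds its real part relative to the centre. Borel-Caratheodory then bounds log L
  itself at the price 3/(R - r) = 12/\<delta>, and Cauchy's inequality its derivative at the further
  price 2/\<delta>.\<close>

lemma logderiv_bound:
  assumes grh: GRH and \<delta>: "0 < \<delta>" "\<delta> \<le> 1/2" and z: "1/2 + \<delta> \<le> Re z" "Re z \<le> 2"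
  shows "norm (deriv L z / L z) \<le> 24 / \<delta>\<^sup>2 * (logderiv_const + ln (real q) + \<bar>Im z\<bar>)"
proof -
  let ?H = "{z::complex. Re z > 1/2}"
  have H: "convex ?H" "open ?H" by (rule convex_halfspace_Re_gt open_halfspace_Re_gt)+
  have holL: "L holomorphic_on ?H" by (rule holomorphic_on_subset[OF L_holomorphic]) auto
  obtain g where g: "g holomorphic_on ?H" "\<And>x. x \<in> ?H \<Longrightarrow> exp (g x) = L x"
    using holomorphic_logarithm_exists[OF H holL, of 2] L_nonzero[OF grh] by auto
  define c where "c = Complex 2 (Im z)"
  \<comment> \<open>The centre is at distance 3/2 from the critical line and z at distance at most
    3/2 - \<delta> from the centre. The radii \<open>R\<close> and \<open>r\<close> fit in between,
    leaving a gap \<delta>/4 for Borel-Caratheodory and a Cauchy disc of radius \<delta>/2 around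
    z.\<close>
  define R where "R = 3/2 - \<delta> / 4"
  define r where "r = 3/2 - \<delta> / 2"
  \<comment> \<open>The factor 3 comes from |L(c)| \<ge> 1/3, the 4 from |c| + R, and the added 1
    makes the bound strict.\<close>
  define A where "A = 1 + ln (3 * K32 * real q * (\<bar>Im z\<bar> + 4))"
  have rR: "0 < r" "r < R" "0 < R" "r \<le> 3/2" "R - r = \<delta> / 4" using \<delta> by (auto simp: r_def R_def)
  have Rel: "Re w > 1/2" "norm w \<le> \<bar>Im z\<bar> + 4" if "w \<in> ball c R" for w
  proof -
    have d: "norm (c - w) < R" using that by (simp add: dist_norm)
    have "Re (c - w) < R" using d complex_Re_le_cmod[of "c - w"] by linarith
    thus "Re w > 1/2" using \<delta> by (simp add: c_def R_def)
    have "norm c \<le> 2 + \<bar>Im z\<bar>" using cmod_le[of c] by (simp add: c_def)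
    moreover have "R \<le> 2" using \<delta> by (simp add: R_def)
    ultimately show "norm w \<le> \<bar>Im z\<bar> + 4"
      using d norm_triangle_ineq2[of w c] by (simp add: norm_minus_commute)
  qed
  have sub: "ball c R \<subseteq> ?H" using Rel by auto
  define f where "f = (\<lambda>w. g w - g c)"
  have cH: "c \<in> ?H" by (simp add: c_def)
  have fhol: "f holomorphic_on ball c R"
    unfolding f_def by (intro holomorphic_intros holomorphic_on_subset[OF g(1) sub])
  have "Re (f w) < A" if "w \<in> ball c R" for w
  proof -
    have w: "w \<in> ?H" using that sub by blast
    have "exp (Re (f w)) = norm (exp (f w))" by simp
    also have "exp (f w) = L w / L c" using g(2)[OF w] g(2)[OF cH] by (simp add: f_def exp_diff)
    also have "norm (L w / L c) = norm (L w) / norm (L c)" by (rule norm_divide)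
    also have "\<dots> \<le> (real q * norm w * K32) / (1/3)"
      using w K32_ge_1 by (intro frac_le norm_L_le norm_L_ge) (auto simp: c_def)
    also have "\<dots> \<le> 3 * K32 * real q * (\<bar>Im z\<bar> + 4)"
      using Rel(2)[OF that] K32_ge_1 mult_left_mono[of "norm w" "\<bar>Im z\<bar> + 4" "3 * K32 * real q"]
      by (simp add: mult_ac)
    finally have "exp (Re (f w)) \<le> 3 * K32 * real q * (\<bar>Im z\<bar> + 4)" .
    hence "Re (f w) \<le> ln (3 * K32 * real q * (\<bar>Im z\<bar> + 4))"
      by (metis exp_gt_zero ln_exp ln_le_cancel_iff order_less_le_trans)
    thus ?thesis by (simp add: A_def)
  qed
  note BC = borel_caratheodory[OF fhol _ rR(3) this rR(2)]
  have "Re (f c) < A" using \<open>\<And>w. w \<in> ball c R \<Longrightarrow> Re (f w) < A\<close> rR(3) by simp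
  hence A0: "A > 0" by (simp add: f_def)
  have fb: "norm (f w) \<le> 12 * A / \<delta>" if "norm (w - c) \<le> r" for w
  proof -
    have "norm (f w) \<le> 2 * A * r / (R - r)" using that by (intro BC) (auto simp: f_def)
    also have "\<dots> \<le> 2 * A * (3/2) / (R - r)"
      using rR A0 by (intro divide_right_mono mult_left_mono) auto
    also have "\<dots> = 12 * A / \<delta>" unfolding rR(5) using \<delta> by simp
    finally show ?thesis .
  qed
  have zc: "norm (z - c) \<le> 3/2 - \<delta>"
  proof -
    have "z - c = of_real (Re z - 2)" by (simp add: complex_eq_iff c_def)
    hence "norm (z - c) = \<bar>Re z - 2\<bar>" by (metis norm_of_real real_norm_def)
    thus ?thesis using z by simp
  qed
  have cb: "cball z (\<delta> / 2) \<subseteq> ball c R" and cr: "\<And>w. norm (z - w) = \<delta> / 2 \<Longrightarrow> norm (w - c) \<le> r"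
  proof -
    have "norm (w - c) \<le> r" if "norm (z - w) \<le> \<delta> / 2" for w
      using norm_triangle_ineq[of "w - z" "z - c"] zc that by (simp add: r_def norm_minus_commute)
    thus "cball z (\<delta> / 2) \<subseteq> ball c R" "\<And>w. norm (z - w) = \<delta> / 2 \<Longrightarrow> norm (w - c) \<le> r"
      using rR(2) by (force simp: dist_norm norm_minus_commute)+
  qed
  have "norm ((deriv ^^ 1) f z) \<le> fact 1 * (12 * A / \<delta>) / (\<delta> / 2) ^ 1"
  proof (rule Cauchy_inequality)
    show "f holomorphic_on ball z (\<delta> / 2)"
      by (rule holomorphic_on_subset[OF fhol]) (use cb in auto)
    show "continuous_on (cball z (\<delta> / 2)) f"
      by (rule holomorphic_on_imp_continuous_on[OF holomorphic_on_subset[OF fhol cb]])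
    show "norm (f w) \<le> 12 * A / \<delta>" if "norm (z - w) = \<delta> / 2" for w
      by (intro fb cr that)
  qed (use \<delta> in auto)
  hence 1: "norm (deriv f z) \<le> 24 / \<delta>\<^sup>2 * A"
    by (simp add: power2_eq_square)
  have zH: "z \<in> ?H" using z \<delta> by simp
  have dg: "(g has_field_derivative deriv g z) (at z)"
    using g(1) H(2) zH by (rule holomorphic_derivI)
  have "((\<lambda>w. exp (g w)) has_field_derivative exp (g z) * deriv g z) (at z)"
    by (rule DERIV_fun_exp[OF dg])
  hence "(L has_field_derivative exp (g z) * deriv g z) (at z)"
    using H(2) zH g(2) by (rule has_field_derivative_transform_within_open)
  hence "deriv L z = L z * deriv g z"
    using g(2)[OF zH] by (simp add: DERIV_imp_deriv)
  hence "deriv L z / L z = deriv g z" using L_nonzero[OF grh, of z] zH by simp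
  also have "deriv g z = deriv f z"
    unfolding f_def using dg by (intro DERIV_imp_deriv[symmetric]) (auto intro!: derivative_eq_intros)
  finally have "norm (deriv L z / L z) \<le> 24 / \<delta>\<^sup>2 * A" using 1 by simp
  moreover have "A \<le> logderiv_const + ln (real q) + \<bar>Im z\<bar>"
  proof -
    have "A = 1 + ln (3 * K32) + ln (real q) + ln (\<bar>Im z\<bar> + 4)"
      unfolding A_def using K32_ge_1 q_pos by (simp add: ln_mult)
    moreover have "ln (\<bar>Im z\<bar> + 4) \<le> \<bar>Im z\<bar> + 3"
      using ln_le_minus_one[of "\<bar>Im z\<bar> + 4"] abs_ge_zero[of "Im z"] by linarith
    ultimately show ?thesis by (simp add: logderiv_const_def)
  qed
  ultimately show ?thesis
    using \<delta> mult_left_mono[of A _ "24 / \<delta>\<^sup>2"] by (meson order.trans divide_nonneg_nonneg zero_le_numeral zero_le_power2)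
qed

end

section \<open>The Dirichlet series of the logarithmic derivative\<close>

lemma mangoldt_le_ln: "(mangoldt n :: real) \<le> ln (real n)"
  by (cases "n = 0") (auto intro: mangoldt_le)

lemma ln_nat_nonneg: "ln (real n) \<ge> 0"
  by (cases "n = 0") auto

lemma summable_ln_powr:
  assumes "s < -1"
  shows "summable (\<lambda>n. ln (real n) * real n powr s)"
proof (rule summable_comparison_test')
  define a where "a = (-1 - s) / 2"
  have a: "a > 0" "a + s < -1" using assms by (auto simp: a_def field_simps)
  show "summable (\<lambda>n. (1 / a) * real n powr (a + s))"
    using a by (intro summable_mult) (simp add: summable_real_powr_iff)
  fix n :: nat assume n: "n \<ge> 1"
  have "ln (real n) * real n powr s \<le> (real n powr a / a) * real n powr s"
    using n a by (intro mult_right_mono ln_powr_bound) auto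
  also have "\<dots> = (1 / a) * real n powr (a + s)" by (simp add: powr_add)
  finally show "norm (ln (real n) * real n powr s) \<le> (1 / a) * real n powr (a + s)"
    using ln_nat_nonneg[of n] by simp
qed

lemma powr_nat_mult: "of_nat (d * m) powr (z::complex) = of_nat d powr z * of_nat m powr z"
  unfolding of_nat_mult by (rule powr_times_real) auto

lemma summable_on_product:
  fixes a b :: "'i \<Rightarrow> complex"
  assumes a: "(\<lambda>x. norm (a x)) summable_on A" and b: "(\<lambda>y. norm (b y)) summable_on B"
  shows "(\<lambda>(x, y). a x * b y) summable_on A \<times> B"
proof -
  have "(\<lambda>p. norm (a (fst p) * b (snd p))) summable_on A \<times> B"
    unfolding Infinite_Sum.abs_summable_on_Sigma_iff
  proof (intro conjI ballI)
    show "(\<lambda>y. norm (a (fst (x, y)) * b (snd (x, y)))) summable_on B" for x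
      using b by (simp add: norm_mult summable_on_cmult_right)
    have "(\<Sum>\<^sub>\<infinity>y\<in>B. norm (a (fst (x, y)) * b (snd (x, y)))) = norm (a x) * (\<Sum>\<^sub>\<infinity>y\<in>B. norm (b y))" for x
      using b by (simp add: norm_mult infsum_cmult_right)
    thus "(\<lambda>x. norm (\<Sum>\<^sub>\<infinity>y\<in>B. norm (a (fst (x, y)) * b (snd (x, y))))) summable_on A"
      using a by (simp add: summable_on_cmult_left abs_mult infsum_nonneg)
  qed
  hence "(\<lambda>p. a (fst p) * b (snd p)) summable_on A \<times> B"
    by (rule Infinite_Sum.abs_summable_summable)
  thus ?thesis by (simp add: case_prod_unfold)
qed

context real_char
begin

lemma deriv_L_sums:
  assumes z: "Re z > 1"
  shows "(\<lambda>n. of_real (chi n * ln (real n)) * of_nat n powr (-z)) sums (- deriv L z)"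
proof -
  let ?S = "{z::complex. Re z > 1}"
  let ?f = "\<lambda>n z. chi (Suc n) *\<^sub>R (of_nat (Suc n) powr (-z)) :: complex"
  let ?D = "\<lambda>n z. chi (Suc n) *\<^sub>R (- (Ln (of_nat (Suc n)) * of_nat (Suc n) powr (-z))) :: complex"
  have "\<exists>g g'. \<forall>x\<in>?S. (\<lambda>n. ?f n x) sums g x \<and> (\<lambda>n. ?D n x) sums g' x \<and> (g has_field_derivative g' x) (at x)"
  proof (rule series_and_derivative_comparison_local)
    show "open ?S" by (simp add: open_halfspace_Re_gt)
    show "(?f n has_field_derivative ?D n x) (at x)" if "x \<in> ?S" for n x
      unfolding scaleR_conv_of_real by (intro DERIV_cmult DERIV_powr_neg of_nat_neq_0)
    fix x assume x: "x \<in> ?S"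
    define d where "d = (Re x - 1) / 2"
    have d: "d > 0" using x by (simp add: d_def)
    have "norm (?f n y) \<le> real (Suc n) powr (- 1 - d)" if "y \<in> ball x d" for n y
    proof -
      have dist: "norm (x - y) < d" using that by (simp add: dist_norm)
      have "Re (x - y) < d" using dist complex_Re_le_cmod[of "x - y"] by linarith
      hence re: "Re y > 1 + d" by (simp add: d_def field_simps)
      have "norm (?f n y) \<le> 1 * real (Suc n) powr (- Re y)"
        unfolding norm_scaleR using abs_le_1 norm_nat_powr[of "Suc n" "-y"] by (intro mult_mono) auto
      also have "\<dots> \<le> 1 * real (Suc n) powr (- 1 - d)"
        using re by (intro mult_left_mono powr_mono) auto
      finally show ?thesis by simp
    qed
    moreover have "summable (\<lambda>n. real (Suc n) powr (- 1 - d))"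
      using d by (intro summable_Suc_powr) auto
    ultimately show "\<exists>d h. 0 < d \<and> summable h \<and> (\<forall>\<^sub>F n in sequentially. \<forall>y\<in>ball x d \<inter> ?S. norm (?f n y) \<le> h n)"
      using d by (intro exI[of _ d] exI[of _ "\<lambda>n. real (Suc n) powr (- 1 - d)"]) auto
  qed
  then obtain g g' where g: "\<And>x. x \<in> ?S \<Longrightarrow> (\<lambda>n. ?f n x) sums g x" "\<And>x. x \<in> ?S \<Longrightarrow> (\<lambda>n. ?D n x) sums g' x"
      "\<And>x. x \<in> ?S \<Longrightarrow> (g has_field_derivative g' x) (at x)"
    by blast
  have zS: "z \<in> ?S" using z by simp
  have "(L has_field_derivative g' z) (at z)"
  proof (rule has_field_derivative_transform_within_open[OF g(3)[OF zS] _ zS])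
    show "open ?S" by (simp add: open_halfspace_Re_gt)
    show "g x = L x" if "x \<in> ?S" for x
      using g(1)[OF that] L_sums[of x] that sums_unique2 by force
  qed
  hence "deriv L z = g' z" by (rule DERIV_imp_deriv)
  hence "(\<lambda>n. - ?D n z) sums (- deriv L z)" using g(2)[OF zS] by (simp only: sums_minus)
  moreover have "- ?D n z = of_real (chi (Suc n) * ln (real (Suc n))) * of_nat (Suc n) powr (-z)" for n
    by (simp add: scaleR_conv_of_real Ln_of_nat del: of_nat_Suc)
  ultimately have "(\<lambda>n. of_real (chi (Suc n) * ln (real (Suc n))) * of_nat (Suc n) powr (-z)) sums (- deriv L z)"
    by simp
  thus ?thesis by (subst (asm) sums_Suc_iff) (simp add: zero)
qed

text \<open>The bound on \<open>b\<close> covers the three coefficient sequences at once: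
  \<open>mangoldt\<close>, the constant 1 and \<open>ln\<close>.\<close>

lemma summable_norm_chi:
  assumes z: "Re z > 1" and b: "\<And>n. \<bar>b n\<bar> \<le> ln (real n) + 1"
  shows "summable (\<lambda>n. norm (of_real (b n * chi n) * of_nat n powr (-z) :: complex))"
proof (rule summable_comparison_test')
  show "summable (\<lambda>n. ln (real n) * real n powr (- Re z) + real n powr (- Re z))"
    using z by (intro summable_add summable_ln_powr) (auto simp: summable_real_powr_iff)
  fix n :: nat assume n: "n \<ge> 1"
  have "norm (of_real (b n * chi n) * of_nat n powr (-z) :: complex) = \<bar>b n\<bar> * \<bar>chi n\<bar> * real n powr (- Re z)"
    using n by (simp add: norm_mult norm_nat_powr abs_mult)
  also have "\<dots> \<le> (ln (real n) + 1) * 1 * real n powr (- Re z)"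
    using b abs_le_1 ln_nat_nonneg by (intro mult_mono) auto
  finally show "norm (norm (of_real (b n * chi n) * of_nat n powr (-z) :: complex))
      \<le> ln (real n) * real n powr (- Re z) + real n powr (- Re z)"
    by (simp add: algebra_simps)
qed

text \<open>The convolution of \<Lambda> with 1 is ln. Complete multiplicativity allows both factors
  to be twisted by \<open>chi\<close>, so the series with coefficients \<Lambda> chi, times L,
  equals -L'.\<close>

lemma logderiv_sums:
  assumes grh: GRH and z: "Re z > 1"
  shows "(\<lambda>n. of_real (mangoldt n * chi n) * of_nat n powr (-z)) sums (- deriv L z / L z)"
proof -
  define a where "a = (\<lambda>n. of_real (mangoldt n * chi n) * of_nat n powr (-z) :: complex)"
  define b where "b = (\<lambda>n. of_real (chi n) * of_nat n powr (-z) :: complex)"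
  define e where "e = (\<lambda>n. of_real (chi n * ln (real n)) * of_nat n powr (-z) :: complex)"
  have na: "summable (\<lambda>n. norm (a n))"
    unfolding a_def using z
  proof (rule summable_norm_chi)
    show "\<bar>mangoldt n\<bar> \<le> ln (real n) + 1" for n
      using mangoldt_le_ln[of n] by simp
  qed
  have nb: "summable (\<lambda>n. norm (b n))"
    unfolding b_def using z summable_norm_chi[of z "\<lambda>_. 1"] ln_nat_nonneg by simp
  have ne: "summable (\<lambda>n. norm (e n))"
    unfolding e_def using z summable_norm_chi[of z "\<lambda>n. ln (real n)"] ln_nat_nonneg
    by (simp add: mult.commute)
  have "(\<lambda>n. b (Suc n)) sums L z" using L_sums[of z] z by (simp add: b_def scaleR_conv_of_real)
  hence bs: "b sums L z" by (subst (asm) sums_Suc_iff) (simp add: b_def zero)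
  define D where "D = suminf a"
  have as: "a sums D" unfolding D_def using summable_norm_cancel[OF na] by (rule summable_sums)
  have es: "e sums (- deriv L z)" unfolding e_def by (rule deriv_L_sums[OF z])
  \<comment> \<open>Excluding 0, where all terms vanish, keeps every divisor set finite and makes
    (d, m) \<mapsto> (dm, d) a bijection.\<close>
  let ?A = "{0::nat<..}"
  have restrict: "(f has_sum s) UNIV \<Longrightarrow> (f has_sum s) ?A" if "f 0 = 0" for f :: "nat \<Rightarrow> complex" and s
    using that by (subst has_sum_cong_neutral[of UNIV ?A f f]) auto
  have ah: "(a has_sum D) ?A" using norm_summable_imp_has_sum[OF na as]
    by (intro restrict) (simp_all add: a_def)
  have bh: "(b has_sum L z) ?A" using norm_summable_imp_has_sum[OF nb bs]
    by (intro restrict) (simp_all add: b_def)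
  have eh: "(e has_sum (- deriv L z)) ?A" using norm_summable_imp_has_sum[OF ne es]
    by (intro restrict) (simp_all add: e_def)
  have aabs: "(\<lambda>n. norm (a n)) summable_on ?A" "(\<lambda>n. norm (b n)) summable_on ?A"
    using norm_summable_imp_summable_on[of "\<lambda>n. norm (a n)"] norm_summable_imp_summable_on[of "\<lambda>n. norm (b n)"] na nb
    by (auto intro: summable_on_subset_banach)
  have "((\<lambda>(d, m). a d * b m) has_sum (D * L z)) (?A \<times> ?A)"
  proof (rule has_sum_SigmaI)
    show "((\<lambda>m. case (d, m) of (d, m) \<Rightarrow> a d * b m) has_sum (a d * L z)) ?A" for d
      using has_sum_cmult_right[OF bh] by simp
    show "((\<lambda>d. a d * L z) has_sum (D * L z)) ?A"
      by (rule has_sum_cmult_left[OF ah])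
    show "(\<lambda>(d, m). a d * b m) summable_on ?A \<times> ?A"
      by (rule summable_on_product[OF aabs])
  qed
  also have "?this \<longleftrightarrow> ((\<lambda>(n, d). mangoldt d * b n) has_sum (D * L z)) (Sigma ?A (\<lambda>n. {d. d dvd n}))"
  proof (rule has_sum_reindex_bij_witness[of _ "\<lambda>(n, d). (d, n div d)" "\<lambda>(d, m). (d * m, d)"])
    fix p assume "p \<in> ?A \<times> ?A"
    thus "(case case p of (d, m) \<Rightarrow> (d * m, d) of (n, d) \<Rightarrow> mangoldt d * b n) = (case p of (d, m) \<Rightarrow> a d * b m)"
      unfolding a_def b_def by (auto simp: mult powr_nat_mult simp del: of_nat_mult)
  qed (auto simp: dvd_div_eq_0_iff intro!: Nat.gr0I)
  finally have "((\<lambda>(n, d). mangoldt d * b n) has_sum (D * L z)) (Sigma ?A (\<lambda>n. {d. d dvd n}))" .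
  hence "(e has_sum (D * L z)) ?A"
  proof (rule has_sum_SigmaD)
    fix n :: nat assume n: "n \<in> ?A"
    have "(\<Sum>d | d dvd n. mangoldt d * b n) = e n"
      using n mangoldt_sum[of n, where 'a = complex] by (simp flip: sum_distrib_right add: e_def b_def mult_ac)
    moreover have "finite {d. d dvd n}" using n by simp
    ultimately show "((\<lambda>d. case (n, d) of (n, d) \<Rightarrow> mangoldt d * b n) has_sum e n) {d. d dvd n}"
      by (simp add: has_sum_finite_iff)
  qed
  hence "D * L z = - deriv L z" using eh has_sum_unique by blast
  moreover have "L z \<noteq> 0" using L_nonzero[OF grh, of z] z by simp
  ultimately have "D = - deriv L z / L z" by (simp add: field_simps)
  thus ?thesis using as by (simp add: a_def)
qed

end

section \<open>A Gaussian Perron formula\<close>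

lemma gauss_integrable: "integrable lborel (\<lambda>t::real. exp (- t\<^sup>2 / 2))"
  and gauss_integral: "(\<integral>t. exp (- t\<^sup>2 / 2) \<partial>lborel) = sqrt (2 * pi)"
proof -
  have eq: "exp (- t\<^sup>2 / 2) = sqrt (2 * pi) * (std_normal_density t * t ^ 0)" for t :: real
    by (simp add: std_normal_density_def)
  show "integrable lborel (\<lambda>t::real. exp (- t\<^sup>2 / 2))"
    unfolding eq by (intro integrable_mult_right integrable_std_normal_moment)
  show "(\<integral>t. exp (- t\<^sup>2 / 2) \<partial>lborel) = sqrt (2 * pi)"
    unfolding eq using integral_std_normal_moment_even[of 0] by simp
qed

lemma integrable_gauss_bound:
  fixes f :: "real \<Rightarrow> complex"
  assumes cont: "continuous_on UNIV f" and bound: "\<And>t. norm (f t) \<le> K * exp (- t\<^sup>2 / 2)"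
  shows "integrable lborel f" and "norm (\<integral>t. f t \<partial>lborel) \<le> K * sqrt (2 * pi)"
proof -
  have meas: "f \<in> borel_measurable lborel"
    using borel_measurable_continuous_onI[OF cont] by simp
  have intK: "integrable lborel (\<lambda>t::real. K * exp (- t\<^sup>2 / 2))"
    by (intro integrable_mult_right gauss_integrable)
  have "AE t in lborel. norm (f t) \<le> norm (K * exp (- t\<^sup>2 / 2))"
    using bound by (intro AE_I2) (smt (verit) real_norm_def)
  from Bochner_Integration.integrable_bound[OF intK meas this] show int: "integrable lborel f" .
  have "norm (\<integral>t. f t \<partial>lborel) \<le> (\<integral>t. norm (f t) \<partial>lborel)"
    by (rule integral_norm_bound)
  also have "\<dots> \<le> (\<integral>t. K * exp (- t\<^sup>2 / 2) \<partial>lborel)"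
    using int intK bound by (intro integral_mono) auto
  also have "\<dots> = K * sqrt (2 * pi)"
    unfolding gauss_integral[symmetric] by (rule integral_mult_right_zero)
  finally show "norm (\<integral>t. f t \<partial>lborel) \<le> K * sqrt (2 * pi)" .
qed

text \<open>The characteristic function of the standard normal distribution, after rescaling the
  variable by the square root of 2.\<close>

lemma gauss_fourier:
  "(\<integral>t. exp (- t\<^sup>2) *\<^sub>R exp (\<i> * of_real (v * t)) \<partial>lborel) = complex_of_real (sqrt pi * exp (- v\<^sup>2 / 4))"
proof -
  define u where "u = v / sqrt 2"
  have "complex_of_real (exp (- u\<^sup>2 / 2)) = char std_normal_distribution u"
    by (simp add: char_std_normal_distribution)
  also have "\<dots> = (\<integral>x. std_normal_density x *\<^sub>R exp (\<i> * of_real (u * x)) \<partial>lborel)"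
    unfolding char_def by (subst integral_density) (auto simp: normal_density_nonneg)
  also have "\<dots> = \<bar>sqrt 2\<bar> *\<^sub>R (\<integral>x. std_normal_density (0 + sqrt 2 * x) *\<^sub>R exp (\<i> * of_real (u * (0 + sqrt 2 * x))) \<partial>lborel)"
    by (rule lborel_integral_real_affine) simp
  also have "(\<lambda>x. std_normal_density (0 + sqrt 2 * x) *\<^sub>R exp (\<i> * of_real (u * (0 + sqrt 2 * x))))
      = (\<lambda>x. (1 / sqrt (2 * pi)) *\<^sub>R (exp (- x\<^sup>2) *\<^sub>R exp (\<i> * of_real (v * x))))"
    by (simp add: fun_eq_iff std_normal_density_def u_def power_mult_distrib)
  also have "(\<integral>x. (1 / sqrt (2 * pi)) *\<^sub>R (exp (- x\<^sup>2) *\<^sub>R exp (\<i> * of_real (v * x))) \<partial>lborel)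
      = (1 / sqrt (2 * pi)) *\<^sub>R (\<integral>x. exp (- x\<^sup>2) *\<^sub>R exp (\<i> * of_real (v * x)) \<partial>lborel)"
    by (rule integral_scaleR_right)
  finally have "complex_of_real (exp (- u\<^sup>2 / 2)) =
      (1 / sqrt pi) *\<^sub>R (\<integral>x. exp (- x\<^sup>2) *\<^sub>R exp (\<i> * of_real (v * x)) \<partial>lborel)"
    by (simp add: real_sqrt_mult)
  moreover have "u\<^sup>2 / 2 = v\<^sup>2 / 4" by (simp add: u_def power_divide)
  ultimately show ?thesis by (simp add: scaleR_conv_of_real field_simps)
qed

text \<open>Taking out exp(c^2 + c l) leaves a Gaussian Fourier transform at frequency 2c + l, and
  c^2 + c l - (2c + l)^2 / 4 = -l^2 / 4, so c drops out. For l = ln(X/n) the value is a multiple of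
  the weight.\<close>

lemma gauss_mellin:
  fixes c l :: real
  shows "(\<integral>t. exp ((Complex c t)\<^sup>2 + Complex c t * of_real l) \<partial>lborel)
    = complex_of_real (sqrt pi * exp (- l\<^sup>2 / 4))"
proof -
  have "exp ((Complex c t)\<^sup>2 + Complex c t * of_real l) =
      exp (c\<^sup>2 + c * l) *\<^sub>R (exp (- t\<^sup>2) *\<^sub>R exp (\<i> * of_real ((2 * c + l) * t)))" for t
  proof -
    have "(Complex c t)\<^sup>2 + Complex c t * of_real l
        = of_real (c\<^sup>2 + c * l) + of_real (- t\<^sup>2) + \<i> * of_real ((2 * c + l) * t)"
      by (simp add: complex_eq_iff power2_eq_square algebra_simps)
    thus ?thesis by (simp only: exp_add exp_of_real scaleR_conv_of_real mult.assoc)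
  qed
  hence "(\<integral>t. exp ((Complex c t)\<^sup>2 + Complex c t * of_real l) \<partial>lborel) =
      exp (c\<^sup>2 + c * l) *\<^sub>R (\<integral>t. exp (- t\<^sup>2) *\<^sub>R exp (\<i> * of_real ((2 * c + l) * t)) \<partial>lborel)"
    by (simp only: integral_scaleR_right)
  also have "\<dots> = of_real (sqrt pi * (exp (c\<^sup>2 + c * l) * exp (- (2 * c + l)\<^sup>2 / 4)))"
    unfolding gauss_fourier by (simp add: scaleR_conv_of_real)
  also have "exp (c\<^sup>2 + c * l) * exp (- (2 * c + l)\<^sup>2 / 4) = exp (- l\<^sup>2 / 4)"
    unfolding exp_add[symmetric] by (rule arg_cong[of _ _ exp]) (simp add: power2_eq_square field_simps)
  finally show ?thesis .
qed

text \<open>A primitive F on the convex half plane replaces rectangular contours: truncated vertical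
  integrals are differences of F, and the horizontal differences are killed by the Gaussian bound at
  large height.\<close>

lemma vertical_shift:
  fixes G :: "complex \<Rightarrow> complex"
  assumes hol: "G holomorphic_on {z. Re z > a}" and cd: "a < c" "c \<le> d"
    and bound: "\<And>z. c \<le> Re z \<Longrightarrow> Re z \<le> d \<Longrightarrow> norm (G z) \<le> K * exp (- (Im z)\<^sup>2 / 2)"
  shows "(\<integral>t. G (Complex c t) \<partial>lborel) = (\<integral>t. G (Complex d t) \<partial>lborel)"
proof -
  let ?H = "{z. Re z > a}"
  have H: "convex ?H" "open ?H" by (rule convex_halfspace_Re_gt open_halfspace_Re_gt)+
  obtain F where F: "\<And>z. z \<in> ?H \<Longrightarrow> (F has_field_derivative G z) (at z)"
    using holomorphic_convex_primitive'[OF H hol] H(2) by (metis at_within_open)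
  have K: "K \<ge> 0"
    using order.trans[OF norm_ge_zero bound[of "of_real c"]] cd by simp
  have contG: "continuous_on UNIV (\<lambda>t. G (Complex x t))" if "x > a" for x
  proof -
    have "continuous_on UNIV (\<lambda>t. Complex x t)"
      unfolding Complex_eq by (intro continuous_intros)
    moreover have "continuous_on ?H G" using hol by (rule holomorphic_on_imp_continuous_on)
    ultimately show ?thesis using that by (auto intro!: continuous_on_compose2[of ?H G UNIV])
  qed
  have lim: "(\<lambda>k. F (Complex x (real k)) - F (Complex x (- real k))) \<longlonglongrightarrow> \<i> * (\<integral>t. G (Complex x t) \<partial>lborel)"
    if x: "c \<le> x" "x \<le> d" for x
  proof -
    have eq: "(\<integral>t. indicator {- real k..real k} t *\<^sub>R (\<i> * G (Complex x t)) \<partial>lborel)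
        = F (Complex x (real k)) - F (Complex x (- real k))" for k :: nat
    proof (rule integral_FTC_Icc)
      fix t assume "- real k \<le> t" "t \<le> real k"
      have "(F has_field_derivative G (Complex x t)) (at (Complex x t))"
        using x cd by (intro F) auto
      moreover have "((\<lambda>t. Complex x t) has_vector_derivative \<i>) (at t within {- real k..real k})"
        unfolding Complex_eq by (auto intro!: derivative_eq_intros)
      ultimately have "((F \<circ> (\<lambda>t. Complex x t)) has_vector_derivative (\<i> * G (Complex x t))) (at t within {- real k..real k})"
        by (rule field_vector_diff_chain_within[rotated, OF has_field_derivative_at_within])
      thus "((\<lambda>t. F (Complex x t)) has_vector_derivative (\<i> * G (Complex x t))) (at t within {- real k..real k})"
        by (simp add: o_def)
    qed (use contG[of x] x cd in \<open>auto intro!: continuous_intros continuous_on_subset[OF contG]\<close>)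
    have meas: "(\<lambda>t. \<i> * G (Complex x t)) \<in> borel_measurable lborel"
      using borel_measurable_continuous_onI[OF contG[of x]] x cd by simp
    have "(\<lambda>k. \<integral>t. indicator {- real k..real k} t *\<^sub>R (\<i> * G (Complex x t)) \<partial>lborel) \<longlonglongrightarrow> (\<integral>t. \<i> * G (Complex x t) \<partial>lborel)"
    proof (rule integral_dominated_convergence[where w = "\<lambda>t. K * exp (- t\<^sup>2 / 2)"])
      show "integrable lborel (\<lambda>t. K * exp (- t\<^sup>2 / 2))" by (intro integrable_mult_right gauss_integrable)
      show "AE t in lborel. (\<lambda>k. indicator {- real k..real k} t *\<^sub>R (\<i> * G (Complex x t))) \<longlonglongrightarrow> \<i> * G (Complex x t)"
      proof (rule AE_I2, rule tendsto_eventually)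
        fix t :: real
        show "\<forall>\<^sub>F k in sequentially. indicator {- real k..real k} t *\<^sub>R (\<i> * G (Complex x t)) = \<i> * G (Complex x t)"
          using eventually_ge_at_top[of "nat \<lceil>\<bar>t\<bar>\<rceil>"]
        proof eventually_elim
          case (elim k)
          hence "\<bar>t\<bar> \<le> real k" by linarith
          thus ?case by (auto simp: indicator_def)
        qed
      qed
      show "AE t in lborel. norm (indicator {- real k..real k} t *\<^sub>R (\<i> * G (Complex x t))) \<le> K * exp (- t\<^sup>2 / 2)" for k :: nat
      proof (rule AE_I2)
        fix t :: real
        have "norm (G (Complex x t)) \<le> K * exp (- t\<^sup>2 / 2)" using bound[of "Complex x t"] x by simp
        thus "norm (indicator {- real k..real k} t *\<^sub>R (\<i> * G (Complex x t))) \<le> K * exp (- t\<^sup>2 / 2)"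
          using K by (auto simp: indicator_def norm_mult)
      qed
    qed (use meas in auto)
    thus ?thesis unfolding eq by simp
  qed
  have horiz: "norm (F (Complex d y) - F (Complex c y)) \<le> K * exp (- y\<^sup>2 / 2) * (d - c)" for y
  proof -
    let ?S = "closed_segment (Complex c y) (Complex d y)"
    have seg: "Im w = y" "c \<le> Re w" "Re w \<le> d" if "w \<in> ?S" for w
      using that cd closed_segment_same_Im[of "Complex c y" "Complex d y"]
      by (auto simp: closed_segment_eq_real_ivl)
    have "norm (F (Complex d y) - F (Complex c y)) \<le> K * exp (- y\<^sup>2 / 2) * norm (Complex d y - Complex c y)"
    proof (rule field_differentiable_bound[of ?S])
      show "(F has_field_derivative G w) (at w within ?S)" if "w \<in> ?S" for w
        using seg[OF that] cd by (intro has_field_derivative_at_within[OF F]) auto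
      show "norm (G w) \<le> K * exp (- y\<^sup>2 / 2)" if "w \<in> ?S" for w
        using bound[of w] seg[OF that] by simp
    qed auto
    also have "Complex d y - Complex c y = of_real (d - c)" by (simp add: complex_eq_iff)
    finally show ?thesis using cd by (simp only: norm_of_real)
  qed
  have "(\<lambda>k. (F (Complex d (real k)) - F (Complex d (- real k))) - (F (Complex c (real k)) - F (Complex c (- real k)))) \<longlonglongrightarrow> 0"
  proof (rule Lim_null_comparison)
    show "\<forall>\<^sub>F k in sequentially. norm ((F (Complex d (real k)) - F (Complex d (- real k))) - (F (Complex c (real k)) - F (Complex c (- real k))))
        \<le> 2 * (K * exp (- (real k)\<^sup>2 / 2) * (d - c))"
    proof (intro always_eventually allI)
      fix k
      have "norm ((F (Complex d (real k)) - F (Complex d (- real k))) - (F (Complex c (real k)) - F (Complex c (- real k))))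
          \<le> norm (F (Complex d (real k)) - F (Complex c (real k))) + norm (F (Complex d (- real k)) - F (Complex c (- real k)))"
        using norm_triangle_ineq4[of "F (Complex d (real k)) - F (Complex c (real k))" "F (Complex d (- real k)) - F (Complex c (- real k))"]
        by (simp add: algebra_simps)
      also have "\<dots> \<le> 2 * (K * exp (- (real k)\<^sup>2 / 2) * (d - c))"
        using horiz[of "real k"] horiz[of "- real k"] by simp
      finally show "norm ((F (Complex d (real k)) - F (Complex d (- real k))) - (F (Complex c (real k)) - F (Complex c (- real k))))
        \<le> 2 * (K * exp (- (real k)\<^sup>2 / 2) * (d - c))" .
    qed
    have "(\<lambda>k. exp (- (real k)\<^sup>2 / 2)) \<longlonglongrightarrow> 0" by real_asymp
    hence "(\<lambda>k. 2 * (K * exp (- (real k)\<^sup>2 / 2) * (d - c))) \<longlonglongrightarrow> 2 * (K * 0 * (d - c))"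
      by (intro tendsto_intros)
    thus "(\<lambda>k. 2 * (K * exp (- (real k)\<^sup>2 / 2) * (d - c))) \<longlonglongrightarrow> 0" by simp
  qed
  moreover have "(\<lambda>k. (F (Complex d (real k)) - F (Complex d (- real k))) - (F (Complex c (real k)) - F (Complex c (- real k))))
      \<longlonglongrightarrow> \<i> * (\<integral>t. G (Complex d t) \<partial>lborel) - \<i> * (\<integral>t. G (Complex c t) \<partial>lborel)"
    using cd by (intro tendsto_diff lim) auto
  ultimately have "\<i> * (\<integral>t. G (Complex d t) \<partial>lborel) - \<i> * (\<integral>t. G (Complex c t) \<partial>lborel) = 0"
    using LIMSEQ_unique by blast
  thus ?thesis by simp
qed

text \<open>Half of the Gaussian decay is spent on absorbing the linear growth of L'/L, since |t|
  \<le> 1 + t^2/2 \<le> exp(t^2/2).\<close>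

lemma linear_gauss_le:
  fixes t B :: real
  assumes "B \<ge> 0"
  shows "(B + \<bar>t\<bar>) * exp (- t\<^sup>2) \<le> (B + 1) * exp (- t\<^sup>2 / 2)"
proof -
  have "1 + t\<^sup>2 / 2 \<le> exp (t\<^sup>2 / 2)" by (rule exp_ge_add_one_self)
  moreover have "\<bar>t\<bar> \<le> 1 + t\<^sup>2 / 2"
    using zero_le_power2[of "\<bar>t\<bar> - 1"] by (simp add: power2_eq_square algebra_simps)
  ultimately have "\<bar>t\<bar> \<le> exp (t\<^sup>2 / 2)" by linarith
  moreover have "B * 1 \<le> B * exp (t\<^sup>2 / 2)" using assms by (intro mult_left_mono) auto
  ultimately have "(B + \<bar>t\<bar>) * exp (- t\<^sup>2) \<le> ((B + 1) * exp (t\<^sup>2 / 2)) * exp (- t\<^sup>2)"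
    by (intro mult_right_mono) (auto simp: algebra_simps)
  also have "\<dots> = (B + 1) * exp (t\<^sup>2 / 2 + - t\<^sup>2)" by (simp only: exp_add mult.assoc)
  also have "t\<^sup>2 / 2 + - t\<^sup>2 = - t\<^sup>2 / 2" by simp
  finally show ?thesis .
qed

section \<open>Character sums over primes from the contour integral\<close>

lemma summable_mangoldt_gweight:
  assumes "X \<ge> 1"
  shows "summable (\<lambda>n. mangoldt n * gweight X n :: real)"
    and "(\<Sum>n. mangoldt n * gweight X n) \<le> 20 * exp 4 * X"
proof -
  have b: "(\<Sum>k=1..n. mangoldt k) \<le> 4 * real n powr 1" for n
    using psi_le[of n] by (simp add: psi_def)
  note * = gweight_series_le[of mangoldt 4 1 X, OF mangoldt_nonneg b _ _ _ assms mangoldt_0]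
  show "summable (\<lambda>n. mangoldt n * gweight X n :: real)" by (rule *) auto
  show "(\<Sum>n. mangoldt n * gweight X n) \<le> 20 * exp 4 * X"
    using *(2) assms by simp
qed

lemma nonprime_gweight:
  assumes X: "X \<ge> 1" and \<delta>: "0 < \<delta>" "\<delta> \<le> 1/2"
  defines "a \<equiv> (\<lambda>n. if prime n then 0 else mangoldt n :: real)"
  shows "summable (\<lambda>n. a n * gweight X n)"
    and "(\<Sum>n. a n * gweight X n) \<le> 5 * exp 4 * (1 / \<delta>) * X powr (1/2 + \<delta>)"
proof -
  have b: "(\<Sum>k=1..n. a k) \<le> 1 / \<delta> * real n powr (1/2 + \<delta>)" for n
  proof (cases "n = 0")
    case False
    have "(\<Sum>k=1..n. a k) \<le> sqrt (real n) * ln (real n)"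
      unfolding a_def by (rule sum_mangoldt_nonprime_le)
    \<comment> \<open>The logarithm is traded for n^\<delta>/\<delta>, which costs nothing next to
      the GRH term of the same order.\<close>
    also have "\<dots> \<le> sqrt (real n) * (real n powr \<delta> / \<delta>)"
      using False \<delta> by (intro mult_left_mono ln_powr_bound) auto
    also have "\<dots> = 1 / \<delta> * real n powr (1/2 + \<delta>)"
      using False by (simp add: powr_add powr_half_sqrt)
    finally show ?thesis .
  qed auto
  have nn: "a n \<ge> 0" for n by (simp add: a_def mangoldt_nonneg)
  note * = gweight_series_le[of a "1 / \<delta>" "1/2 + \<delta>" X, OF nn b _ _ _ X]
  show "summable (\<lambda>n. a n * gweight X n)" by (rule *) (use \<delta> in \<open>auto simp: a_def\<close>)
  show "(\<Sum>n. a n * gweight X n) \<le> 5 * exp 4 * (1 / \<delta>) * X powr (1/2 + \<delta>)"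
    by (rule *) (use \<delta> in \<open>auto simp: a_def\<close>)
qed

lemma logderiv_const_ge: "logderiv_const \<ge> 4"
  using K32_ge_1 by (simp add: logderiv_const_def)

context real_char
begin

definition G :: "real \<Rightarrow> complex \<Rightarrow> complex" where
  "G X z = exp (z\<^sup>2 + z * of_real (ln X)) * (deriv L z / L z)"

lemma G_holomorphic:
  assumes GRH
  shows "G X holomorphic_on {z. Re z > 1/2}"
proof -
  have hol: "L holomorphic_on {z. Re z > 1/2}"
    by (rule holomorphic_on_subset[OF L_holomorphic]) auto
  show ?thesis unfolding G_def
    using L_nonzero[OF assms]
    by (intro holomorphic_intros holomorphic_deriv hol open_halfspace_Re_gt) auto
qed

lemma norm_G_le:
  assumes grh: GRH and \<delta>: "0 < \<delta>" "\<delta> \<le> 1/2" and z: "1/2 + \<delta> \<le> Re z" "Re z \<le> 2" and X: "X \<ge> 1"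
  shows "norm (G X z) \<le> exp ((Re z)\<^sup>2) * X powr Re z * (24 / \<delta>\<^sup>2 * (logderiv_const + ln (real q) + 1)) * exp (- (Im z)\<^sup>2 / 2)"
proof -
  define B where "B = logderiv_const + ln (real q)"
  have B: "B \<ge> 0" using logderiv_const_ge q_gt_1 by (simp add: B_def)
  have "Re (z\<^sup>2 + z * of_real (ln X)) = (Re z)\<^sup>2 + Re z * ln X + - (Im z)\<^sup>2"
    by (simp add: power2_eq_square)
  hence "norm (exp (z\<^sup>2 + z * of_real (ln X))) = exp ((Re z)\<^sup>2 + Re z * ln X + - (Im z)\<^sup>2)"
    by (simp only: norm_exp_eq_Re)
  also have "\<dots> = exp ((Re z)\<^sup>2) * X powr Re z * exp (- (Im z)\<^sup>2)"
    using X by (simp add: exp_add exp_diff exp_minus powr_def divide_inverse)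
  finally have "norm (exp (z\<^sup>2 + z * of_real (ln X))) = exp ((Re z)\<^sup>2) * X powr Re z * exp (- (Im z)\<^sup>2)" .
  hence "norm (G X z) \<le> exp ((Re z)\<^sup>2) * X powr Re z * exp (- (Im z)\<^sup>2) * (24 / \<delta>\<^sup>2 * (B + \<bar>Im z\<bar>))"
    unfolding G_def norm_mult B_def
    using logderiv_bound[OF grh \<delta> z] by (intro mult_mono) auto
  also have "\<dots> = exp ((Re z)\<^sup>2) * X powr Re z * (24 / \<delta>\<^sup>2) * ((B + \<bar>Im z\<bar>) * exp (- (Im z)\<^sup>2))"
    by (simp add: mult_ac)
  also have "\<dots> \<le> exp ((Re z)\<^sup>2) * X powr Re z * (24 / \<delta>\<^sup>2) * ((B + 1) * exp (- (Im z)\<^sup>2 / 2))"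
    using B by (intro mult_left_mono linear_gauss_le) auto
  finally show ?thesis by (simp only: B_def mult.assoc)
qed

text \<open>The shift from Re z = 2 to Re z = 1/2 + \<delta> crosses no pole, because
  \<open>L\<close> is holomorphic and free of zeros there, the point 1 included.\<close>

lemma G_integral_bound:
  assumes grh: GRH and \<delta>: "0 < \<delta>" "\<delta> \<le> 1/2" and X: "X \<ge> 1"
  shows "norm (\<integral>t. G X (Complex 2 t) \<partial>lborel)
    \<le> exp 1 * X powr (1/2 + \<delta>) * (24 / \<delta>\<^sup>2 * (logderiv_const + ln (real q) + 1)) * sqrt (2 * pi)"
proof -
  define A where "A = 24 / \<delta>\<^sup>2 * (logderiv_const + ln (real q) + 1)"
  have A: "A \<ge> 0" using logderiv_const_ge q_gt_1 by (simp add: A_def)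
  define c where "c = 1/2 + \<delta>"
  have c: "1/2 < c" "0 < c" "c \<le> 1" using \<delta> by (auto simp: c_def)
  have "(\<integral>t. G X (Complex c t) \<partial>lborel) = (\<integral>t. G X (Complex 2 t) \<partial>lborel)"
  proof (rule vertical_shift[OF G_holomorphic[OF grh] c(1)])
    fix z assume z: "c \<le> Re z" "Re z \<le> 2"
    have "norm (G X z) \<le> exp ((Re z)\<^sup>2) * X powr Re z * A * exp (- (Im z)\<^sup>2 / 2)"
      unfolding A_def using norm_G_le[OF grh \<delta> _ z(2) X] z by (simp add: c_def)
    \<comment> \<open>A bound uniform over the strip is needed only to justify the shift; its size
      in X is irrelevant, as the final estimate is taken on the left edge.\<close>
    also have "\<dots> \<le> exp 4 * X powr 2 * A * exp (- (Im z)\<^sup>2 / 2)"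
    proof -
      have "(Re z)\<^sup>2 \<le> 2\<^sup>2" using z c by (intro power_mono) auto
      thus ?thesis using z X A by (intro mult_right_mono mult_mono powr_mono) auto
    qed
    finally show "norm (G X z) \<le> exp 4 * X powr 2 * A * exp (- (Im z)\<^sup>2 / 2)" .
  qed (use c in auto)
  moreover have "norm (\<integral>t. G X (Complex c t) \<partial>lborel) \<le> exp 1 * X powr c * A * sqrt (2 * pi)"
  proof (rule integrable_gauss_bound(2))
    have "continuous_on UNIV (\<lambda>t. Complex c t)" unfolding Complex_eq by (intro continuous_intros)
    moreover have "continuous_on {z. Re z > 1/2} (G X)"
      using G_holomorphic[OF grh] by (rule holomorphic_on_imp_continuous_on)
    ultimately show "continuous_on UNIV (\<lambda>t. G X (Complex c t))"
      using c by (auto intro!: continuous_on_compose2[of "{z. Re z > 1/2}" "G X" UNIV])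
    fix t
    have "norm (G X (Complex c t)) \<le> exp (c\<^sup>2) * X powr c * A * exp (- t\<^sup>2 / 2)"
      using norm_G_le[OF grh \<delta> _ _ X, of "Complex c t"] c by (simp add: c_def A_def)
    also have "\<dots> \<le> exp 1 * X powr c * A * exp (- t\<^sup>2 / 2)"
      using c A by (intro mult_right_mono) (auto simp: power_le_one)
    finally show "norm (G X (Complex c t)) \<le> exp 1 * X powr c * A * exp (- t\<^sup>2 / 2)" .
  qed
  ultimately show ?thesis by (simp add: A_def c_def)
qed

text \<open>On Re z = 2 the Dirichlet series of L'/L converges absolutely, and the Gaussian is
  integrable, so sum and integral may be exchanged. Each term is then a Mellin integral of the
  weight.\<close>

lemma gauss_perron:
  assumes grh: GRH and X: "X \<ge> 1"
  shows "(\<lambda>n. complex_of_real (sqrt pi * (mangoldt n * chi n * gweight X n))) sums (- (\<integral>t. G X (Complex 2 t) \<partial>lborel))"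
proof -
  define a where "a = (\<lambda>n. mangoldt n * chi n :: real)"
  have a0: "a 0 = 0" by (simp add: a_def)
  define f where "f = (\<lambda>n t. complex_of_real (a n) * exp ((Complex 2 t)\<^sup>2 + Complex 2 t * of_real (ln (X / real n))))"
  have f_eq: "f n t = exp ((Complex 2 t)\<^sup>2 + Complex 2 t * of_real (ln X)) * (of_real (a n) * of_nat n powr (- Complex 2 t))" for n t
  proof (cases "n = 0")
    case False
    have "of_real (ln (X / real n)) = (of_real (ln X) - Ln (of_nat n) :: complex)"
      using False X by (simp add: ln_div Ln_of_nat)
    hence "(Complex 2 t)\<^sup>2 + Complex 2 t * of_real (ln (X / real n))
        = ((Complex 2 t)\<^sup>2 + Complex 2 t * of_real (ln X)) + (- Complex 2 t) * Ln (of_nat n)"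
      by (simp only: right_diff_distrib) simp
    hence "f n t = of_real (a n) * (exp ((Complex 2 t)\<^sup>2 + Complex 2 t * of_real (ln X)) * exp ((- Complex 2 t) * Ln (of_nat n)))"
      unfolding f_def by (simp only: exp_add[of "_ + _"])
    also have "exp ((- Complex 2 t) * Ln (of_nat n)) = of_nat n powr (- Complex 2 t)"
      using False by (simp add: powr_def)
    finally show ?thesis by (simp only: mult_ac)
  qed (simp add: f_def a0)
  define b where "b = (\<lambda>n. \<bar>a n\<bar> * exp (4 + 2 * ln (X / real n)))"
  have norm_f: "norm (f n t) = b n * exp (- t\<^sup>2)" for n t
  proof -
    have "Re ((Complex 2 t)\<^sup>2 + Complex 2 t * of_real (ln (X / real n))) = (4 + 2 * ln (X / real n)) + - t\<^sup>2"
      by (simp add: power2_eq_square)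
    thus ?thesis unfolding f_def norm_mult norm_exp_eq_Re b_def by (simp only: exp_add) (simp add: mult_ac)
  qed
  have norm_summable: "summable (\<lambda>n. norm (of_real (a n) * of_nat n powr (-z) :: complex))" if "Re z = 2" for z
    unfolding a_def
  proof (rule summable_norm_chi)
    show "\<bar>mangoldt n\<bar> \<le> ln (real n) + 1" for n
      using mangoldt_le_ln[of n] by simp
  qed (use that in auto)
  have b_summable: "summable b"
  proof -
    have "b n = (exp 4 * X\<^sup>2) * norm (of_real (a n) * of_nat n powr (-2) :: complex)" for n
    proof (cases "n = 0")
      case False
      have "exp (2 * ln (X / real n)) = (X / real n)\<^sup>2"
        using False X by (simp add: exp_double)
      moreover have "norm (of_nat n powr (-2) :: complex) = 1 / (real n)\<^sup>2"
        using False norm_nat_powr[of n "-2"] by (simp add: powr_minus_divide)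
      ultimately show ?thesis by (simp add: b_def exp_add norm_mult power_divide)
    qed (simp add: b_def a0)
    hence "b = (\<lambda>n. (exp 4 * X\<^sup>2) * norm (of_real (a n) * of_nat n powr (-2) :: complex))" by (rule ext)
    thus ?thesis using summable_mult[OF norm_summable[of 2]] by simp
  qed
  have b_nonneg: "b n \<ge> 0" for n by (simp add: b_def)
  have f_int: "integrable lborel (f n)" for n
  proof (rule integrable_gauss_bound(1))
    show "continuous_on UNIV (f n)"
      unfolding f_def Complex_eq by (intro continuous_intros)
    show "norm (f n t) \<le> b n * exp (- t\<^sup>2 / 2)" for t
      unfolding norm_f using b_nonneg[of n] by (intro mult_left_mono) auto
  qed
  have "(\<lambda>n. integral\<^sup>L lborel (f n)) sums (\<integral>t. (\<Sum>n. f n t) \<partial>lborel)"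
  proof (rule sums_integral[OF f_int])
    show "AE t in lborel. summable (\<lambda>n. norm (f n t))"
      unfolding norm_f using b_summable by (intro AE_I2 summable_mult2)
    show "summable (\<lambda>n. \<integral>t. norm (f n t) \<partial>lborel)"
      unfolding norm_f using b_summable by (simp add: summable_mult2)
  qed
  moreover have "(\<Sum>n. f n t) = - G X (Complex 2 t)" for t
  proof -
    have "(\<lambda>n. of_real (a n) * of_nat n powr (- Complex 2 t)) sums (- deriv L (Complex 2 t) / L (Complex 2 t))"
      unfolding a_def by (rule logderiv_sums[OF grh]) simp
    hence "(\<lambda>n. f n t) sums (exp ((Complex 2 t)\<^sup>2 + Complex 2 t * of_real (ln X)) * (- deriv L (Complex 2 t) / L (Complex 2 t)))"
      unfolding f_eq by (rule sums_mult)
    thus ?thesis by (simp add: sums_iff G_def)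
  qed
  moreover have "integral\<^sup>L lborel (f n) = complex_of_real (sqrt pi * (a n * gweight X n))" for n
  proof (cases "n = 0")
    case False
    have "ln (X / real n) = - ln (real n / X)" using False X by (simp add: ln_div)
    hence "(ln (X / real n))\<^sup>2 = (ln (real n / X))\<^sup>2" by simp
    thus ?thesis unfolding f_def integral_mult_right_zero gauss_mellin gweight_def by (simp add: mult_ac)
  qed (simp add: f_def a0)
  ultimately show ?thesis by (simp add: a_def)
qed

text \<open>Proper prime powers are removed from the von Mangoldt sum; their total weight is already
  below the GRH bound.\<close>

lemma prime_sum_bound:
  assumes grh: GRH and \<delta>: "0 < \<delta>" "\<delta> \<le> 1/2" and X: "X \<ge> 1"
  shows "summable (\<lambda>n. (if prime n then ln (real n) * chi n else 0) * gweight X n)"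
    and "\<bar>\<Sum>n. (if prime n then ln (real n) * chi n else 0) * gweight X n\<bar>
      \<le> (sqrt 2 * exp 1 * (24 / \<delta>\<^sup>2) * (logderiv_const + 1) + 5 * exp 4 * (1 / \<delta>)) * (1 + ln (real q)) * X powr (1/2 + \<delta>)"
proof -
  let ?a = "\<lambda>n. mangoldt n * chi n * gweight X n"
  let ?b = "\<lambda>n. (if prime n then 0 else mangoldt n) * gweight X n"
  have sa: "summable ?a"
  proof (rule summable_comparison_test'[OF summable_mangoldt_gweight(1)[OF X]])
    show "norm (?a n) \<le> mangoldt n * gweight X n" for n
      using abs_le_1[of n] gweight_pos[of X n] mangoldt_nonneg[of n]
        mult_left_mono[of "\<bar>chi n\<bar>" 1 "mangoldt n * gweight X n"]
      by (simp add: abs_mult mult_ac)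
  qed
  note sb = nonprime_gweight[OF X \<delta>]
  have nb: "norm (?b n * chi n) \<le> ?b n" for n
  proof -
    have "?b n \<ge> 0" using gweight_pos[of X n] mangoldt_nonneg[of n] by simp
    hence "?b n * \<bar>chi n\<bar> \<le> ?b n * 1" and "\<bar>?b n\<bar> = ?b n"
      by (rule mult_left_mono[OF abs_le_1], rule abs_of_nonneg)
    thus ?thesis by (simp only: real_norm_def abs_mult[of "_ * _"] mult_1_right)
  qed
  have sbc: "summable (\<lambda>n. ?b n * chi n)"
    by (rule summable_comparison_test'[OF sb(1) nb])
  have eq: "(if prime n then ln (real n) * chi n else 0) * gweight X n = ?a n - ?b n * chi n" for n
    by simp
  show "summable (\<lambda>n. (if prime n then ln (real n) * chi n else 0) * gweight X n)"
    unfolding eq by (intro summable_diff sa sbc)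
  define c where "c = 1/2 + \<delta>"
  have lq: "ln (real q) \<ge> 0" using q_gt_1 by simp
  have "(\<lambda>n. complex_of_real (sqrt pi * ?a n)) sums complex_of_real (sqrt pi * suminf ?a)"
    using sa by (intro sums_of_real sums_mult summable_sums)
  hence "complex_of_real (sqrt pi * suminf ?a) = - (\<integral>t. G X (Complex 2 t) \<partial>lborel)"
    using gauss_perron[OF grh X] sums_unique2 by blast
  hence "norm (complex_of_real (sqrt pi * suminf ?a)) = norm (\<integral>t. G X (Complex 2 t) \<partial>lborel)"
    by simp
  hence "sqrt pi * \<bar>suminf ?a\<bar> = norm (\<integral>t. G X (Complex 2 t) \<partial>lborel)"
    by (simp only: norm_of_real abs_mult) simp
  also have "\<dots> \<le> exp 1 * X powr c * (24 / \<delta>\<^sup>2 * (logderiv_const + ln (real q) + 1)) * sqrt (2 * pi)"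
    unfolding c_def by (rule G_integral_bound[OF grh \<delta> X])
  also have "\<dots> = sqrt pi * (sqrt 2 * exp 1 * (24 / \<delta>\<^sup>2) * (logderiv_const + ln (real q) + 1) * X powr c)"
    by (simp add: real_sqrt_mult mult_ac)
  finally have "\<bar>suminf ?a\<bar> \<le> sqrt 2 * exp 1 * (24 / \<delta>\<^sup>2) * (logderiv_const + ln (real q) + 1) * X powr c"
    by (rule mult_left_le_imp_le) simp
  also have "\<dots> \<le> sqrt 2 * exp 1 * (24 / \<delta>\<^sup>2) * ((logderiv_const + 1) * (1 + ln (real q))) * X powr c"
  proof (intro mult_right_mono mult_left_mono)
    \<comment> \<open>Factoring out 1 + ln q leaves a constant that depends on \<delta>
      alone.\<close>
    show "logderiv_const + ln (real q) + 1 \<le> (logderiv_const + 1) * (1 + ln (real q))"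
      using lq logderiv_const_ge by (simp add: algebra_simps)
  qed auto
  finally have A: "\<bar>suminf ?a\<bar> \<le> (sqrt 2 * exp 1 * (24 / \<delta>\<^sup>2) * (logderiv_const + 1)) * ((1 + ln (real q)) * X powr c)"
    by (simp add: mult_ac)
  have "\<bar>\<Sum>n. ?b n * chi n\<bar> \<le> suminf ?b"
    using norm_suminf_le[OF nb sb(1)] by simp
  also have "\<dots> \<le> (5 * exp 4 * (1 / \<delta>)) * (1 * X powr c)" using sb(2) by (simp add: c_def)
  also have "\<dots> \<le> (5 * exp 4 * (1 / \<delta>)) * ((1 + ln (real q)) * X powr c)"
    using lq \<delta> by (intro mult_left_mono mult_right_mono) auto
  finally have B: "\<bar>\<Sum>n. ?b n * chi n\<bar> \<le> (5 * exp 4 * (1 / \<delta>)) * ((1 + ln (real q)) * X powr c)" .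
  have "(\<Sum>n. (if prime n then ln (real n) * chi n else 0) * gweight X n) = suminf ?a - (\<Sum>n. ?b n * chi n)"
    unfolding eq by (rule suminf_diff[OF sa sbc, symmetric])
  hence "\<bar>\<Sum>n. (if prime n then ln (real n) * chi n else 0) * gweight X n\<bar> \<le> \<bar>suminf ?a\<bar> + \<bar>\<Sum>n. ?b n * chi n\<bar>"
    by (simp only: abs_triangle_ineq4)
  also have "\<dots> \<le> (sqrt 2 * exp 1 * (24 / \<delta>\<^sup>2) * (logderiv_const + 1)) * ((1 + ln (real q)) * X powr c)
      + (5 * exp 4 * (1 / \<delta>)) * ((1 + ln (real q)) * X powr c)"
    by (rule add_mono[OF A B])
  finally show "\<bar>\<Sum>n. (if prime n then ln (real n) * chi n else 0) * gweight X n\<bar>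
      \<le> (sqrt 2 * exp 1 * (24 / \<delta>\<^sup>2) * (logderiv_const + 1) + 5 * exp 4 * (1 / \<delta>)) * (1 + ln (real q)) * X powr (1/2 + \<delta>)"
    by (simp only: distrib_right mult.assoc c_def)
qed

end

section \<open>The moment bound\<close>

lemma real_char_quad_char:
  assumes "N > 0" "\<not> (\<exists>m. N = m ^ 2)"
  shows "real_char (8 * N) (\<lambda>n. of_int (quad_char N n))"
proof
  show "dirichlet_character (8 * N) (\<lambda>n. complex_of_real (of_int (quad_char N n)))"
    by (rule dirichlet_character_quad_char[OF assms(1)])
  show "real_of_int (quad_char N n) \<in> {-1, 0, 1}" for n
    using quad_char_values[of N n] by auto
  obtain n where "quad_char N n = -1" using quad_char_nonprincipal[OF assms] by blast
  thus "\<exists>n. real_of_int (quad_char N n) = -1" by (intro exI[of _ n]) simp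
qed

text \<open>The prime 2 is left out, as the multiplicativity and reciprocity used here are stated
  for odd primes; for Q \<ge> 3 it lies outside [Q, 2Q].\<close>

definition pweight :: "real \<Rightarrow> nat \<Rightarrow> real" where
  "pweight X n = (if prime n \<and> n > 2 then ln (real n) * gweight X n else 0)"

lemma pweight_nonneg: "pweight X n \<ge> 0"
  using gweight_pos[of X n] ln_nat_nonneg[of n] by (simp add: pweight_def)

lemma pweight_le: "pweight X n \<le> mangoldt n * gweight X n"
  using gweight_pos[of X n] mangoldt_nonneg[of n] by (simp add: pweight_def)

lemma pweight_summable: "X \<ge> 1 \<Longrightarrow> summable (pweight X)"
proof (rule summable_comparison_test'[of "\<lambda>n. mangoldt n * gweight X n" 0])
  show "norm (pweight X n) \<le> mangoldt n * gweight X n" for n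
    using pweight_nonneg[of X n] pweight_le[of X n] by simp
qed (rule summable_mangoldt_gweight(1))

lemma pweight_bounded_summable:
  fixes f :: "nat \<Rightarrow> 'a :: {banach, real_normed_algebra_1}"
  assumes "X \<ge> 1" "\<And>n. norm (f n) \<le> K"
  shows "summable (\<lambda>n. pweight X n *\<^sub>R f n)"
proof (rule summable_comparison_test'[of "\<lambda>n. pweight X n * K" 0])
  show "summable (\<lambda>n. pweight X n * K)" by (intro summable_mult2 pweight_summable assms)
  show "norm (pweight X n *\<^sub>R f n) \<le> pweight X n * K" for n
    using assms(2)[of n] pweight_nonneg[of X n] by (simp add: mult_left_mono)
qed

lemma abs_Legendre_le: "\<bar>real_of_int (Legendre a p)\<bar> \<le> 1"
  using Legendre_values[of a p] by auto

lemma pweight_Legendre_le: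
  assumes "X \<ge> 1"
  shows "\<bar>\<Sum>n. pweight X n * of_int (Legendre (int N) (int n))\<bar> \<le> 20 * exp 4 * X"
proof -
  have "\<bar>\<Sum>n. pweight X n * of_int (Legendre (int N) (int n))\<bar> \<le> (\<Sum>n. mangoldt n * gweight X n)"
  proof (rule norm_suminf_le[where 'a = real, unfolded real_norm_def])
    fix n
    have "\<bar>pweight X n * of_int (Legendre (int N) (int n))\<bar> \<le> pweight X n * 1"
      using abs_Legendre_le[of "int N" "int n"] pweight_nonneg[of X n]
      by (simp only: abs_mult abs_of_nonneg) (intro mult_left_mono, auto)
    thus "\<bar>pweight X n * of_int (Legendre (int N) (int n))\<bar> \<le> mangoldt n * gweight X n"
      using pweight_le[of X n] by simp
  qed (rule summable_mangoldt_gweight(1)[OF assms])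
  also have "\<dots> \<le> 20 * exp 4 * X" by (rule summable_mangoldt_gweight(2)[OF assms])
  finally show ?thesis .
qed

definition charsum_const :: "real \<Rightarrow> real" where
  "charsum_const \<delta> = sqrt 2 * exp 1 * (24 / \<delta>\<^sup>2) * (logderiv_const + 1) + 5 * exp 4 * (1 / \<delta>)"

lemma pweight_Legendre_nonsquare:
  assumes grh: GRH and \<delta>: "0 < \<delta>" "\<delta> \<le> 1/2" and X: "X \<ge> 1" and N: "N > 0" "\<not> (\<exists>m. N = m ^ 2)"
  shows "\<bar>\<Sum>n. pweight X n * of_int (Legendre (int N) (int n))\<bar>
    \<le> charsum_const \<delta> * (1 + ln (8 * real N)) * X powr (1/2 + \<delta>)"
proof -
  interpret real_char "8 * N" "\<lambda>n. of_int (quad_char N n)"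
    by (rule real_char_quad_char[OF N])
  have "pweight X n * of_int (Legendre (int N) (int n))
      = (if prime n then ln (real n) * of_int (quad_char N n) else 0) * gweight X n" for n
  proof (cases "prime n")
    case True
    show ?thesis
    proof (cases "n = 2")
      case True
      \<comment> \<open>At 2 both sides vanish, one by the choice of the weight and the other
        because the modulus is even.\<close>
      have "quad_char N 2 = 0" unfolding quad_char_def by simp
      thus ?thesis using True by (simp add: pweight_def)
    next
      case False
      hence "n > 2" using prime_ge_2_nat[OF True] by simp
      thus ?thesis using True quad_char_eq_Legendre[OF N(1) True] by (simp add: pweight_def mult_ac)
    qed
  qed (simp add: pweight_def)
  thus ?thesis using prime_sum_bound(2)[OF grh \<delta> X] by (simp add: charsum_const_def)
qed

text \<open>On [Q, 2Q] the logarithm of p/Q lies between 0 and 1, so the Gaussian is at least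
  exp(-1/4) \<ge> 3/4.\<close>

lemma pweight_ge:
  assumes Q: "Q \<ge> 3" and p: "prime p" "Q \<le> real p" "real p \<le> 2 * Q"
  shows "ln Q / 2 \<le> pweight Q p"
proof -
  have "real p \<ge> 3" using Q p by simp
  hence "p > 2" by simp
  have r: "1 \<le> real p / Q" "real p / Q \<le> 2" using Q p by (auto simp: field_simps)
  hence "0 \<le> ln (real p / Q)" "ln (real p / Q) \<le> ln 2"
    by (auto intro: ln_ge_zero)
  hence "0 \<le> ln (real p / Q)" "ln (real p / Q) \<le> 1" using ln_2_less_1 by linarith+
  hence "(ln (real p / Q))\<^sup>2 \<le> 1" by (simp add: power_le_one)
  hence "- (1/4) \<le> - (ln (real p / Q))\<^sup>2 / 4" by simp
  hence "exp (- (1/4)) \<le> gweight Q p" unfolding gweight_def by (simp only: exp_le_cancel_iff)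
  moreover have "1 + - (1/4) \<le> exp (- (1/4) :: real)" by (rule exp_ge_add_one_self)
  ultimately have "1/2 \<le> gweight Q p" by linarith
  moreover have "ln Q \<le> ln (real p)" "0 \<le> ln Q" using Q p by auto
  ultimately have "ln Q * (1/2) \<le> ln (real p) * gweight Q p" by (intro mult_mono) auto
  thus ?thesis using p(1) \<open>p > 2\<close> by (simp add: pweight_def)
qed

lemma norm_S_le:
  assumes "\<forall>n\<in>{u<..u+h}. norm (\<alpha> n) \<le> 1"
  shows "norm (S \<alpha> u h p) \<le> real h"
proof -
  have "norm (S \<alpha> u h p) \<le> (\<Sum>n\<in>{u<..u+h}. norm (\<alpha> n * of_int (Legendre (int n) (int p))))"
    unfolding S_def by (rule norm_sum)
  also have "\<dots> \<le> (\<Sum>n\<in>{u<..u+h}. 1)"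
  proof (rule sum_mono)
    fix n assume n: "n \<in> {u<..u+h}"
    have "norm (\<alpha> n) * \<bar>of_int (Legendre (int n) (int p))\<bar> \<le> 1 * 1"
      using assms n abs_Legendre_le by (intro mult_mono) auto
    thus "norm (\<alpha> n * of_int (Legendre (int n) (int p))) \<le> 1" by (simp add: norm_mult)
  qed
  finally show ?thesis by simp
qed

text \<open>The even moment is S^s times the s-th power of its conjugate, so the last s coordinates
  carry conjugated coefficients. The symbols are real, and all 2s of them merge into the symbol of
  the product.\<close>

lemma norm_S_power_expand:
  fixes s :: nat and \<alpha> :: "nat \<Rightarrow> complex"
  assumes p: "prime p" "p > 2"
  defines "\<beta> \<equiv> (\<lambda>f. \<Prod>i<2 * s. if i < s then \<alpha> (f i) else cnj (\<alpha> (f i)))"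
  shows "of_real (norm (S \<alpha> u h p) ^ (2 * s)) =
    (\<Sum>f\<in>{..<2 * s} \<rightarrow>\<^sub>E {u<..u+h}. \<beta> f * of_int (Legendre (int (\<Prod>i<2 * s. f i)) (int p)))"
proof -
  let ?S = "S \<alpha> u h p"
  let ?g = "\<lambda>i n. (if i < s then \<alpha> n else cnj (\<alpha> n)) * of_int (Legendre (int n) (int p)) :: complex"
  have "of_real (norm ?S ^ (2 * s)) = (of_real ((norm ?S)\<^sup>2)) ^ s"
    by (simp add: power_mult)
  also have "\<dots> = ?S ^ s * cnj ?S ^ s"
    by (simp only: complex_norm_square power_mult_distrib)
  also have "\<dots> = (\<Prod>i<2 * s. if i < s then ?S else cnj ?S)"
  proof -
    have "{..<2 * s} \<inter> {i. i < s} = {..<s}" "{..<2 * s} \<inter> - {i. i < s} = {s..<2 * s}" by auto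
    thus ?thesis by (simp add: prod.If_cases)
  qed
  also have "\<dots> = (\<Prod>i<2 * s. \<Sum>n\<in>{u<..u+h}. ?g i n)"
    by (intro prod.cong refl) (simp add: S_def)
  also have "\<dots> = (\<Sum>f\<in>{..<2 * s} \<rightarrow>\<^sub>E {u<..u+h}. \<Prod>i<2 * s. ?g i (f i))"
    by (rule prod_sum_PiE) auto
  also have "\<dots> = (\<Sum>f\<in>{..<2 * s} \<rightarrow>\<^sub>E {u<..u+h}. \<beta> f * of_int (Legendre (int (\<Prod>i<2 * s. f i)) (int p)))"
    unfolding \<beta>_def of_nat_prod Legendre_prod[OF p] of_int_prod prod.distrib [symmetric] ..
  finally show ?thesis .
qed

text \<open>After the sum over tuples is moved outside, the coefficients enter only through products
  of modulus at most 1. This is where uniformity in \<alpha> comes from.\<close>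

lemma M_le_tuples:
  assumes Q: "Q \<ge> 3" and \<alpha>: "\<forall>n\<in>{u<..u+h}. norm (\<alpha> n) \<le> 1"
  shows "ln Q / 2 * M (2 * s) Q \<alpha> u h \<le>
    (\<Sum>f\<in>{..<2 * s} \<rightarrow>\<^sub>E {u<..u+h}. \<bar>\<Sum>n. pweight Q n * of_int (Legendre (int (\<Prod>i<2 * s. f i)) (int n))\<bar>)"
proof -
  let ?T = "{..<2 * s} \<rightarrow>\<^sub>E {u<..u+h}"
  let ?A = "{p::nat. prime p \<and> Q \<le> real p \<and> real p \<le> 2 * Q}"
  let ?L = "\<lambda>f n. real_of_int (Legendre (int (\<Prod>i<2 * s. f i)) (int n))"
  define \<beta> where "\<beta> = (\<lambda>f. \<Prod>i<2 * s. if i < s then \<alpha> (f i) else cnj (\<alpha> (f i)))"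
  have X: "Q \<ge> 1" using Q by simp
  have finT: "finite ?T" by (intro finite_PiE) auto
  have finA: "finite ?A" by (rule finite_subset[of _ "{..nat \<lfloor>2 * Q\<rfloor>}"]) (auto simp: le_nat_floor)
  have \<beta>: "norm (\<beta> f) \<le> 1" if f: "f \<in> ?T" for f
  proof -
    have "norm (\<beta> f) = (\<Prod>i<2 * s. norm (\<alpha> (f i)))"
      unfolding \<beta>_def prod_norm [symmetric] by (intro prod.cong) auto
    also have "\<dots> \<le> 1" using f \<alpha> by (intro prod_le_1) (auto simp: PiE_iff)
    finally show ?thesis .
  qed
  have sumS: "summable (\<lambda>n. pweight Q n * norm (S \<alpha> u h n) ^ (2 * s))"
    using pweight_bounded_summable[OF X, of "\<lambda>n. norm (S \<alpha> u h n) ^ (2 * s)" "real h ^ (2 * s)"] norm_S_le[OF \<alpha>]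
    by (simp add: power_mono)
  have sumL: "summable (\<lambda>n. pweight Q n * ?L f n)" for f
    using pweight_bounded_summable[OF X, of "?L f" 1] abs_Legendre_le by simp
  have "ln Q / 2 * M (2 * s) Q \<alpha> u h = (\<Sum>p\<in>?A. ln Q / 2 * norm (S \<alpha> u h p) ^ (2 * s))"
    by (simp add: M_def sum_distrib_left)
  also have "\<dots> \<le> (\<Sum>p\<in>?A. pweight Q p * norm (S \<alpha> u h p) ^ (2 * s))"
    using pweight_ge[OF Q] by (intro sum_mono mult_right_mono) auto
  also have "\<dots> \<le> (\<Sum>n. pweight Q n * norm (S \<alpha> u h n) ^ (2 * s))"
    using pweight_nonneg by (intro sum_le_suminf sumS finA) auto
  \<comment> \<open>A nonnegative real is its own norm; written this way, the complex expansion can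
    be inserted.\<close>
  also have "\<dots> = norm (\<Sum>n. complex_of_real (pweight Q n * norm (S \<alpha> u h n) ^ (2 * s)))"
  proof -
    have "(\<Sum>n. complex_of_real (pweight Q n * norm (S \<alpha> u h n) ^ (2 * s)))
        = of_real (\<Sum>n. pweight Q n * norm (S \<alpha> u h n) ^ (2 * s))"
      using suminf_of_real[OF sumS] by (rule sym)
    moreover have "(\<Sum>n. pweight Q n * norm (S \<alpha> u h n) ^ (2 * s)) \<ge> 0"
      using pweight_nonneg by (intro suminf_nonneg sumS) auto
    ultimately show ?thesis by (simp only: norm_of_real abs_of_nonneg)
  qed
  also have "(\<lambda>n. complex_of_real (pweight Q n * norm (S \<alpha> u h n) ^ (2 * s)))
      = (\<lambda>n. \<Sum>f\<in>?T. \<beta> f * of_real (pweight Q n * ?L f n))"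
  proof
    fix n
    show "complex_of_real (pweight Q n * norm (S \<alpha> u h n) ^ (2 * s)) = (\<Sum>f\<in>?T. \<beta> f * of_real (pweight Q n * ?L f n))"
    proof (cases "prime n \<and> n > 2")
      case True
      hence "complex_of_real (norm (S \<alpha> u h n) ^ (2 * s)) = (\<Sum>f\<in>?T. \<beta> f * of_real (?L f n))"
        unfolding \<beta>_def of_real_of_int_eq using norm_S_power_expand[of n \<alpha> u h s] by blast
      hence "complex_of_real (pweight Q n * norm (S \<alpha> u h n) ^ (2 * s)) = of_real (pweight Q n) * (\<Sum>f\<in>?T. \<beta> f * of_real (?L f n))"
        by (simp only: of_real_mult)
      thus ?thesis by (simp only: sum_distrib_left of_real_mult mult_ac)
    next
      case False
      hence "pweight Q n = 0" by (auto simp: pweight_def)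
      thus ?thesis by simp
    qed
  qed
  also have "(\<Sum>n. \<Sum>f\<in>?T. \<beta> f * of_real (pweight Q n * ?L f n)) = (\<Sum>f\<in>?T. \<Sum>n. \<beta> f * of_real (pweight Q n * ?L f n))"
    by (intro suminf_sum summable_mult summable_of_real sumL)
  also have "\<dots> = (\<Sum>f\<in>?T. \<beta> f * of_real (\<Sum>n. pweight Q n * ?L f n))"
    by (intro sum.cong refl, subst suminf_mult, intro summable_of_real sumL, subst suminf_of_real[OF sumL, symmetric], rule refl)
  also have "norm \<dots> \<le> (\<Sum>f\<in>?T. norm (\<beta> f * of_real (\<Sum>n. pweight Q n * ?L f n)))"
    by (rule norm_sum)
  also have "\<dots> \<le> (\<Sum>f\<in>?T. \<bar>\<Sum>n. pweight Q n * ?L f n\<bar>)"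
  proof (rule sum_mono)
    fix f assume "f \<in> ?T"
    hence "norm (\<beta> f) * \<bar>\<Sum>n. pweight Q n * ?L f n\<bar> \<le> 1 * \<bar>\<Sum>n. pweight Q n * ?L f n\<bar>"
      by (intro mult_right_mono \<beta>) auto
    thus "norm (\<beta> f * of_real (\<Sum>n. pweight Q n * ?L f n)) \<le> \<bar>\<Sum>n. pweight Q n * ?L f n\<bar>"
      by (simp only: norm_mult norm_of_real mult_1_left)
  qed
  finally show ?thesis .
qed

lemma charsum_const_nonneg: "\<delta> > 0 \<Longrightarrow> charsum_const \<delta> \<ge> 0"
  unfolding charsum_const_def using logderiv_const_ge
  by (intro add_nonneg_nonneg mult_nonneg_nonneg) auto

text \<open>Tuples with square product are counted by \<open>R_sq\<close> and get the trivial bound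
  of order Q; the others, at most h^(2s), get the GRH bound with a logarithm of the modulus of order
  ln Q. Dividing by (ln Q)/2 gives Q / ln Q in the first case and cancels the logarithm in the
  second.\<close>

lemma M_bound:
  assumes grh: GRH and \<delta>: "0 < \<delta>" "\<delta> \<le> 1/2" and Q: "Q \<ge> 8" and hu: "h < u" "real u \<le> Q"
    and \<alpha>: "\<forall>n\<in>{u<..u+h}. norm (\<alpha> n) \<le> 1"
  shows "M (2 * s) Q \<alpha> u h \<le> 40 * exp 4 * real (R_sq (2 * s) h u) * (Q / ln Q)
    + 2 * charsum_const \<delta> * (2 + 4 * real s) * real h ^ (2 * s) * Q powr (1/2 + \<delta>)"
proof -
  let ?T = "{..<2 * s} \<rightarrow>\<^sub>E {u<..u+h}"
  let ?N = "\<lambda>f::nat \<Rightarrow> nat. \<Prod>i<2 * s. f i"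
  let ?v = "\<lambda>f. \<bar>\<Sum>n. pweight Q n * of_int (Legendre (int (?N f)) (int n))\<bar>"
  define sq where "sq = {f \<in> ?T. \<exists>m. ?N f = m ^ 2}"
  have X: "Q \<ge> 1" "Q \<ge> 3" using Q by auto
  have finT: "finite ?T" by (intro finite_PiE) auto
  have cardT: "card ?T = h ^ (2 * s)" by (simp add: card_PiE)
  have e: "exp 1 \<le> (3::real)" using e_less_272 by linarith
  have lnQ: "ln Q \<ge> 1" using Q e by (subst ln_ge_iff) auto
  \<comment> \<open>Every factor is at most u + h \<le> 2u \<le> 2Q, so N \<le> (2Q)^(2s). With
    ln(2Q) \<le> 2 ln Q, and with Q \<ge> 8 to absorb 1 + ln 8, this gives 1 + ln(8N) \<le> (2 + 4s)
    ln Q.\<close>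
  define W where "W = charsum_const \<delta> * ((2 + 4 * real s) * ln Q) * Q powr (1/2 + \<delta>)"
  have W: "W \<ge> 0" using charsum_const_nonneg[OF \<delta>(1)] lnQ by (simp add: W_def)
  have nonsq: "?v f \<le> W" if f: "f \<in> ?T - sq" for f
  proof -
    have fi: "0 < f i" "real (f i) \<le> 2 * Q" if "i < 2 * s" for i
    proof -
      have "f i \<in> {u<..u+h}" using f that by (auto simp: PiE_iff)
      thus "0 < f i" by simp
      have "f i \<le> 2 * u" using \<open>f i \<in> {u<..u+h}\<close> hu by simp
      hence "real (f i) \<le> 2 * real u" by linarith
      thus "real (f i) \<le> 2 * Q" using hu by linarith
    qed
    have N0: "?N f > 0" using fi(1) by (intro prod_pos) auto
    have "real (?N f) = (\<Prod>i<2 * s. real (f i))" by simp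
    also have "\<dots> \<le> (\<Prod>i<2 * s. 2 * Q)" using fi(2) by (intro prod_mono) auto
    also have "\<dots> = (2 * Q) ^ (2 * s)" by simp
    finally have "real (?N f) \<le> (2 * Q) ^ (2 * s)" .
    moreover have "0 < real (?N f)" using N0 by (simp only: of_nat_0_less_iff)
    ultimately have "ln (real (?N f)) \<le> ln ((2 * Q) ^ (2 * s))" by (intro ln_mono)
    also have "\<dots> = 2 * real s * ln (2 * Q)" using Q by (subst ln_realpow) auto
    also have "ln (2 * Q) \<le> 2 * ln Q"
    proof -
      have "ln (2 * Q) = ln 2 + ln Q" using Q by (simp add: ln_mult)
      thus ?thesis using ln_2_less_1 lnQ by linarith
    qed
    finally have "ln (real (?N f)) \<le> 4 * real s * ln Q" by (simp add: mult_left_mono)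
    moreover have "ln (8 * real (?N f)) = ln 8 + ln (real (?N f))"
      using N0 by (intro ln_mult_pos) (simp_all only: of_nat_0_less_iff zero_less_numeral)
    moreover have "ln 8 \<le> ln Q" using Q by simp
    ultimately have lnN: "1 + ln (8 * real (?N f)) \<le> (2 + 4 * real s) * ln Q"
      using lnQ by (simp add: algebra_simps)
    have "\<not> (\<exists>m. ?N f = m ^ 2)" using f by (auto simp: sq_def)
    hence "?v f \<le> charsum_const \<delta> * (1 + ln (8 * real (?N f))) * Q powr (1/2 + \<delta>)"
      by (intro pweight_Legendre_nonsquare[OF grh \<delta> X(1) N0])
    also have "\<dots> \<le> W"
      unfolding W_def using lnN charsum_const_nonneg[OF \<delta>(1)] by (intro mult_right_mono mult_left_mono) auto
    finally show ?thesis .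
  qed
  have "ln Q / 2 * M (2 * s) Q \<alpha> u h \<le> (\<Sum>f\<in>?T. ?v f)" by (rule M_le_tuples[OF X(2) \<alpha>])
  also have "\<dots> = (\<Sum>f\<in>sq. ?v f) + (\<Sum>f\<in>?T - sq. ?v f)"
    using finT by (intro sum.subset_diff[THEN trans[OF _ add.commute]]) (auto simp: sq_def)
  also have "\<dots> \<le> (\<Sum>f\<in>sq. 20 * exp 4 * Q) + (\<Sum>f\<in>?T - sq. W)"
    by (intro add_mono sum_mono pweight_Legendre_le X nonsq)
  also have "\<dots> \<le> real (card sq) * (20 * exp 4 * Q) + real (h ^ (2 * s)) * W"
  proof -
    have "card (?T - sq) \<le> card ?T" by (intro card_mono finT) auto
    hence "real (card (?T - sq)) * W \<le> real (h ^ (2 * s)) * W"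
      unfolding cardT by (intro mult_right_mono W) (simp only: of_nat_le_iff)
    thus ?thesis by simp
  qed
  also have "card sq = R_sq (2 * s) h u" by (simp add: sq_def R_sq_def)
  finally have "ln Q / 2 * M (2 * s) Q \<alpha> u h \<le> real (R_sq (2 * s) h u) * (20 * exp 4 * Q) + real h ^ (2 * s) * W"
    by simp
  hence "(2 / ln Q) * (ln Q / 2 * M (2 * s) Q \<alpha> u h) \<le>
      (2 / ln Q) * (real (R_sq (2 * s) h u) * (20 * exp 4 * Q) + real h ^ (2 * s) * W)"
    using lnQ by (intro mult_left_mono) auto
  also have "(2 / ln Q) * (ln Q / 2 * M (2 * s) Q \<alpha> u h) = M (2 * s) Q \<alpha> u h" using lnQ by simp
  also have "(2 / ln Q) * (real (R_sq (2 * s) h u) * (20 * exp 4 * Q) + real h ^ (2 * s) * W)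
      = 40 * exp 4 * real (R_sq (2 * s) h u) * (Q / ln Q)
        + 2 * charsum_const \<delta> * (2 + 4 * real s) * real h ^ (2 * s) * Q powr (1/2 + \<delta>)"
    using lnQ by (simp add: W_def field_simps)
  finally show ?thesis .
qed

lemma powr_absorb:
  assumes "e > (0::real)"
  shows "\<exists>N>0. \<forall>x\<ge>N. C \<le> x powr e"
proof -
  have "filterlim (\<lambda>x::real. x powr e) at_top at_top" using assms by real_asymp
  hence "eventually (\<lambda>x. C \<le> x powr e) at_top" by (simp add: filterlim_at_top)
  then obtain N where "\<forall>x\<ge>N. C \<le> x powr e" by (auto simp: eventually_at_top_linorder)
  thus ?thesis by (intro exI[of _ "max 1 N"]) auto
qed

theorem theorem1p3:
  fixes s :: nat
  assumes grh: "GRH"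
    and s1: "s \<ge> 1"
    and hyp: "\<forall>\<epsilon>>0. \<exists>H. \<forall>(h::nat) (u::nat). H \<le> h \<longrightarrow> 2 \<le> h \<longrightarrow> h < u \<longrightarrow>
                real (R_sq (2 * s) h u) \<le> real h powr (real s + \<epsilon>)"
  shows "\<forall>\<epsilon>>0. \<exists>N. \<forall>(Q::real) (h::nat) (u::nat) (\<alpha>::nat \<Rightarrow> complex).
           N \<le> real h \<longrightarrow> N \<le> Q \<longrightarrow> 2 \<le> h \<longrightarrow> h < u \<longrightarrow> real u \<le> Q \<longrightarrow>
           (\<forall>n\<in>{u<..u+h}. norm (\<alpha> n) \<le> 1) \<longrightarrow>
           M (2 * s) Q \<alpha> u h \<le> real h powr (real s + \<epsilon>) * real (prime_pi Q)
                               + real h ^ (2 * s) * Q powr (1/2 + \<epsilon>)"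
proof (intro allI impI)
  fix \<epsilon> :: real assume \<epsilon>: "\<epsilon> > 0"
  \<comment> \<open>Half of \<epsilon> is spent on the distance to the critical line; the other half
    absorbs the constants.\<close>
  define \<delta> where "\<delta> = min (\<epsilon> / 2) (1/2)"
  have \<delta>: "0 < \<delta>" "\<delta> \<le> 1/2" "\<delta> \<le> \<epsilon> / 2" using \<epsilon> by (auto simp: \<delta>_def)
  \<comment> \<open>Here 320 = 40 * 8, the 8 being the Chebyshev constant that converts Q / ln Q
    into \<pi>(Q). This constant is absorbed by a power of \<open>h\<close>, whereas
    \<open>C2\<close> is absorbed by a power of \<open>Q\<close>.\<close>
  define C1 where "C1 = 320 * exp (4::real)"
  define C2 where "C2 = 2 * charsum_const \<delta> * (2 + 4 * real s)"
  have e2: "\<epsilon> / 2 > 0" using \<epsilon> by simp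
  obtain H where H: "\<And>h u. H \<le> h \<Longrightarrow> 2 \<le> h \<Longrightarrow> h < u \<Longrightarrow> real (R_sq (2 * s) h u) \<le> real h powr (real s + \<epsilon> / 2)"
    using hyp e2 by blast
  obtain N1 where N1: "\<And>x. x \<ge> N1 \<Longrightarrow> C1 \<le> x powr (\<epsilon> / 2)" using powr_absorb[OF e2] by blast
  obtain N2 where N2: "\<And>x. x \<ge> N2 \<Longrightarrow> C2 \<le> x powr (\<epsilon> / 2)" using powr_absorb[OF e2] by blast
  obtain N3 where N3: "\<And>Q. Q \<ge> N3 \<Longrightarrow> Q / 8 \<le> real (prime_pi Q) * ln Q"
    using prime_pi_lower_bound by (auto simp: eventually_at_top_linorder)
  show "\<exists>N. \<forall>(Q::real) (h::nat) (u::nat) (\<alpha>::nat \<Rightarrow> complex).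
           N \<le> real h \<longrightarrow> N \<le> Q \<longrightarrow> 2 \<le> h \<longrightarrow> h < u \<longrightarrow> real u \<le> Q \<longrightarrow>
           (\<forall>n\<in>{u<..u+h}. norm (\<alpha> n) \<le> 1) \<longrightarrow>
           M (2 * s) Q \<alpha> u h \<le> real h powr (real s + \<epsilon>) * real (prime_pi Q)
                               + real h ^ (2 * s) * Q powr (1/2 + \<epsilon>)"
  proof (intro exI allI impI)
    fix Q :: real and h u :: nat and \<alpha> :: "nat \<Rightarrow> complex"
    assume hN: "Max {real H, N1, N2, N3, 8} \<le> real h" and QN: "Max {real H, N1, N2, N3, 8} \<le> Q"
      and h2: "2 \<le> h" and hu: "h < u" and uQ: "real u \<le> Q" and \<alpha>: "\<forall>n\<in>{u<..u+h}. norm (\<alpha> n) \<le> 1"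
    have h: "H \<le> h" "N1 \<le> real h" using hN by auto
    have Q: "N2 \<le> Q" "N3 \<le> Q" "8 \<le> Q" using QN by auto
    have lnQ: "ln Q > 0" using Q by simp
    have "40 * exp 4 * real (R_sq (2 * s) h u) * (Q / ln Q)
        \<le> 40 * exp 4 * real h powr (real s + \<epsilon> / 2) * (8 * real (prime_pi Q))"
    proof (intro mult_mono)
      show "real (R_sq (2 * s) h u) \<le> real h powr (real s + \<epsilon> / 2)" by (rule H[OF h(1) h2 hu])
      show "Q / ln Q \<le> 8 * real (prime_pi Q)" using N3[OF Q(2)] lnQ by (simp add: field_simps)
    qed (use lnQ Q in auto)
    also have "\<dots> = C1 * (real h powr (real s + \<epsilon> / 2) * real (prime_pi Q))" by (simp add: C1_def)
    also have "\<dots> \<le> real h powr (\<epsilon> / 2) * (real h powr (real s + \<epsilon> / 2) * real (prime_pi Q))"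
      using N1[OF h(2)] by (intro mult_right_mono) auto
    also have "\<dots> = real h powr (real s + \<epsilon>) * real (prime_pi Q)"
      by (simp add: powr_add [symmetric] mult.assoc [symmetric] add_ac)
    finally have 1: "40 * exp 4 * real (R_sq (2 * s) h u) * (Q / ln Q) \<le> real h powr (real s + \<epsilon>) * real (prime_pi Q)" .
    have "C2 * real h ^ (2 * s) * Q powr (1/2 + \<delta>) \<le> Q powr (\<epsilon> / 2) * real h ^ (2 * s) * Q powr (1/2 + \<epsilon> / 2)"
      using N2[OF Q(1)] \<delta> Q charsum_const_nonneg[OF \<delta>(1)] by (intro mult_mono powr_mono) auto
    also have "\<dots> = real h ^ (2 * s) * (Q powr (\<epsilon> / 2) * Q powr (1/2 + \<epsilon> / 2))"
      by (simp only: mult_ac)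
    also have "Q powr (\<epsilon> / 2) * Q powr (1/2 + \<epsilon> / 2) = Q powr (1/2 + \<epsilon>)"
      unfolding powr_add [symmetric] by (rule arg_cong[of _ _ "(powr) Q"]) simp
    finally have 2: "C2 * real h ^ (2 * s) * Q powr (1/2 + \<delta>) \<le> real h ^ (2 * s) * Q powr (1/2 + \<epsilon>)" .
    show "M (2 * s) Q \<alpha> u h \<le> real h powr (real s + \<epsilon>) * real (prime_pi Q) + real h ^ (2 * s) * Q powr (1/2 + \<epsilon>)"
      using M_bound[OF grh \<delta>(1,2) Q(3) hu uQ \<alpha>, of s] 1 2 unfolding C2_def by linarith
  qed
qed

end
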